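(* Let $\alpha$ be a positive number, and let $f_\alpha$ be the density of the free Gamma distribution $\nu_\alpha$. Then \[ \lim_{\xi\to\infty}\frac{f_\alpha(\xi)}{\xi^{-1}e^{-\xi}}=\alpha e^{\alpha}. \]
   Context: For $\alpha>0$ the free Gamma distribution $\nu_\alpha=\Lambda(\mu_\alpha)$ is the image under the Bercovici–Pata bijection $\Lambda$ of the classical Gamma distribution $\mu_\alpha(dt)=\frac1{\Gamma(\alpha)}t^{\alpha-1}e^{-t}1_{[0,\infty)}(t)\,dt$. ($\Lambda$ sends the $*$-infinitely divisible law with Lévy–Khintchine triplet $(a,\rho,\eta)$ to the law, infinitely divisible for free additive convolution, whose free cumulant transform $\mathcal{C}(z)=zG^{\langle-1\rangle}(z)-1$, with $G$ the Cauchy transform, equals $\eta z+az^2+\int_{\mathbb{R}}(\frac1{1-tz}-1-tz1_{[-1,1]}(t))\,\rho(dt)$.) The measure $\nu_\alpha$ is absolutely continuous, and its density $f_\alpha$ is the following function. For $z\in\mathbb{C}\setminus[0,\infty)$ put $H_\alpha(z)=z+\alpha+\alpha\int_0^\infty\frac{te^{-t}}{z-t}\,dt$ and $F(z)=\int_0^\infty\frac{te^{-t}}{|z-t|^2}\,dt$. $c_\alpha$ is the unique positive number with $F(-c_\alpha)=\frac1\alpha$. $v_\alpha\colon\mathbb{R}\to[0,\infty)$ is given by $v_\alpha(x)=0$ for $x\le-c_\alpha$, and for $x>-c_\alpha$, $v_\alpha(x)$ is the unique $y>0$ with $F(x+\mathrm{i}y)=\frac1\alpha$. Then $H_\alpha(x+\mathrm{i}v_\alpha(x))\in\mathbb{R}$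 for all $x\in\mathbb{R}$, and $P_\alpha(x)=H_\alpha(x+\mathrm{i}v_\alpha(x))$ defines a strictly increasing bijection $P_\alpha\colon\mathbb{R}\to\mathbb{R}$ with inverse $P_\alpha^{\langle-1\rangle}$. Put $s_\alpha=P_\alpha(-c_\alpha)$ and $Q_\alpha(x)=\frac{v_\alpha(x)}{x^2+v_\alpha(x)^2}$. Then $f_\alpha(\xi)=0$ for $\xi\le s_\alpha$ and $f_\alpha(\xi)=\frac1\pi Q_\alpha(P_\alpha^{\langle-1\rangle}(\xi))$ for $\xi>s_\alpha$. *)

theory Defs
  imports "HOL-Probability.Probability"
begin

section \<open>The Bercovici--Pata bijection\<close>

definition levy_measure :: "real measure \<Rightarrow> bool" where
  "levy_measure \<rho> \<longleftrightarrow> sets \<rho> = sets borel \<and> emeasure \<rho> {0} = 0 \<and>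
     (\<integral>\<^sup>+ t. ennreal (min 1 (t\<^sup>2)) \<partial>\<rho>) < \<infinity>"

text \<open>
  The term linear in \<open>t\<close> is cut off by the indicator of \<open>[-1,1]\<close>, and the Gaussian part enters
  as \<open>- a u\<^sup>2 / 2\<close>. These conventions match those of \<open>free_levy_khintchine\<close> below.
\<close>

definition levy_khintchine_triplet ::
    "real measure \<Rightarrow> real \<Rightarrow> real measure \<Rightarrow> real \<Rightarrow> bool" where
  "levy_khintchine_triplet \<mu> a \<rho> \<eta> \<longleftrightarrow> 0 \<le> a \<and> levy_measure \<rho> \<and>
     (\<forall>u::real. char \<mu> u =
        exp (\<i> * of_real (\<eta> * u) - of_real (a * u\<^sup>2 / 2) +
          (CLINT t|\<rho>. exp (\<i> * of_real (u * t)) - 1 -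
             \<i> * of_real (u * t) * indicator {-1..1} t)))"

definition cauchy_transform :: "real measure \<Rightarrow> complex \<Rightarrow> complex" where
  "cauchy_transform \<nu> z = (CLINT t|\<nu>. 1 / (z - of_real t))"

definition truncated_cone :: "real \<Rightarrow> real \<Rightarrow> complex set" where
  "truncated_cone \<theta> M = {w. \<bar>Re w\<bar> < \<theta> * Im w \<and> M < Im w}"

text \<open>
  The Cauchy transform is inverted near infinity: it is injective on some truncated cone, and the
  image of that cone contains the reciprocals of a second one, which lie in the lower half-plane
  and accumulate at \<open>0\<close>. The free cumulant transform is \<open>z G\<^sup>-\<^sup>1(z) - 1\<close> for such \<open>z\<close>.
  It is analytic there, so it is determined by its values on a single such region.
\<close>

definition has_free_cumulant_transform :: "real measure \<Rightarrow> (complex \<Rightarrow> complex) \<Rightarrow> bool" where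
  "has_free_cumulant_transform \<nu> C \<longleftrightarrow>
     (\<exists>\<theta>>0. \<exists>M>0. \<exists>\<theta>'>0. \<exists>M'>0.
        inj_on (cauchy_transform \<nu>) (truncated_cone \<theta> M) \<and>
        inverse ` truncated_cone \<theta>' M' \<subseteq> cauchy_transform \<nu> ` truncated_cone \<theta> M \<and>
        (\<forall>z \<in> inverse ` truncated_cone \<theta>' M'.
           C z = z * inv_into (truncated_cone \<theta> M) (cauchy_transform \<nu>) z - 1))"

definition free_levy_khintchine :: "real \<Rightarrow> real measure \<Rightarrow> real \<Rightarrow> complex \<Rightarrow> complex" where
  "free_levy_khintchine a \<rho> \<eta> z = of_real \<eta> * z + of_real a * z\<^sup>2 +
     (CLINT t|\<rho>. 1 / (1 - of_real t * z) - 1 - of_real t * z * indicator {-1..1} t)"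

text \<open>The graph of the bijection: \<open>\<nu> = \<Lambda>(\<mu>)\<close>.\<close>

definition bercovici_pata :: "real measure \<Rightarrow> real measure \<Rightarrow> bool" where
  "bercovici_pata \<mu> \<nu> \<longleftrightarrow> real_distribution \<mu> \<and> real_distribution \<nu> \<and>
     (\<exists>a \<rho> \<eta>. levy_khintchine_triplet \<mu> a \<rho> \<eta> \<and>
        has_free_cumulant_transform \<nu> (free_levy_khintchine a \<rho> \<eta>))"


section \<open>The free Gamma distributions\<close>

definition gamma_law :: "real \<Rightarrow> real measure" where
  "gamma_law \<alpha> = density lborel
     (\<lambda>t. ennreal (1 / Gamma \<alpha> * t powr (\<alpha> - 1) * exp (- t) * indicator {0..} t))"

definition is_free_gamma_law :: "real \<Rightarrow> real measure \<Rightarrow> bool" where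
  "is_free_gamma_law \<alpha> \<nu> \<longleftrightarrow> bercovici_pata (gamma_law \<alpha>) \<nu>"

text \<open>
  \<open>fg_H\<close> and \<open>fg_F\<close> are only meaningful off the half-line \<open>[0,\<infinity>)\<close>, and are only used there.
\<close>

definition fg_H :: "real \<Rightarrow> complex \<Rightarrow> complex" where
  "fg_H \<alpha> z = z + of_real \<alpha> +
     of_real \<alpha> * (LBINT t:{0..}. of_real (t * exp (- t)) / (z - of_real t))"

definition fg_F :: "complex \<Rightarrow> real" where
  "fg_F z = (LBINT t:{0..}. t * exp (- t) / (cmod (z - of_real t))\<^sup>2)"

definition fg_c :: "real \<Rightarrow> real" where
  "fg_c \<alpha> = (THE c. 0 < c \<and> fg_F (of_real (- c)) = 1 / \<alpha>)"

definition fg_v :: "real \<Rightarrow> real \<Rightarrow> real" where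
  "fg_v \<alpha> x = (if x \<le> - fg_c \<alpha> then 0 else (THE y. 0 < y \<and> fg_F (Complex x y) = 1 / \<alpha>))"

text \<open>\<open>fg_H \<alpha>\<close> is real on the graph of \<open>fg_v \<alpha>\<close>, so taking the real part loses nothing.\<close>

definition fg_P :: "real \<Rightarrow> real \<Rightarrow> real" where
  "fg_P \<alpha> x = Re (fg_H \<alpha> (Complex x (fg_v \<alpha> x)))"

definition fg_s :: "real \<Rightarrow> real" where
  "fg_s \<alpha> = fg_P \<alpha> (- fg_c \<alpha>)"

definition fg_Q :: "real \<Rightarrow> real \<Rightarrow> real" where
  "fg_Q \<alpha> x = fg_v \<alpha> x / (x\<^sup>2 + (fg_v \<alpha> x)\<^sup>2)"

text \<open>
  A density is determined by its law only almost everywhere; this is the version whose pointwise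
  behaviour is studied.
\<close>

definition free_gamma_density :: "real \<Rightarrow> real \<Rightarrow> real" where
  "free_gamma_density \<alpha> \<xi> =
     (if \<xi> \<le> fg_s \<alpha> then 0 else 1 / pi * fg_Q \<alpha> (inv (fg_P \<alpha>) \<xi>))"

end

theory Submission
  imports Defs "HOL-Complex_Analysis.Complex_Analysis" "HOL-Real_Asymp.Real_Asymp"
begin

text \<open>
  Write \<open>G\<close> for the Cauchy transform of the free Gamma law \<open>\<nu>\<close>. The explicit density
  comes from the functional equation \<open>H (1 / G z) = z\<close> on the upper half plane, where \<open>H\<close> is
  \<open>fg_H \<alpha>\<close>, and its tail from the shape of the curve on which \<open>F\<close>, that is \<open>fg_F\<close>, equals \<open>1 / \<alpha>\<close>.

  \<^emph>\<open>The functional equation.\<close> Near the imaginary axis it says that the free cumulant transform of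
  \<open>\<nu>\<close> is the one attached to the classical Gamma law. It has to be derived from an arbitrary
  Levy--Khintchine triplet of that law. Uniqueness of triplets is avoided as follows. If \<open>\<psi>\<close> is the
  exponent of the triplet, then integrating \<open>\<psi> (\<zeta> x)\<close> against the exponential law in \<open>x\<close> gives the free
  Levy--Khintchine expression at \<open>\<i> \<zeta>\<close> (\<open>free_levy_khintchine_imaginary\<close>), because the mean
  of \<open>e\<^sup>i\<^sup>\<zeta>\<^sup>x\<^sup>t\<close> is \<open>1 / (1 - \<i> \<zeta> t)\<close>. So only \<open>\<psi>\<close> matters, and \<open>\<psi>\<close> is forced to be
  \<open>- \<alpha> Ln (1 - \<i> u)\<close>, the continuous logarithm of the characteristic function of the Gamma law
  (\<open>lk_exponent_gamma_law\<close>). An integration by parts turns this into \<open>fg_H \<alpha>\<close>. The equation then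
  propagates to the whole half plane by analytic continuation, since \<open>1 / G\<close> maps the half plane to
  itself (\<open>free_gamma_subordination\<close>).

  \<^emph>\<open>The density.\<close> The imaginary part of \<open>H w\<close> is \<open>Im w (1 - \<alpha> F w)\<close>, so \<open>1 / G\<close> takes its values in the
  region \<open>F < 1 / \<alpha>\<close>. The function \<open>F\<close> blows up at the half line \<open>[0,\<infinity>)\<close>. Hence the closed region
  \<open>F \<le> 1 / \<alpha>\<close> of the closed half plane does not meet that half line, \<open>H\<close> is continuous on it and
  differs from a translation by at most \<open>sqrt \<alpha>\<close>, and it is injective there (\<open>inj_on_fg_H\<close>). It follows
  that \<open>G\<close> is bounded, because 0 has positive distance from the region, and that \<open>1 / G\<close> extends continuously to the real line, with boundary value at
  \<open>P x\<close> equal to the point \<open>x + \<i> v x\<close> of the boundary of the region. Stieltjes inversion for bounded Cauchy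
  transforms gives the density.

  \<^emph>\<open>The tail.\<close> For large \<open>x\<close>, the integral \<open>y F (x + \<i> y)\<close> is a Poisson integral of \<open>t e\<^sup>-\<^sup>t\<close> and is close to
  \<open>\<pi> x e\<^sup>-\<^sup>x\<close> when \<open>y\<close> is as small as \<open>v x\<close>. Equating it with \<open>y / \<alpha>\<close> yields \<open>v x \<sim> \<pi> \<alpha> x e\<^sup>-\<^sup>x\<close>
  (\<open>fg_v_asymp\<close>). The Hilbert transform of \<open>t e\<^sup>-\<^sup>t\<close> tends to 0, so \<open>P x - x\<close> tends to \<open>\<alpha>\<close>
  (\<open>fg_P_asymp\<close>), and this shift is the source of the factor \<open>e\<^sup>\<alpha>\<close> in the limit.
\<close>

section \<open>Integrals depending on a parameter\<close>

lemma isCont_integral_dominated: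
  fixes f :: "'b::{t2_space,first_countable_topology} \<Rightarrow> 'a \<Rightarrow> 'c::{banach,second_countable_topology}"
  assumes meas: "\<And>w. f w \<in> borel_measurable M"
    and U: "open U" "z \<in> U"
    and g: "integrable M g" "\<And>w. w \<in> U \<Longrightarrow> AE t in M. norm (f w t) \<le> g t"
    and cont: "AE t in M. isCont (\<lambda>w. f w t) z"
  shows "isCont (\<lambda>w. \<integral>t. f w t \<partial>M) z"
  unfolding continuous_within tendsto_at_iff_sequentially comp_def
proof (intro allI impI)
  fix X :: "nat \<Rightarrow> 'b"
  assume "\<forall>i. X i \<in> UNIV - {z}" and X: "X \<longlonglongrightarrow> z"
  obtain N where N: "\<And>n. n \<ge> N \<Longrightarrow> X n \<in> U"
    using topological_tendstoD[OF X U] by (auto simp: eventually_sequentially)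
  have "(\<lambda>n. \<integral>t. f (X (n + N)) t \<partial>M) \<longlonglongrightarrow> (\<integral>t. f z t \<partial>M)"
  proof (rule integral_dominated_convergence[where w = g])
    show "AE t in M. (\<lambda>n. f (X (n + N)) t) \<longlonglongrightarrow> f z t"
      using cont
    proof eventually_elim
      case (elim t)
      show ?case
        using isCont_tendsto_compose[OF elim LIMSEQ_ignore_initial_segment[OF X]] .
    qed
  qed (use N g meas in auto)
  then show "(\<lambda>n. \<integral>t. f (X n) t \<partial>M) \<longlonglongrightarrow> (\<integral>t. f z t \<partial>M)"
    by (rule LIMSEQ_offset)
qed

text \<open>
  Differentiation under the integral sign. A local integrable bound on \<open>f\<close> alone is enough:
  Cauchy's inequality converts it into a bound on the derivative, hence on the difference quotients,
  and dominated convergence applies.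
\<close>

lemma holomorphic_on_integral:
  fixes f :: "complex \<Rightarrow> 'a \<Rightarrow> complex"
  assumes meas: "\<And>z. f z \<in> borel_measurable M"
    and S: "open S"
    and holo: "AE t in M. (\<lambda>z. f z t) holomorphic_on S"
    and bound: "\<And>z. z \<in> S \<Longrightarrow>
      \<exists>e>0. \<exists>g. integrable M g \<and> (AE t in M. \<forall>w\<in>ball z e. norm (f w t) \<le> g t)"
  shows "(\<lambda>z. \<integral>t. f z t \<partial>M) holomorphic_on S"
  unfolding holomorphic_on_open[OF S]
proof
  fix z assume z: "z \<in> S"
  obtain e g where e: "e > 0" and g: "integrable M g"
    and fg: "AE t in M. \<forall>w\<in>ball z e. norm (f w t) \<le> g t"
    using bound[OF z] by blast
  obtain e' where e': "e' > 0" "ball z e' \<subseteq> S"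
    using S z open_contains_ball by blast
  define r where "r = min e e' / 4"
  have r: "r > 0" using e e' by (simp add: r_def)
  have sub: "cball u r \<subseteq> ball z e" "cball u r \<subseteq> S" if "u \<in> ball z r" for u
  proof -
    have "cball u r \<subseteq> ball z (min e e')"
    proof
      fix w assume "w \<in> cball u r"
      then have "dist z w \<le> r + r" 
        using that dist_triangle[of z w u] by simp
      then show "w \<in> ball z (min e e')" using r by (simp add: r_def)
    qed
    moreover have "ball z (min e e') \<subseteq> ball z e" "ball z (min e e') \<subseteq> ball z e'"
      by auto
    ultimately show "cball u r \<subseteq> ball z e" "cball u r \<subseteq> S"
      using e'(2) by blast+
  qed
  have int: "integrable M (f w)" if "w \<in> ball z r" for w
  proof (rule Bochner_Integration.integrable_bound[OF g meas])
    have "w \<in> ball z e"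
      using sub(1)[OF that] r by (meson centre_in_cball less_imp_le subsetD)
    then show "AE t in M. norm (f w t) \<le> norm (g t)"
      using fg by (fastforce elim!: eventually_mono)
  qed
  define q where "q h t = (f (z + h) t - f z t) / h" for h t
  \<comment> \<open>The difference quotient is at most the supremum of the derivative on the ball, and that is
    at most \<open>g t / r\<close> because the disc of radius \<open>r\<close> around each point lies where \<open>g t\<close> bounds \<open>f\<close>.\<close>
  have q_bound: "AE t in M. norm (q h t) \<le> g t / r" if h: "h \<noteq> 0" "norm h < r" for h
    using fg holo
  proof eventually_elim
    case (elim t)
    have der: "norm (deriv (\<lambda>z. f z t) u) \<le> g t / r" if u: "u \<in> ball z r" for u
    proof -
      have "norm ((deriv ^^ 1) (\<lambda>z. f z t) u) \<le> fact 1 * g t / r ^ 1"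
      proof (rule Cauchy_inequality[OF _ _ r])
        show "(\<lambda>z. f z t) holomorphic_on ball u r"
          using elim(2) sub(2)[OF u] by (meson ball_subset_cball holomorphic_on_subset)
        show "continuous_on (cball u r) (\<lambda>z. f z t)"
          using elim(2) sub(2)[OF u]
          by (meson holomorphic_on_imp_continuous_on continuous_on_subset)
        show "norm (f x t) \<le> g t" if "norm (u - x) = r" for x
          using elim(1) sub(1)[OF u] that by (auto simp: dist_norm subset_eq)
      qed
      then show ?thesis by simp
    qed
    have "norm (f (z + h) t - f z t) \<le> (g t / r) * norm ((z + h) - z)"
    proof (rule field_differentiable_bound[of "ball z r" "\<lambda>z. f z t"])
      fix u assume u: "u \<in> ball z r"
      have "u \<in> S" using sub(2)[OF u] r by auto
      then have "(\<lambda>z. f z t) field_differentiable at u"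
        using elim(2) S by (simp add: holomorphic_on_imp_differentiable_at)
      then show "((\<lambda>z. f z t) has_field_derivative deriv (\<lambda>z. f z t) u) (at u within ball z r)"
        by (simp add: field_differentiable_derivI has_field_derivative_at_within)
      show "norm (deriv (\<lambda>z. f z t) u) \<le> g t / r" by (rule der[OF u])
    qed (use h r in \<open>auto simp: dist_norm\<close>)
    then show ?case
      using h by (simp add: q_def norm_divide divide_le_eq)
  qed
  \<comment> \<open>The derivative, written as a limit along one sequence so that it is visibly measurable.\<close>
  define d where "d t = lim (\<lambda>n. q (inverse (of_nat (Suc n))) t)" for t
  have q_lim: "AE t in M. ((\<lambda>h. q h t) \<longlongrightarrow> d t) (at 0)"
    using holo
  proof eventually_elim
    case (elim t)
    have "(\<lambda>z. f z t) field_differentiable at z"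
      using elim S z by (simp add: holomorphic_on_imp_differentiable_at)
    then obtain D where "((\<lambda>z. f z t) has_field_derivative D) (at z)"
      by (auto simp: field_differentiable_def)
    then have D: "((\<lambda>h. q h t) \<longlongrightarrow> D) (at 0)"
      by (simp add: DERIV_def q_def)
    have "filterlim (\<lambda>n. inverse (of_nat (Suc n)) :: complex) (at 0) sequentially"
      unfolding filterlim_at
      using LIMSEQ_Suc[OF lim_inverse_n[where ?'a = complex]]
      by (auto simp: field_simps simp del: of_nat_Suc)
    then have "(\<lambda>n. q (inverse (of_nat (Suc n))) t) \<longlonglongrightarrow> D"
      by (rule filterlim_compose[OF D])
    then show ?case
      using D by (simp add: d_def limI)
  qed
  have q_meas: "q h \<in> borel_measurable M" for h
    unfolding q_def using meas by measurable
  have d_meas: "d \<in> borel_measurable M"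
    unfolding d_def using q_meas by measurable
  have "((\<lambda>z. \<integral>t. f z t \<partial>M) has_field_derivative (\<integral>t. d t \<partial>M)) (at z)"
    unfolding DERIV_def tendsto_at_iff_sequentially comp_def
  proof (intro allI impI)
    fix X :: "nat \<Rightarrow> complex"
    assume X0: "\<forall>i. X i \<in> UNIV - {0}" and X: "X \<longlonglongrightarrow> 0"
    obtain N where N: "\<And>n. n \<ge> N \<Longrightarrow> norm (X n) < r"
      using LIMSEQ_D[OF X r] by auto
    have lim: "(\<lambda>n. \<integral>t. q (X (n + N)) t \<partial>M) \<longlonglongrightarrow> (\<integral>t. d t \<partial>M)"
    proof (rule integral_dominated_convergence[where w = "\<lambda>t. g t / r"])
      show "AE t in M. (\<lambda>n. q (X (n + N)) t) \<longlonglongrightarrow> d t"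
        using q_lim
      proof eventually_elim
        case (elim t)
        have "filterlim (\<lambda>n. X (n + N)) (at 0) sequentially"
          unfolding filterlim_at using X0 LIMSEQ_ignore_initial_segment[OF X] by auto
        then show ?case by (rule filterlim_compose[OF elim])
      qed
      show "AE t in M. norm (q (X (n + N)) t) \<le> g t / r" for n
        using X0 N by (intro q_bound) auto
    qed (use g d_meas q_meas in auto)
    have eq: "((\<integral>t. f (z + X (n + N)) t \<partial>M) - (\<integral>t. f z t \<partial>M)) / X (n + N)
      = (\<integral>t. q (X (n + N)) t \<partial>M)" for n
    proof -
      have "integrable M (f (z + X (n + N)))" "integrable M (f z)"
        using N r by (auto intro!: int simp: dist_norm)
      then show ?thesis by (simp add: q_def)
    qed
    show "(\<lambda>n. ((\<integral>t. f (z + X n) t \<partial>M) - (\<integral>t. f z t \<partial>M)) / X n) \<longlonglongrightarrow> (\<integral>t. d t \<partial>M)"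
      by (rule LIMSEQ_offset[where k = N]) (use lim eq in simp)
  qed
  then show "\<exists>D. ((\<lambda>z. \<integral>t. f z t \<partial>M) has_field_derivative D) (at z)" by blast
qed

section \<open>The functions F and H off the half line\<close>

definition slit_plane :: "complex set" where
  "slit_plane = {z. Im z \<noteq> 0 \<or> Re z < 0}"

lemma open_slit_plane: "open slit_plane"
  unfolding slit_plane_def
  by (intro open_Collect_disj open_Collect_neq open_Collect_less continuous_intros)

lemma not_in_slit_plane_iff: "z \<notin> slit_plane \<longleftrightarrow> (\<exists>x\<ge>0. z = of_real x)"
  by (auto simp: slit_plane_def complex_eq_iff not_less)

lemma slit_plane_dist:
  assumes "z \<in> slit_plane"
  obtains d where "d > 0" "\<And>w t. w \<in> ball z d \<Longrightarrow> 0 \<le> t \<Longrightarrow> d \<le> cmod (w - of_real t)"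
proof -
  obtain e where e: "e > 0" "ball z e \<subseteq> slit_plane"
    using assms open_slit_plane open_contains_ball by blast
  show ?thesis
  proof (rule that[of "e / 2"])
    fix w t assume w: "w \<in> ball z (e / 2)" and t: "(0::real) \<le> t"
    show "e / 2 \<le> cmod (w - of_real t)"
    proof (rule ccontr)
      assume "\<not> ?thesis"
      then have "dist z (of_real t) < e"
        using w dist_triangle_half_r[of w z e "of_real t"] by (simp add: dist_norm norm_minus_commute)
      then have "of_real t \<in> slit_plane" using e by auto
      then show False using t by (simp add: slit_plane_def)
    qed
  qed (use e in auto)
qed

text \<open>
  The Gamma law with parameter 2. Both \<open>fg_F\<close> and \<open>fg_H\<close> are integrals against it, and \<open>fg_H\<close> is
  affine in its Cauchy transform.
\<close>

definition gamma2 :: "real measure" where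
  "gamma2 = density lborel (\<lambda>t. ennreal (erlang_density 1 1 t))"

interpretation gamma2: prob_space gamma2
  unfolding gamma2_def by (rule prob_space_erlang_density) simp

lemma sets_gamma2 [measurable_cong, simp]: "sets gamma2 = sets borel"
  by (simp add: gamma2_def)

lemma space_gamma2 [simp]: "space gamma2 = UNIV"
  by (simp add: gamma2_def)

lemma AE_gamma2_pos: "AE t in gamma2. t > 0"
  unfolding gamma2_def
  by (subst AE_density) (auto simp: erlang_density_def zero_less_mult_iff)

lemma integral_gamma2:
  fixes f :: "real \<Rightarrow> 'a::{banach,second_countable_topology}"
  assumes [measurable]: "f \<in> borel_measurable borel"
  shows "(\<integral>t. f t \<partial>gamma2) = (LBINT t:{0..}. (t * exp (- t)) *\<^sub>R f t)"
proof -
  have "(\<integral>t. f t \<partial>gamma2) = (\<integral>t. erlang_density 1 1 t *\<^sub>R f t \<partial>lborel)"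
    unfolding gamma2_def by (rule integral_density) auto
  also have "\<dots> = (LBINT t:{0..}. (t * exp (- t)) *\<^sub>R f t)"
    unfolding set_lebesgue_integral_def
    by (intro Bochner_Integration.integral_cong) (auto simp: erlang_density_def indicator_def)
  finally show ?thesis .
qed

lemma fg_F_gamma2: "fg_F z = (\<integral>t. 1 / (cmod (z - of_real t))\<^sup>2 \<partial>gamma2)"
  unfolding fg_F_def by (subst integral_gamma2) auto

lemma fg_H_gamma2: "fg_H \<alpha> z = z + of_real \<alpha> + of_real \<alpha> * cauchy_transform gamma2 z"
  unfolding fg_H_def cauchy_transform_def
  by (subst integral_gamma2) (auto simp: scaleR_conv_of_real)

lemma cauchy_transform_holomorphic:
  assumes "finite_measure M" and M: "sets M = sets borel" and S: "open S"
    and A: "AE t in M. t \<in> A"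
    and away: "\<And>z. z \<in> S \<Longrightarrow> \<exists>d>0. \<forall>w\<in>ball z d. \<forall>t\<in>A. d \<le> cmod (w - of_real t)"
  shows "cauchy_transform M holomorphic_on S"
proof -
  interpret finite_measure M by fact
  have "(\<lambda>z. \<integral>t. 1 / (z - of_real t) \<partial>M) holomorphic_on S"
  proof (rule holomorphic_on_integral[OF _ S])
    show "(\<lambda>t. 1 / (z - of_real t)) \<in> borel_measurable M" for z :: complex
      by (subst measurable_cong_sets[OF M refl]) measurable
    show "AE t in M. (\<lambda>z. 1 / (z - of_real t)) holomorphic_on S"
      using A
    proof eventually_elim
      case (elim t)
      have "z - of_real t \<noteq> 0" if "z \<in> S" for z
        using away[OF that] elim
        by (metis centre_in_ball norm_zero not_less)
      then show ?case by (intro holomorphic_intros)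
    qed
    fix z assume "z \<in> S"
    then obtain d where d: "d > 0" "\<And>w t. w \<in> ball z d \<Longrightarrow> t \<in> A \<Longrightarrow> d \<le> cmod (w - of_real t)"
      using away by blast
    have "AE t in M. \<forall>w\<in>ball z d. cmod (1 / (w - of_real t)) \<le> 1 / d"
      using A
    proof eventually_elim
      case (elim t)
      show ?case
      proof
        fix w assume "w \<in> ball z d"
        then show "cmod (1 / (w - of_real t)) \<le> 1 / d"
          using d(2)[OF _ elim] d(1) frac_le[of 1 1 d "cmod (w - of_real t)"]
          by (simp add: norm_divide)
      qed
    qed
    then show "\<exists>e>0. \<exists>g. integrable M g \<and>
        (AE t in M. \<forall>w\<in>ball z e. cmod (1 / (w - of_real t)) \<le> g t)"
      using d(1) by (intro exI[of _ d] conjI exI[of _ "\<lambda>_. 1 / d"]) auto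
  qed
  then show ?thesis by (simp add: cauchy_transform_def[abs_def])
qed

lemma kernel_bounds:
  assumes "d > 0" "d \<le> cmod (w - of_real t)"
  shows "cmod (1 / (w - of_real t)) \<le> 1 / d" "1 / (cmod (w - of_real t))\<^sup>2 \<le> 1 / d\<^sup>2"
  using frac_le[of 1 1 d "cmod (w - of_real t)"] assms
  by (auto simp: norm_divide intro!: frac_le power_mono)

lemma integrable_cauchy_kernel:
  assumes "z \<in> slit_plane"
  shows "integrable gamma2 (\<lambda>t. 1 / (z - of_real t))"
    and "integrable gamma2 (\<lambda>t. 1 / (cmod (z - of_real t))\<^sup>2)"
proof -
  obtain d where d: "d > 0" "\<And>w t. w \<in> ball z d \<Longrightarrow> 0 \<le> t \<Longrightarrow> d \<le> cmod (w - of_real t)"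
    using slit_plane_dist[OF assms] by blast
  have le: "AE t in gamma2. d \<le> cmod (z - of_real t)"
    using AE_gamma2_pos by eventually_elim (use d in auto)
  show "integrable gamma2 (\<lambda>t. 1 / (z - of_real t))"
  proof (rule gamma2.integrable_const_bound)
    show "AE t in gamma2. cmod (1 / (z - of_real t)) \<le> 1 / d"
      using le by eventually_elim (rule kernel_bounds[OF d(1)])
  qed simp
  show "integrable gamma2 (\<lambda>t. 1 / (cmod (z - of_real t))\<^sup>2)"
  proof (rule gamma2.integrable_const_bound)
    show "AE t in gamma2. norm (1 / (cmod (z - of_real t))\<^sup>2) \<le> 1 / d\<^sup>2"
      using le
    proof eventually_elim
      case (elim t)
      show ?case using kernel_bounds(2)[OF d(1) elim] by simp
    qed
  qed simp
qed

lemma cauchy_transform_gamma2_holomorphic: "cauchy_transform gamma2 holomorphic_on slit_plane"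
proof (rule cauchy_transform_holomorphic[OF gamma2.finite_measure_axioms sets_gamma2 open_slit_plane])
  show "AE t in gamma2. t \<in> {0<..}" using AE_gamma2_pos by simp
  fix z assume "z \<in> slit_plane"
  from slit_plane_dist[OF this]
  show "\<exists>d>0. \<forall>w\<in>ball z d. \<forall>t\<in>{0<..}. d \<le> cmod (w - of_real t)"
    by (metis greaterThan_iff less_imp_le)
qed

lemma fg_H_holomorphic: "fg_H \<alpha> holomorphic_on slit_plane"
  unfolding fg_H_gamma2 by (intro holomorphic_intros cauchy_transform_gamma2_holomorphic)

lemma isCont_fg_H: "z \<in> slit_plane \<Longrightarrow> isCont (fg_H \<alpha>) z"
  using holomorphic_on_imp_continuous_on[OF fg_H_holomorphic] open_slit_plane
  by (simp add: continuous_on_eq_continuous_at)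

lemma isCont_fg_F:
  assumes "z \<in> slit_plane"
  shows "isCont fg_F z"
proof -
  obtain d where d: "d > 0" "\<And>w t. w \<in> ball z d \<Longrightarrow> 0 \<le> t \<Longrightarrow> d \<le> cmod (w - of_real t)"
    using slit_plane_dist[OF assms] by blast
  have "isCont (\<lambda>w. \<integral>t. 1 / (cmod (w - of_real t))\<^sup>2 \<partial>gamma2) z"
  proof (rule isCont_integral_dominated[where U = "ball z d" and g = "\<lambda>_. 1 / d\<^sup>2"])
    show "AE t in gamma2. norm (1 / (cmod (w - of_real t))\<^sup>2) \<le> 1 / d\<^sup>2" if "w \<in> ball z d" for w
      using AE_gamma2_pos
    proof eventually_elim
      case (elim t)
      show ?case using kernel_bounds(2)[OF d(1) d(2)[OF that, of t]] elim by simp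
    qed
    show "AE t in gamma2. isCont (\<lambda>w. 1 / (cmod (w - of_real t))\<^sup>2) z"
      using AE_gamma2_pos
    proof eventually_elim
      case (elim t)
      then have "cmod (z - of_real t) \<noteq> 0" using d(2)[of z t] d(1) by auto
      then show ?case by (intro continuous_intros) auto
    qed
  qed (use d in auto)
  then show ?thesis by (simp add: fg_F_gamma2[abs_def])
qed

lemma fg_F_strict_mono:
  assumes "z \<in> slit_plane" "w \<in> slit_plane"
    and less: "\<And>t. t \<ge> 0 \<Longrightarrow> cmod (z - of_real t) < cmod (w - of_real t)"
  shows "fg_F w < fg_F z"
  unfolding fg_F_gamma2
proof (rule gamma2.integral_less_AE_space)
  show "AE t in gamma2. 1 / (cmod (w - of_real t))\<^sup>2 < 1 / (cmod (z - of_real t))\<^sup>2"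
    using AE_gamma2_pos
  proof eventually_elim
    case (elim t)
    then have "cmod (z - of_real t) \<noteq> 0"
      using assms(1) by (auto simp: slit_plane_def complex_eq_iff)
    then show ?case
      using less[of t] elim by (intro divide_strict_left_mono power_strict_mono mult_pos_pos) auto
  qed
qed (use assms integrable_cauchy_kernel gamma2.emeasure_space_1 in auto)

lemma fg_F_le:
  assumes "d > 0" "\<And>t. t \<ge> 0 \<Longrightarrow> d \<le> cmod (z - of_real t)"
  shows "fg_F z \<le> 1 / d\<^sup>2"
proof -
  have "(\<integral>t. 1 / (cmod (z - of_real t))\<^sup>2 \<partial>gamma2) \<le> (\<integral>t. 1 / d\<^sup>2 \<partial>gamma2)"
  proof (rule integral_mono_AE')
    show "AE t in gamma2. 1 / (cmod (z - of_real t))\<^sup>2 \<le> 1 / d\<^sup>2"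
      using AE_gamma2_pos
    proof eventually_elim
      case (elim t)
      show ?case using kernel_bounds(2)[OF assms(1) assms(2)[of t]] elim by simp
    qed
  qed auto
  then show ?thesis
    by (simp add: fg_F_gamma2 gamma2.prob_space[simplified])
qed

lemma fg_F_le_Im: "y > 0 \<Longrightarrow> fg_F (Complex x y) \<le> 1 / y\<^sup>2"
  by (rule fg_F_le) (use abs_Im_le_cmod[of "Complex x y - of_real t" for t] in \<open>auto\<close>)

lemma fg_F_le_Re: "x > 0 \<Longrightarrow> fg_F (of_real (- x)) \<le> 1 / x\<^sup>2"
  by (rule fg_F_le) (auto simp flip: of_real_diff of_real_minus)

text \<open>
  Within distance \<open>\<delta>\<close> of \<open>x0\<close>, the kernel is at least \<open>1 / (4 s\<^sup>2)\<close> at \<open>t = x0 + s\<close> for \<open>s \<ge> \<delta>\<close>, while the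
  weight \<open>t e\<^sup>-\<^sup>t\<close> is at least a constant times \<open>s\<close>, even for \<open>x0 = 0\<close> where it vanishes. The integral of
  \<open>1 / s\<close> over \<open>[\<delta>,1]\<close> is \<open>ln (1 / \<delta>)\<close>, which is as large as desired.
\<close>

lemma fg_F_blowup:
  assumes x0: "x0 \<ge> 0"
  obtains \<delta> where "\<delta> > 0" "\<And>w. w \<in> slit_plane \<Longrightarrow> w \<in> ball (of_real x0) \<delta> \<Longrightarrow> fg_F w > C"
proof -
  define \<delta> where "\<delta> = exp (- (4 * exp (x0 + 1) * (\<bar>C\<bar> + 1)))"
  have \<delta>: "\<delta> > 0" "\<delta> < 1" by (auto simp: \<delta>_def)
  show ?thesis
  proof (rule that[of \<delta>])
    fix w assume w: "w \<in> slit_plane" and wd: "w \<in> ball (of_real x0) \<delta>"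
    define c where "c = exp (- (x0 + 1)) / 4"
    \<comment> \<open>The factor 4 in \<open>c\<close> comes from \<open>(2 s)\<^sup>2\<close>, and \<open>\<delta>\<close> is chosen to make the left side \<open>\<bar>C\<bar> + 1\<close>.\<close>
    have "c * ln (1 / \<delta>) = (\<integral>t. indicator {x0 + \<delta>..x0 + 1} t *\<^sub>R (c / (t - x0)) \<partial>lborel)"
    proof -
      have "(\<integral>t. indicator {x0 + \<delta>..x0 + 1} t *\<^sub>R (c / (t - x0)) \<partial>lborel)
        = c * ln (x0 + 1 - x0) - c * ln (x0 + \<delta> - x0)"
      proof (rule integral_FTC_atLeastAtMost)
        show "((\<lambda>t. c * ln (t - x0)) has_vector_derivative c / (t - x0))
            (at t within {x0 + \<delta>..x0 + 1})" if "x0 + \<delta> \<le> t" for t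
          unfolding has_real_derivative_iff_has_vector_derivative[symmetric]
          using that \<delta> by (auto intro!: derivative_eq_intros)
      qed (use \<delta> in \<open>auto intro!: continuous_intros\<close>)
      then show ?thesis using \<delta> by (simp add: ln_div)
    qed
    also have "\<dots> \<le> (\<integral>t. indicator {0..} t *\<^sub>R (t * exp (- t) / (cmod (w - of_real t))\<^sup>2) \<partial>lborel)"
    proof (rule integral_mono')
      have "integrable gamma2 (\<lambda>t. 1 / (cmod (w - of_real t))\<^sup>2)"
        using integrable_cauchy_kernel w by blast
      then have "integrable lborel (\<lambda>t. erlang_density 1 1 t *\<^sub>R (1 / (cmod (w - of_real t))\<^sup>2))"
        unfolding gamma2_def by (subst (asm) integrable_density) auto
      then show "integrable lborel (\<lambda>t. indicator {0..} t *\<^sub>R (t * exp (- t) / (cmod (w - of_real t))\<^sup>2))"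
        by (rule Bochner_Integration.integrable_cong[THEN iffD1, rotated -1])
           (auto simp: erlang_density_def indicator_def)
      fix t :: real
      show "0 \<le> indicator {0..} t *\<^sub>R (t * exp (- t) / (cmod (w - of_real t))\<^sup>2)"
        by (auto simp: indicator_def)
      show "indicator {x0 + \<delta>..x0 + 1} t *\<^sub>R (c / (t - x0))
          \<le> indicator {0..} t *\<^sub>R (t * exp (- t) / (cmod (w - of_real t))\<^sup>2)"
      proof (cases "t \<in> {x0 + \<delta>..x0 + 1}")
        case True
        define s where "s = t - x0"
        have s: "s > 0" "s \<ge> \<delta>" "t = x0 + s" "s \<le> 1" using True \<delta> by (auto simp: s_def)
        have "cmod (w - of_real t) \<le> cmod (w - of_real x0) + cmod (of_real x0 - of_real t)"
          by (metis norm_triangle_ineq diff_add_cancel add_diff_eq)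
        also have "cmod (of_real x0 - of_real t) = s"
          using s by (simp flip: of_real_diff)
        also have "cmod (w - of_real x0) \<le> s"
          using wd s by (simp add: dist_norm norm_minus_commute)
        finally have le: "cmod (w - of_real t) \<le> 2 * s" by simp
        have ne: "cmod (w - of_real t) > 0"
          using w s x0 by (auto simp: slit_plane_def complex_eq_iff)
        have "c / s = (s * exp (- (x0 + 1))) / (2 * s)\<^sup>2"
          using s by (simp add: c_def power2_eq_square field_simps)
        also have "\<dots> \<le> (t * exp (- t)) / (cmod (w - of_real t))\<^sup>2"
        proof (intro frac_le mult_mono power_mono)
          show "0 \<le> t * exp (- t)" "0 \<le> t" using s(1,3) x0 by auto
        qed (use s x0 le ne in auto)
        finally show ?thesis using True s x0 by simp
      next
        case False
        then show ?thesis by (auto simp: indicator_def)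
      qed
    qed
    also have "\<dots> = fg_F w" by (simp add: fg_F_def set_lebesgue_integral_def)
    finally have "c * ln (1 / \<delta>) \<le> fg_F w" .
    moreover have "c * ln (1 / \<delta>) = \<bar>C\<bar> + 1"
    proof -
      have "exp (- (x0 + 1)) * exp (x0 + 1) = 1" by (simp flip: exp_add)
      then show ?thesis by (simp add: c_def \<delta>_def ln_div)
    qed
    ultimately show "C < fg_F w" by linarith
  qed (use \<delta> in auto)
qed

section \<open>The curve F = 1/alpha\<close>

lemma fg_F_strict_anti_Im:
  assumes "Complex x y \<in> slit_plane" "0 \<le> y" "y < y'"
  shows "fg_F (Complex x y') < fg_F (Complex x y)"
proof (rule fg_F_strict_mono)
  fix t :: real
  show "cmod (Complex x y - of_real t) < cmod (Complex x y' - of_real t)"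
    using assms by (auto simp: cmod_def intro!: power_strict_mono)
qed (use assms in \<open>auto simp: slit_plane_def\<close>)

lemma fg_F_strict_mono_neg:
  assumes "x < x'" "x' < 0"
  shows "fg_F (of_real x) < fg_F (of_real x')"
  by (rule fg_F_strict_mono) (use assms in \<open>auto simp: slit_plane_def simp flip: of_real_diff\<close>)

lemma fg_F_eq_on_negative_axis:
  assumes "\<alpha> > 0"
  shows "\<exists>c>0. fg_F (of_real (- c)) = 1 / \<alpha>"
proof -
  obtain \<delta> where \<delta>: "\<delta> > 0" "\<And>w. w \<in> slit_plane \<Longrightarrow> w \<in> ball (of_real 0) \<delta> \<Longrightarrow> fg_F w > 1 / \<alpha>"
    using fg_F_blowup[of 0 "1 / \<alpha>"] by auto
  define a where "a = max (\<delta> / 2) (sqrt \<alpha>)"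
  have a: "a > 0" "\<delta> / 2 \<le> a" "sqrt \<alpha> \<le> a" using \<delta> by (auto simp: a_def)
  have "fg_F (of_real (- a)) \<le> 1 / a\<^sup>2" using a by (intro fg_F_le_Re)
  also have "\<dots> \<le> 1 / \<alpha>"
    using assms a power_mono[of "sqrt \<alpha>" a 2] by (intro divide_left_mono) auto
  finally have 1: "fg_F (of_real (- a)) \<le> 1 / \<alpha>" .
  have 2: "1 / \<alpha> \<le> fg_F (of_real (- (\<delta> / 2)))"
    using \<delta> by (intro less_imp_le[OF \<delta>(2)]) (auto simp: slit_plane_def)
  have "\<exists>x\<ge>-a. x \<le> - (\<delta> / 2) \<and> fg_F (of_real x) = 1 / \<alpha>"
  proof (rule IVT')
    show "continuous_on {- a..- (\<delta> / 2)} (\<lambda>x. fg_F (of_real x))"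
      using \<delta>
      by (intro continuous_at_imp_continuous_on ballI isCont_o2[OF _ isCont_fg_F])
         (auto simp: slit_plane_def)
  qed (use 1 2 a in auto)
  then obtain x where "x \<le> - (\<delta> / 2)" "fg_F (of_real x) = 1 / \<alpha>" by blast
  then show ?thesis using \<delta> by (intro exI[of _ "- x"]) auto
qed

lemma fg_c:
  assumes "\<alpha> > 0"
  shows fg_c_pos: "fg_c \<alpha> > 0" and fg_F_fg_c: "fg_F (of_real (- fg_c \<alpha>)) = 1 / \<alpha>"
proof -
  have "\<exists>!c. 0 < c \<and> fg_F (of_real (- c)) = 1 / \<alpha>"
  proof (rule ex_ex1I)
    fix c c' assume "0 < c \<and> fg_F (of_real (- c)) = 1 / \<alpha>" "0 < c' \<and> fg_F (of_real (- c')) = 1 / \<alpha>"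
    then show "c = c'"
      using fg_F_strict_mono_neg[of "- c" "- c'"] fg_F_strict_mono_neg[of "- c'" "- c"]
      by (cases c c' rule: linorder_cases) auto
  qed (use fg_F_eq_on_negative_axis[OF assms] in blast)
  from theI'[OF this] show "fg_c \<alpha> > 0" "fg_F (of_real (- fg_c \<alpha>)) = 1 / \<alpha>"
    unfolding fg_c_def by auto
qed

lemma fg_F_le_iff_neg:
  assumes "\<alpha> > 0" "x < 0"
  shows "fg_F (of_real x) \<le> 1 / \<alpha> \<longleftrightarrow> x \<le> - fg_c \<alpha>"
  using fg_F_strict_mono_neg[of x "- fg_c \<alpha>"] fg_F_strict_mono_neg[of "- fg_c \<alpha>" x]
    fg_F_fg_c[OF assms(1)] fg_c_pos[OF assms(1)] assms
  by (cases x "- fg_c \<alpha>" rule: linorder_cases) auto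

lemma fg_F_eq_on_vertical_line:
  assumes "\<alpha> > 0" and x: "x > - fg_c \<alpha>"
  shows "\<exists>y>0. fg_F (Complex x y) = 1 / \<alpha>"
proof -
  have "\<exists>b>0. fg_F (Complex x b) > 1 / \<alpha>"
  proof (cases "x < 0")
    case True
    have "isCont fg_F (Complex x 0)"
      using True by (intro isCont_fg_F) (auto simp: slit_plane_def)
    moreover have "(\<lambda>n. Complex x (inverse (real (Suc n)))) \<longlonglongrightarrow> Complex x 0"
      by (intro tendsto_Complex tendsto_const LIMSEQ_inverse_real_of_nat)
    ultimately have "(\<lambda>n. fg_F (Complex x (inverse (real (Suc n))))) \<longlonglongrightarrow> fg_F (Complex x 0)"
      by (rule isCont_tendsto_compose)
    moreover have "fg_F (Complex x 0) > 1 / \<alpha>"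
      using fg_F_le_iff_neg[OF assms(1) True] x by (simp add: complex_of_real_def)
    ultimately have "eventually (\<lambda>n. fg_F (Complex x (inverse (real (Suc n)))) > 1 / \<alpha>) sequentially"
      by (rule order_tendstoD)
    then obtain n where "fg_F (Complex x (inverse (real (Suc n)))) > 1 / \<alpha>"
      using eventually_happens'[OF sequentially_bot] by blast
    then show ?thesis by (intro exI[of _ "inverse (real (Suc n))"]) auto
  next
    case False
    then obtain \<delta> where \<delta>: "\<delta> > 0" "\<And>w. w \<in> slit_plane \<Longrightarrow> w \<in> ball (of_real x) \<delta> \<Longrightarrow> fg_F w > 1 / \<alpha>"
      using fg_F_blowup[of x "1 / \<alpha>"] by auto
    have "fg_F (Complex x (\<delta> / 2)) > 1 / \<alpha>"
    proof (rule \<delta>(2))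
      show "Complex x (\<delta> / 2) \<in> ball (of_real x) \<delta>"
        using \<delta>(1) by (auto simp: dist_norm cmod_def)
    qed (use \<delta> in \<open>auto simp: slit_plane_def\<close>)
    then show ?thesis using \<delta> by (intro exI[of _ "\<delta> / 2"]) auto
  qed
  then obtain b where b: "b > 0" "fg_F (Complex x b) > 1 / \<alpha>" by blast
  define a where "a = max b (sqrt \<alpha>)"
  have a: "a > 0" "b \<le> a" "sqrt \<alpha> \<le> a" using b by (auto simp: a_def)
  have "fg_F (Complex x a) \<le> 1 / a\<^sup>2" using a by (intro fg_F_le_Im)
  also have "\<dots> \<le> 1 / \<alpha>"
    using assms a power_mono[of "sqrt \<alpha>" a 2] by (intro divide_left_mono) auto
  finally have 1: "fg_F (Complex x a) \<le> 1 / \<alpha>" .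
  have "\<exists>y\<ge>b. y \<le> a \<and> fg_F (Complex x y) = 1 / \<alpha>"
  proof (rule IVT2')
    show "continuous_on {b..a} (\<lambda>y. fg_F (Complex x y))"
      using b
      by (intro continuous_at_imp_continuous_on ballI isCont_o2[OF _ isCont_fg_F])
         (auto simp: slit_plane_def Complex_eq intro!: continuous_intros)
  qed (use 1 b a in auto)
  then show ?thesis using b(1) by (meson less_le_trans)
qed

lemma fg_v_above:
  assumes "\<alpha> > 0" "x > - fg_c \<alpha>"
  shows fg_v_pos: "fg_v \<alpha> x > 0" and fg_F_fg_v: "fg_F (Complex x (fg_v \<alpha> x)) = 1 / \<alpha>"
proof -
  have "\<exists>!y. 0 < y \<and> fg_F (Complex x y) = 1 / \<alpha>"
  proof (rule ex_ex1I)
    fix y y' assume "0 < y \<and> fg_F (Complex x y) = 1 / \<alpha>" "0 < y' \<and> fg_F (Complex x y') = 1 / \<alpha>"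
    then show "y = y'"
      using fg_F_strict_anti_Im[of x y y'] fg_F_strict_anti_Im[of x y' y]
      by (cases y y' rule: linorder_cases) (auto simp: slit_plane_def)
  qed (use fg_F_eq_on_vertical_line[OF assms] in blast)
  from theI'[OF this] show "fg_v \<alpha> x > 0" "fg_F (Complex x (fg_v \<alpha> x)) = 1 / \<alpha>"
    using assms unfolding fg_v_def by auto
qed

text \<open>
  The part of the closed upper half plane, off the half line \<open>[0,\<infinity>)\<close>, on which \<open>fg_H \<alpha>\<close> has
  nonnegative imaginary part.
\<close>

definition fg_region :: "real \<Rightarrow> complex set" where
  "fg_region \<alpha> = {w \<in> slit_plane. 0 \<le> Im w \<and> fg_F w \<le> 1 / \<alpha>}"

text \<open>
  The boundary of the region: the points that \<open>fg_H \<alpha>\<close> maps into the real line. The product form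
  covers the real ray up to \<open>- fg_c \<alpha>\<close> together with the curve above the rest of the line, and it is a
  closed condition.
\<close>

definition fg_curve :: "real \<Rightarrow> complex set" where
  "fg_curve \<alpha> = {w \<in> fg_region \<alpha>. Im w * (1 - \<alpha> * fg_F w) = 0}"

lemma mem_fg_curve_iff:
  assumes "\<alpha> > 0"
  shows "w \<in> fg_curve \<alpha> \<longleftrightarrow>
    w \<in> slit_plane \<and> 0 \<le> Im w \<and> (Im w = 0 \<and> fg_F w \<le> 1 / \<alpha> \<or> fg_F w = 1 / \<alpha>)"
proof -
  have "1 - \<alpha> * fg_F w = 0 \<longleftrightarrow> fg_F w = 1 / \<alpha>" using assms by (auto simp: eq_divide_eq mult.commute)
  then show ?thesis by (auto simp: fg_curve_def fg_region_def)
qed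

text \<open>
  By monotonicity of \<open>F\<close> on the negative axis and along vertical lines, each vertical line meets the
  curve exactly once, at the height that \<open>fg_v\<close> prescribes.
\<close>

lemma fg_curve_iff_graph:
  assumes "\<alpha> > 0"
  shows "Complex x y \<in> fg_curve \<alpha> \<longleftrightarrow> y = fg_v \<alpha> x"
proof (cases "x \<le> - fg_c \<alpha>")
  case True
  then have neg: "x < 0" using fg_c_pos[OF assms] by simp
  then have slit: "Complex x y \<in> slit_plane" by (simp add: slit_plane_def)
  have le: "fg_F (Complex x 0) \<le> 1 / \<alpha>"
    using fg_F_le_iff_neg[OF assms neg] True by (simp add: complex_of_real_def)
  have "fg_F (Complex x y) < 1 / \<alpha>" if "y > 0"
    using fg_F_strict_anti_Im[of x 0 y] le neg that by (simp add: slit_plane_def)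
  then show ?thesis
    using True slit le unfolding mem_fg_curve_iff[OF assms] fg_v_def
    by (cases "y > 0") auto
next
  case False
  then have v: "fg_v \<alpha> x > 0" "fg_F (Complex x (fg_v \<alpha> x)) = 1 / \<alpha>"
    using fg_v_above[OF assms] by auto
  have pos: "y > 0" if "Complex x y \<in> fg_curve \<alpha>"
  proof (rule ccontr)
    assume "\<not> y > 0"
    then have w: "x < 0" "y = 0" "fg_F (of_real x) \<le> 1 / \<alpha>"
      using that unfolding mem_fg_curve_iff[OF assms]
      by (auto simp: slit_plane_def complex_of_real_def)
    then show False
      using fg_F_le_iff_neg[OF assms w(1)] False by auto
  qed
  have uniq: "y = fg_v \<alpha> x" if "y > 0" "fg_F (Complex x y) = 1 / \<alpha>"
    using that v fg_F_strict_anti_Im[of x y "fg_v \<alpha> x"] fg_F_strict_anti_Im[of x "fg_v \<alpha> x" y]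
    by (cases y "fg_v \<alpha> x" rule: linorder_cases) (auto simp: slit_plane_def)
  show ?thesis
  proof
    assume *: "Complex x y \<in> fg_curve \<alpha>"
    show "y = fg_v \<alpha> x"
      using * pos[OF *] unfolding mem_fg_curve_iff[OF assms] by (intro uniq) auto
  next
    assume "y = fg_v \<alpha> x"
    then show "Complex x y \<in> fg_curve \<alpha>"
      using v unfolding mem_fg_curve_iff[OF assms] by (simp add: slit_plane_def)
  qed
qed

text \<open>
  A limit of points of the region cannot lie on the half line \<open>[0,\<infinity>)\<close>, because \<open>F\<close> would be unbounded
  along the sequence.
\<close>

lemma fg_region_closed_sequentially:
  assumes w: "\<And>n. w n \<in> fg_region \<alpha>" and lim: "w \<longlonglongrightarrow> l"
  shows "l \<in> fg_region \<alpha>"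
proof -
  have "l \<in> slit_plane"
  proof (rule ccontr)
    assume "l \<notin> slit_plane"
    then obtain x where x: "x \<ge> 0" "l = of_real x" by (auto simp: not_in_slit_plane_iff)
    obtain \<delta> where \<delta>: "\<delta> > 0" "\<And>w. w \<in> slit_plane \<Longrightarrow> w \<in> ball (of_real x) \<delta> \<Longrightarrow> fg_F w > 1 / \<alpha>"
      using fg_F_blowup[OF x(1), of "1 / \<alpha>"] by auto
    have "eventually (\<lambda>n. w n \<in> ball l \<delta>) sequentially"
      using \<delta> by (intro topological_tendstoD[OF lim]) auto
    then obtain n where "w n \<in> ball l \<delta>"
      using eventually_happens'[OF sequentially_bot] by blast
    then have "fg_F (w n) > 1 / \<alpha>"
      using \<delta>(2) w[of n] x by (auto simp: fg_region_def)
    then show False using w[of n] by (auto simp: fg_region_def)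
  qed
  moreover have "(\<lambda>n. fg_F (w n)) \<longlonglongrightarrow> fg_F l"
    by (rule isCont_tendsto_compose[OF isCont_fg_F lim]) fact
  then have "fg_F l \<le> 1 / \<alpha>"
    by (rule LIMSEQ_le_const2) (use w in \<open>auto simp: fg_region_def\<close>)
  moreover have "0 \<le> Im l"
    using tendsto_Im[OF lim] by (rule LIMSEQ_le_const) (use w in \<open>auto simp: fg_region_def\<close>)
  ultimately show ?thesis by (simp add: fg_region_def)
qed

lemma closed_fg_region: "closed (fg_region \<alpha>)"
  using fg_region_closed_sequentially by (auto simp: closed_sequential_limits)

lemma closed_fg_curve: "closed (fg_curve \<alpha>)"
  unfolding closed_sequential_limits
proof (intro allI impI)
  fix w l assume "(\<forall>n. w n \<in> fg_curve \<alpha>) \<and> w \<longlonglongrightarrow> l"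
  then have w: "\<And>n. w n \<in> fg_curve \<alpha>" and lim: "w \<longlonglongrightarrow> l" by auto
  have l: "l \<in> fg_region \<alpha>"
    using w by (intro fg_region_closed_sequentially[OF _ lim]) (auto simp: fg_curve_def)
  then have "(\<lambda>n. Im (w n) * (1 - \<alpha> * fg_F (w n))) \<longlonglongrightarrow> Im l * (1 - \<alpha> * fg_F l)"
    by (intro tendsto_intros lim isCont_tendsto_compose[OF isCont_fg_F lim])
       (auto simp: fg_region_def)
  moreover have "Im (w n) * (1 - \<alpha> * fg_F (w n)) = 0" for n
    using w[of n] by (simp only: fg_curve_def mem_Collect_eq)
  ultimately have "(\<lambda>_. 0) \<longlonglongrightarrow> Im l * (1 - \<alpha> * fg_F l)"
    by (simp only:)
  then have "0 = Im l * (1 - \<alpha> * fg_F l)"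
    by (rule LIMSEQ_unique[OF tendsto_const])
  then have "Im l * (1 - \<alpha> * fg_F l) = 0" by (rule sym)
  then show "l \<in> fg_curve \<alpha>" using l by (simp add: fg_curve_def)
qed

lemma fg_v_bounds:
  assumes "\<alpha> > 0"
  shows "0 \<le> fg_v \<alpha> x" "fg_v \<alpha> x \<le> sqrt \<alpha>"
proof -
  show "0 \<le> fg_v \<alpha> x"
    using fg_v_pos[OF assms, of x] by (cases "x \<le> - fg_c \<alpha>") (auto simp: fg_v_def)
  show "fg_v \<alpha> x \<le> sqrt \<alpha>"
  proof (cases "x > - fg_c \<alpha>")
    case True
    then have "1 / \<alpha> \<le> 1 / (fg_v \<alpha> x)\<^sup>2"
      using fg_F_le_Im[of "fg_v \<alpha> x" x] fg_v_above[OF assms True] by simp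
    then have "(fg_v \<alpha> x)\<^sup>2 \<le> \<alpha>"
      using assms fg_v_pos[OF assms True] by (simp add: field_simps)
    then show ?thesis by (rule real_le_rsqrt)
  qed (use assms in \<open>auto simp: fg_v_def\<close>)
qed

text \<open>
  The graph of \<open>fg_v \<alpha>\<close> is the closed set \<open>fg_curve \<alpha>\<close> and its values lie in a compact interval. This
  covers the point \<open>- fg_c \<alpha>\<close>, where the implicit function theorem would not help.
\<close>

lemma continuous_on_fg_v:
  assumes "\<alpha> > 0"
  shows "continuous_on UNIV (fg_v \<alpha>)"
proof (rule continuous_from_closed_graph)
  show "fg_v \<alpha> \<in> UNIV \<rightarrow> {0..sqrt \<alpha>}" using fg_v_bounds[OF assms] by auto
  have "(\<lambda>x. (x, fg_v \<alpha> x)) ` UNIV = (\<lambda>p. Complex (fst p) (snd p)) -` fg_curve \<alpha>"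
    by (auto simp: fg_curve_iff_graph[OF assms] image_iff)
  moreover have "closed ((\<lambda>p. Complex (fst p) (snd p)) -` fg_curve \<alpha>)"
    by (intro closed_vimage closed_fg_curve) (auto simp: Complex_eq intro!: continuous_intros)
  ultimately show "closed ((\<lambda>x. (x, fg_v \<alpha> x)) ` UNIV)" by simp
qed simp

lemma Im_fg_H:
  assumes "z \<in> slit_plane"
  shows "Im (fg_H \<alpha> z) = Im z * (1 - \<alpha> * fg_F z)"
proof -
  have "Im (cauchy_transform gamma2 z) = (\<integral>t. Im (1 / (z - of_real t)) \<partial>gamma2)"
    unfolding cauchy_transform_def using integrable_cauchy_kernel(1)[OF assms] by simp
  also have "\<dots> = (\<integral>t. - Im z * (1 / (cmod (z - of_real t))\<^sup>2) \<partial>gamma2)"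
  proof (rule Bochner_Integration.integral_cong)
    have "Im (1 / u) = - Im u * (1 / (cmod u)\<^sup>2)" for u
      by (simp add: Im_divide cmod_power2)
    then show "Im (1 / (z - of_real t)) = - Im z * (1 / (cmod (z - of_real t))\<^sup>2)" for t
      by simp
  qed simp
  also have "\<dots> = - Im z * fg_F z"
    unfolding fg_F_gamma2 by (rule integral_mult_right_zero)
  finally show ?thesis by (simp add: fg_H_gamma2 algebra_simps)
qed

text \<open>
  A linear bound for the first moment of the kernel by its second moment, with the weight at which the
  estimate of \<open>fg_H_near_shift\<close> becomes \<open>sqrt \<alpha>\<close>.
\<close>

lemma weighted_am_gm:
  fixes s k :: real
  assumes "s > 0"
  shows "k \<le> (s * k\<^sup>2 + 1 / s) / 2"
proof -
  have "0 \<le> (s * k - 1)\<^sup>2 / s" using assms by simp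
  also have "\<dots> = s * k\<^sup>2 - 2 * k + 1 / s"
    using assms by (simp add: field_simps power2_eq_square)
  finally show ?thesis by simp
qed

lemma (in prob_space) expectation_affine_half:
  assumes "integrable M f"
  shows "(\<integral>t. (a * f t + b) / 2 \<partial>M) = (a * (\<integral>t. f t \<partial>M) + b :: real) / 2"
  using assms by (simp add: prob_space)

lemma fg_H_near_shift:
  assumes \<alpha>: "\<alpha> > 0" and w: "w \<in> fg_region \<alpha>"
  shows "cmod (fg_H \<alpha> w - w - of_real \<alpha>) \<le> sqrt \<alpha>"
proof -
  have ws: "w \<in> slit_plane" and F: "fg_F w \<le> 1 / \<alpha>" using w by (auto simp: fg_region_def)
  note int = integrable_cauchy_kernel[OF ws]
  define k where "k t = cmod (1 / (w - of_real t))" for t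
  have k2: "(k t)\<^sup>2 = 1 / (cmod (w - of_real t))\<^sup>2" for t
    by (simp add: k_def norm_divide power_divide)
  have "cmod (cauchy_transform gamma2 w) \<le> (\<integral>t. k t \<partial>gamma2)"
    unfolding cauchy_transform_def k_def by (rule integral_norm_bound)
  also have "\<dots> \<le> (\<integral>t. (sqrt \<alpha> * (k t)\<^sup>2 + 1 / sqrt \<alpha>) / 2 \<partial>gamma2)"
  proof (rule integral_mono)
    show "integrable gamma2 k" using int(1) unfolding k_def by (rule integrable_norm)
    show "integrable gamma2 (\<lambda>t. (sqrt \<alpha> * (k t)\<^sup>2 + 1 / sqrt \<alpha>) / 2)"
      unfolding k2
      by (intro integrable_divide Bochner_Integration.integrable_add integrable_mult_right int(2)) simp
    show "k t \<le> (sqrt \<alpha> * (k t)\<^sup>2 + 1 / sqrt \<alpha>) / 2" for t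
      using \<alpha> by (intro weighted_am_gm) simp
  qed
  also have "\<dots> = (sqrt \<alpha> * fg_F w + 1 / sqrt \<alpha>) / 2"
  proof -
    have ik: "integrable gamma2 (\<lambda>t. (k t)\<^sup>2)" unfolding k2 by (rule int(2))
    have "(\<integral>t. (k t)\<^sup>2 \<partial>gamma2) = fg_F w" unfolding k2 fg_F_gamma2 ..
    then show ?thesis
      unfolding gamma2.expectation_affine_half[OF ik] by simp
  qed
  finally have "cmod (cauchy_transform gamma2 w) \<le> (sqrt \<alpha> * fg_F w + 1 / sqrt \<alpha>) / 2" .
  moreover have "sqrt \<alpha> * fg_F w \<le> sqrt \<alpha> * (1 / \<alpha>)"
    by (rule mult_left_mono[OF F]) (use \<alpha> in simp)
  moreover have "sqrt \<alpha> * (1 / \<alpha>) = 1 / sqrt \<alpha>"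
  proof -
    define s where "s = sqrt \<alpha>"
    have "s > 0" "\<alpha> = s * s" using \<alpha> by (auto simp: s_def)
    then show ?thesis unfolding s_def[symmetric] by simp
  qed
  ultimately have "cmod (cauchy_transform gamma2 w) \<le> (1 / sqrt \<alpha> + 1 / sqrt \<alpha>) / 2"
    by (simp only:) (meson add_right_mono divide_right_mono order_trans zero_le_numeral)
  then have "cmod (cauchy_transform gamma2 w) \<le> 1 / sqrt \<alpha>" by simp
  then have "\<alpha> * cmod (cauchy_transform gamma2 w) \<le> \<alpha> * (1 / sqrt \<alpha>)"
    by (rule mult_left_mono) (use \<alpha> in simp)
  also have "\<alpha> * (1 / sqrt \<alpha>) = sqrt \<alpha>"
    using \<alpha> real_div_sqrt[of \<alpha>] by simp
  finally show ?thesis using \<alpha> by (simp add: fg_H_gamma2 norm_mult)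
qed

text \<open>
  If \<open>H z = H w\<close> with \<open>z \<noteq> w\<close>, then the integral of \<open>p q\<close> is \<open>1 / \<alpha>\<close>, where \<open>p\<close> and \<open>q\<close> are the Cauchy
  kernels of \<open>z\<close> and \<open>w\<close>. As \<open>F z\<close> and \<open>F w\<close>, the integrals of \<open>\<bar>p\<bar>\<^sup>2\<close> and \<open>\<bar>q\<bar>\<^sup>2\<close>, are at most \<open>1 / \<alpha>\<close>,
  this is the equality case of the Cauchy--Schwarz inequality and forces \<open>p\<close> to be the conjugate of
  \<open>q\<close>, so \<open>z\<close> is the conjugate of \<open>w\<close>. In the closed half plane both must then be real and equal.
\<close>

lemma inj_on_fg_H:
  assumes \<alpha>: "\<alpha> > 0"
  shows "inj_on (fg_H \<alpha>) (fg_region \<alpha>)"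
proof (rule inj_onI, rule ccontr)
  fix z w assume z: "z \<in> fg_region \<alpha>" and w: "w \<in> fg_region \<alpha>"
    and eq: "fg_H \<alpha> z = fg_H \<alpha> w" and ne: "z \<noteq> w"
  have zs: "z \<in> slit_plane" and ws: "w \<in> slit_plane" using z w by (auto simp: fg_region_def)
  note intz = integrable_cauchy_kernel[OF zs] and intw = integrable_cauchy_kernel[OF ws]
  define p q where "p t = 1 / (z - of_real t)" and "q t = 1 / (w - of_real t)" for t
  have diff: "p t - q t = (w - z) * (p t * q t)" if "t > 0" for t
  proof -
    have "z \<noteq> of_real t" "w \<noteq> of_real t" using zs ws that by (auto simp: slit_plane_def)
    then show ?thesis by (simp add: p_def q_def field_simps)
  qed
  have intpq: "integrable gamma2 (\<lambda>t. p t * q t)"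
  proof -
    have "integrable gamma2 (\<lambda>t. (p t - q t) / (w - z))"
      using intz(1) intw(1) by (auto simp: p_def q_def)
    moreover have "AE t in gamma2. (p t - q t) / (w - z) = p t * q t"
      using AE_gamma2_pos 
    proof eventually_elim
      case (elim t)
      show ?case unfolding diff[OF elim] using ne by simp
    qed
    moreover have "(\<lambda>t. p t * q t) \<in> borel_measurable gamma2"
      unfolding p_def q_def by measurable
    ultimately show ?thesis
      using integrable_cong_AE_imp by blast
  qed
  have "(w - z) * (\<integral>t. p t * q t \<partial>gamma2) = (\<integral>t. p t - q t \<partial>gamma2)"
    unfolding integral_mult_right_zero[symmetric]
  proof (rule integral_cong_AE)
    show "AE t in gamma2. (w - z) * (p t * q t) = p t - q t"
      using AE_gamma2_pos by eventually_elim (rule diff[symmetric])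
  qed (simp_all add: p_def q_def)
  also have "\<dots> = cauchy_transform gamma2 z - cauchy_transform gamma2 w"
    using intz(1) intw(1) by (simp add: p_def q_def cauchy_transform_def)
  finally have "(w - z) * (\<integral>t. p t * q t \<partial>gamma2)
      = cauchy_transform gamma2 z - cauchy_transform gamma2 w" .
  moreover have "of_real \<alpha> * (cauchy_transform gamma2 z - cauchy_transform gamma2 w) = w - z"
    using eq unfolding fg_H_gamma2 by algebra
  ultimately have "(w - z) * (of_real \<alpha> * (\<integral>t. p t * q t \<partial>gamma2)) = (w - z) * 1"
    by (metis mult.left_commute mult.right_neutral)
  then have one: "of_real \<alpha> * (\<integral>t. p t * q t \<partial>gamma2) = 1"
    using ne unfolding mult_cancel_left by simp
  have sq: "(cmod (p t - cnj (q t)))\<^sup>2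
      = 1 / (cmod (z - of_real t))\<^sup>2 + 1 / (cmod (w - of_real t))\<^sup>2 - 2 * Re (p t * q t)" for t
  proof -
    have "(cmod (p t - cnj (q t)))\<^sup>2 = (cmod (p t))\<^sup>2 + (cmod (q t))\<^sup>2 - 2 * Re (p t * q t)"
      unfolding cmod_power2 by (simp add: power2_eq_square algebra_simps)
    then show ?thesis by (simp add: p_def q_def norm_divide power_divide)
  qed
  have int_sq: "integrable gamma2 (\<lambda>t. (cmod (p t - cnj (q t)))\<^sup>2)"
    unfolding sq
    by (intro Bochner_Integration.integrable_diff Bochner_Integration.integrable_add
        integrable_mult_right integrable_Re intz(2) intw(2) intpq)
  have "(\<integral>t. (cmod (p t - cnj (q t)))\<^sup>2 \<partial>gamma2) = fg_F z + fg_F w - 2 * Re (\<integral>t. p t * q t \<partial>gamma2)"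
    unfolding sq fg_F_gamma2
    using intz(2) intw(2) integrable_Re[OF intpq] integral_Re[OF intpq] by (simp del: times_complex.sel)
  also have "Re (\<integral>t. p t * q t \<partial>gamma2) = 1 / \<alpha>"
    using arg_cong[OF one, of Re] \<alpha>
    by (simp only: Re_complex_of_real times_complex.sel Im_complex_of_real) (simp add: eq_divide_eq mult.commute)
  also have "fg_F z + fg_F w - 2 * (1 / \<alpha>) \<le> 0"
    using z w by (simp add: fg_region_def)
  finally have "(\<integral>t. (cmod (p t - cnj (q t)))\<^sup>2 \<partial>gamma2) = 0"
    by (intro antisym) (auto intro: integral_nonneg_AE)
  then have "AE t in gamma2. (cmod (p t - cnj (q t)))\<^sup>2 = 0"
    using integral_nonneg_eq_0_iff_AE[OF int_sq] by simp
  then have "AE t in gamma2. t > 0 \<and> p t = cnj (q t)"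
    using AE_gamma2_pos by eventually_elim simp
  then have "\<exists>t. t > 0 \<and> p t = cnj (q t)"
    by (rule eventually_happens'[rotated]) (rule gamma2.ae_filter_bot)
  then obtain t where t: "t > 0" "p t = cnj (q t)" by blast
  have "z - of_real t = inverse (p t)" by (simp add: p_def)
  also have "\<dots> = inverse (cnj (q t))" unfolding t(2) ..
  also have "\<dots> = cnj w - of_real t" by (simp add: q_def)
  finally have zw: "z = cnj w" by simp
  then have "Im z = - Im w" by simp
  then have Im: "Im z = 0" "Im w = 0" using z w unfolding fg_region_def by auto
  have "Re z = Re w" using zw by simp
  then show False using Im ne by (simp add: complex_eq_iff)
qed

section \<open>The bijection P and the density along the curve\<close>

lemma graph_in_fg_curve:
  assumes "\<alpha> > 0"
  shows "Complex x (fg_v \<alpha> x) \<in> fg_curve \<alpha>" "Complex x (fg_v \<alpha> x) \<in> fg_region \<alpha>"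
    "Complex x (fg_v \<alpha> x) \<in> slit_plane"
proof -
  show 1: "Complex x (fg_v \<alpha> x) \<in> fg_curve \<alpha>" by (simp add: fg_curve_iff_graph[OF assms])
  then show 2: "Complex x (fg_v \<alpha> x) \<in> fg_region \<alpha>" by (simp add: fg_curve_def)
  then show "Complex x (fg_v \<alpha> x) \<in> slit_plane" by (simp add: fg_region_def)
qed

lemma fg_H_on_graph:
  assumes "\<alpha> > 0"
  shows "fg_H \<alpha> (Complex x (fg_v \<alpha> x)) = of_real (fg_P \<alpha> x)"
proof -
  have "Im (fg_H \<alpha> (Complex x (fg_v \<alpha> x))) = 0"
    using graph_in_fg_curve[OF assms] by (simp add: Im_fg_H fg_curve_def)
  then show ?thesis by (simp add: fg_P_def complex_eq_iff)
qed

lemma fg_P_near_shift: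
  assumes "\<alpha> > 0"
  shows "\<bar>fg_P \<alpha> x - x - \<alpha>\<bar> \<le> sqrt \<alpha>"
proof -
  have "fg_P \<alpha> x - x - \<alpha>
      = Re (fg_H \<alpha> (Complex x (fg_v \<alpha> x)) - Complex x (fg_v \<alpha> x) - of_real \<alpha>)"
    by (simp add: fg_P_def)
  then show ?thesis
    using fg_H_near_shift[OF assms graph_in_fg_curve(2)[OF assms, of x]] abs_Re_le_cmod order_trans
    by metis
qed

lemma continuous_on_fg_P:
  assumes "\<alpha> > 0"
  shows "continuous_on A (fg_P \<alpha>)"
proof -
  have "continuous_on UNIV (\<lambda>x. Complex x (fg_v \<alpha> x))"
    unfolding Complex_eq by (intro continuous_intros continuous_on_fg_v[OF assms])
  then have "isCont (\<lambda>x. Complex x (fg_v \<alpha> x)) x" for x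
    by (simp add: continuous_on_eq_continuous_at)
  then have "isCont (fg_P \<alpha>) x" for x
    unfolding fg_P_def
    by (intro isCont_Re isCont_o2[OF _ isCont_fg_H] graph_in_fg_curve assms)
  then show ?thesis by (intro continuous_at_imp_continuous_on) auto
qed

lemma inj_fg_P:
  assumes "\<alpha> > 0"
  shows "inj (fg_P \<alpha>)"
proof (rule injI)
  fix x y assume "fg_P \<alpha> x = fg_P \<alpha> y"
  then have "fg_H \<alpha> (Complex x (fg_v \<alpha> x)) = fg_H \<alpha> (Complex y (fg_v \<alpha> y))"
    by (simp add: fg_H_on_graph[OF assms])
  then have "Complex x (fg_v \<alpha> x) = Complex y (fg_v \<alpha> y)"
    using inj_onD[OF inj_on_fg_H[OF assms]] graph_in_fg_curve(2)[OF assms] by blast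
  then show "x = y" by simp
qed

text \<open>
  By the intermediate value theorem, since \<open>P\<close> is continuous and stays within \<open>sqrt \<alpha>\<close> of the
  translation by \<open>\<alpha>\<close>.
\<close>

lemma surj_fg_P:
  assumes "\<alpha> > 0"
  obtains x where "fg_P \<alpha> x = \<xi>"
proof -
  have "\<exists>x\<ge>\<xi> - \<alpha> - sqrt \<alpha>. x \<le> \<xi> - \<alpha> + sqrt \<alpha> \<and> fg_P \<alpha> x = \<xi>"
  proof (rule IVT')
    show "fg_P \<alpha> (\<xi> - \<alpha> - sqrt \<alpha>) \<le> \<xi>" "\<xi> \<le> fg_P \<alpha> (\<xi> - \<alpha> + sqrt \<alpha>)"
      using fg_P_near_shift[OF assms, of "\<xi> - \<alpha> - sqrt \<alpha>"]
        fg_P_near_shift[OF assms, of "\<xi> - \<alpha> + sqrt \<alpha>"] by linarith+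
  qed (use assms continuous_on_fg_P[OF assms] in auto)
  then show ?thesis using that by blast
qed

lemma strict_mono_fg_P:
  assumes "\<alpha> > 0"
  shows "strict_mono (fg_P \<alpha>)"
proof (rule strict_monoI)
  fix x y :: real assume xy: "x < y"
  \<comment> \<open>A point so far to the right that \<open>P x < P M\<close> follows from the distance to the translation;
    a continuous injective function is monotone on \<open>[x,M]\<close>, and this fixes the direction.\<close>
  define M where "M = max y (x + 2 * sqrt \<alpha>) + 1"
  have M: "y < M" "x + 2 * sqrt \<alpha> < M" by (auto simp: M_def)
  have "fg_P \<alpha> x < fg_P \<alpha> M"
    using fg_P_near_shift[OF assms, of x] fg_P_near_shift[OF assms, of M] M by linarith
  moreover have "fg_P \<alpha> x < fg_P \<alpha> y \<and> fg_P \<alpha> y < fg_P \<alpha> M \<or>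
      fg_P \<alpha> M < fg_P \<alpha> y \<and> fg_P \<alpha> y < fg_P \<alpha> x"
    by (rule continuous_inj_imp_mono)
       (use xy M continuous_on_fg_P[OF assms] inj_on_subset[OF inj_fg_P[OF assms]] in auto)
  ultimately show "fg_P \<alpha> x < fg_P \<alpha> y" by linarith
qed

text \<open>
  For \<open>x \<le> - fg_c \<alpha>\<close> both sides vanish, so no case distinction at \<open>fg_s \<alpha>\<close> remains.
\<close>

lemma free_gamma_density_fg_P:
  assumes "\<alpha> > 0"
  shows "free_gamma_density \<alpha> (fg_P \<alpha> x) = 1 / pi * fg_Q \<alpha> x"
proof -
  have "fg_P \<alpha> x \<le> fg_s \<alpha> \<longleftrightarrow> x \<le> - fg_c \<alpha>"
    unfolding fg_s_def by (rule strict_mono_less_eq[OF strict_mono_fg_P[OF assms]])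
  moreover have "fg_Q \<alpha> x = 0" if "x \<le> - fg_c \<alpha>"
    using that by (simp add: fg_Q_def fg_v_def)
  ultimately show ?thesis
    by (simp add: free_gamma_density_def inv_f_f[OF inj_fg_P[OF assms]])
qed

section \<open>The curve far to the right\<close>

definition gamma2_density :: "real \<Rightarrow> real" where
  "gamma2_density t = t * exp (- t)"

text \<open>
  The error is relative to the value at \<open>x\<close>: this matters since \<open>gamma2_density x\<close> is exponentially
  small and is itself the quantity to be compared with \<open>fg_v\<close>.
\<close>

lemma gamma2_density_lipschitz:
  assumes x: "x \<ge> 1" and t: "\<bar>t - x\<bar> \<le> 1"
  shows "\<bar>gamma2_density t - gamma2_density x\<bar> \<le> 6 * gamma2_density x * \<bar>t - x\<bar>"
proof -
  define s where "s = t - x"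
  have s: "\<bar>s\<bar> \<le> 1" "t = x + s" using t by (auto simp: s_def)
  have e3: "exp (- s) \<le> 3"
    using exp_le exp_le_cancel_iff[of "- s" 1] s by linarith
  have 1: "\<bar>exp (- s) - 1\<bar> \<le> 3 * \<bar>s\<bar>"
  proof (cases "s \<ge> 0")
    case True
    then show ?thesis using exp_ge_add_one_self[of "- s"] by simp
  next
    case False
    have "exp (- s) - 1 = exp (- s) * (1 - exp s)"
      by (simp add: right_diff_distrib flip: exp_add)
    also have "\<dots> \<le> exp (- s) * (- s)"
    proof (rule mult_left_mono)
      show "1 - exp s \<le> - s" using exp_ge_add_one_self[of s] by linarith
    qed simp
    also have "\<dots> \<le> 3 * (- s)" using e3 False by (intro mult_right_mono) auto
    finally show ?thesis using False by simp
  qed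
  have "gamma2_density t - gamma2_density x = exp (- x) * (x * (exp (- s) - 1) + s * exp (- s))"
  proof -
    have "exp (- (x + s)) = exp (- x) * exp (- s)" by (simp flip: exp_add)
    then have "gamma2_density t = (x + s) * (exp (- x) * exp (- s))" by (simp only: gamma2_density_def s(2))
    then show ?thesis unfolding gamma2_density_def[of x] by algebra
  qed
  also have "\<bar>\<dots>\<bar> \<le> exp (- x) * (x * (3 * \<bar>s\<bar>) + x * (3 * \<bar>s\<bar>))"
  proof -
    have "\<bar>x * (exp (- s) - 1) + s * exp (- s)\<bar> \<le> \<bar>x * (exp (- s) - 1)\<bar> + \<bar>s * exp (- s)\<bar>"
      by (rule abs_triangle_ineq)
    also have "\<bar>x * (exp (- s) - 1)\<bar> \<le> x * (3 * \<bar>s\<bar>)"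
      using 1 x by (simp add: abs_mult mult_left_mono)
    also have "\<bar>s * exp (- s)\<bar> \<le> 1 * (3 * \<bar>s\<bar>)"
      using mult_left_mono[OF e3, of "\<bar>s\<bar>"] by (simp add: abs_mult mult.commute)
    also have "1 * (3 * \<bar>s\<bar>) \<le> x * (3 * \<bar>s\<bar>)"
      using x by (intro mult_right_mono) auto
    finally show ?thesis by (simp add: abs_mult)
  qed
  finally show ?thesis by (simp add: gamma2_density_def s_def algebra_simps)
qed

lemma integral_gamma2_window:
  assumes "x \<ge> 1" "h \<in> borel_measurable borel"
  shows "(\<integral>t. indicator {x - 1..x + 1} t * h t \<partial>gamma2)
    = (LBINT t:{x - 1..x + 1}. gamma2_density t * h t)"
proof -
  have [measurable]: "h \<in> borel_measurable borel" by fact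
  show ?thesis
    by (subst integral_gamma2, measurable)
       (use assms in \<open>auto simp: set_lebesgue_integral_def gamma2_density_def indicator_def
         intro!: Bochner_Integration.integral_cong\<close>)
qed

text \<open>
  On the window \<open>[x - 1, x + 1]\<close> the weight may be frozen at \<open>x\<close>, at the cost of one factor \<open>\<bar>t - x\<bar>\<close>
  that tames the singularity of the kernel.
\<close>

lemma window_integral_approx:
  assumes x: "x \<ge> 1" and h: "continuous_on UNIV (h :: real \<Rightarrow> real)"
  shows "\<bar>(\<integral>t. indicator {x - 1..x + 1} t * h t \<partial>gamma2) - gamma2_density x * (LBINT t:{x - 1..x + 1}. h t)\<bar>
    \<le> 6 * gamma2_density x * (LBINT t:{x - 1..x + 1}. \<bar>t - x\<bar> * \<bar>h t\<bar>)"
proof -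
  let ?I = "{x - 1..x + 1}"
  have cg: "continuous_on UNIV gamma2_density" unfolding gamma2_density_def by (intro continuous_intros)
  have int: "set_integrable lborel ?I f" if "continuous_on UNIV f" for f :: "real \<Rightarrow> real"
    by (rule borel_integrable_atLeastAtMost') (rule continuous_on_subset[OF that], simp)
  have ints: "set_integrable lborel ?I (\<lambda>t. gamma2_density t * h t)" "set_integrable lborel ?I h"
    "set_integrable lborel ?I (\<lambda>t. \<bar>t - x\<bar> * \<bar>h t\<bar>)"
    by (intro int continuous_intros cg h)+
  have "(\<integral>t. indicator ?I t * h t \<partial>gamma2) - gamma2_density x * (LBINT t:?I. h t)
      = (LBINT t:?I. gamma2_density t * h t) - (LBINT t:?I. gamma2_density x * h t)"
    using x h by (subst integral_gamma2_window) (auto intro: borel_measurable_continuous_onI)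
  also have "\<dots> = (LBINT t:?I. gamma2_density t * h t - gamma2_density x * h t)"
    using ints by (intro set_integral_diff(2)[symmetric]) auto
  also have "\<bar>\<dots>\<bar> \<le> (LBINT t:?I. \<bar>gamma2_density t * h t - gamma2_density x * h t\<bar>)"
    using set_integral_norm_bound[of lborel ?I "\<lambda>t. gamma2_density t * h t - gamma2_density x * h t"] ints
    by (simp add: set_integral_diff(1))
  also have "\<dots> \<le> (LBINT t:?I. 6 * gamma2_density x * (\<bar>t - x\<bar> * \<bar>h t\<bar>))"
  proof (rule set_integral_mono)
    show "set_integrable lborel ?I (\<lambda>t. \<bar>gamma2_density t * h t - gamma2_density x * h t\<bar>)"
      by (intro int continuous_intros cg h)
    show "set_integrable lborel ?I (\<lambda>t. 6 * gamma2_density x * (\<bar>t - x\<bar> * \<bar>h t\<bar>))"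
      by (intro int continuous_intros h)
    fix t assume "t \<in> ?I"
    then have "\<bar>gamma2_density t - gamma2_density x\<bar> * \<bar>h t\<bar> \<le> 6 * gamma2_density x * \<bar>t - x\<bar> * \<bar>h t\<bar>"
      by (intro mult_right_mono gamma2_density_lipschitz[OF x]) auto
    then show "\<bar>gamma2_density t * h t - gamma2_density x * h t\<bar> \<le> 6 * gamma2_density x * (\<bar>t - x\<bar> * \<bar>h t\<bar>)"
      by (simp add: abs_mult flip: left_diff_distrib)
  qed
  finally show ?thesis by simp
qed

lemma poisson_kernel_integral:
  fixes x y :: real
  assumes "y > 0" "a \<le> b"
  shows "(LBINT t:{a..b}. y / ((t - x)\<^sup>2 + y\<^sup>2)) = arctan ((b - x) / y) - arctan ((a - x) / y)"
proof -
  have pos: "(t - x)\<^sup>2 + y\<^sup>2 > 0" for t using assms by (simp add: add_nonneg_pos)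
  show ?thesis
    unfolding set_lebesgue_integral_def
  proof (rule integral_FTC_atLeastAtMost[OF assms(2)])
    show "((\<lambda>t. arctan ((t - x) / y)) has_vector_derivative y / ((t - x)\<^sup>2 + y\<^sup>2))
        (at t within {a..b})" for t
      unfolding has_real_derivative_iff_has_vector_derivative[symmetric]
      by (rule derivative_eq_intros refl | use assms pos[of t] in \<open>simp add: field_simps power2_eq_square\<close>)+
  qed (use pos in \<open>auto intro!: continuous_intros simp: less_imp_neq[symmetric]\<close>)
qed

lemma window_poisson_integral:
  assumes "y > 0"
  shows "(LBINT t:{x - 1..x + 1}. y / ((t - x)\<^sup>2 + y\<^sup>2)) = 2 * arctan (1 / y)"
  by (subst poisson_kernel_integral) (use assms in \<open>auto simp: arctan_minus\<close>)

text \<open>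
  The kernel is odd about \<open>x\<close>. This cancellation is what keeps the real part of the Cauchy transform
  small next to the real line.
\<close>

lemma window_odd_integral:
  fixes x y :: real
  assumes "y > 0"
  shows "(LBINT t:{x - 1..x + 1}. (x - t) / ((t - x)\<^sup>2 + y\<^sup>2)) = 0"
proof -
  have pos: "(t - x)\<^sup>2 + y\<^sup>2 > 0" for t using assms by (simp add: add_nonneg_pos)
  have "(\<integral>t. indicator {x - 1..x + 1} t *\<^sub>R ((x - t) / ((t - x)\<^sup>2 + y\<^sup>2)) \<partial>lborel)
      = - (1 / 2) * ln ((x + 1 - x)\<^sup>2 + y\<^sup>2) - (- (1 / 2) * ln ((x - 1 - x)\<^sup>2 + y\<^sup>2))"
  proof (rule integral_FTC_atLeastAtMost)
    show "((\<lambda>t. - (1 / 2) * ln ((t - x)\<^sup>2 + y\<^sup>2)) has_vector_derivative (x - t) / ((t - x)\<^sup>2 + y\<^sup>2))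
        (at t within {x - 1..x + 1})" for t
    proof -
      have "((\<lambda>t. (t - x)\<^sup>2 + y\<^sup>2) has_real_derivative 2 * (t - x)) (at t within {x - 1..x + 1})"
        by (auto intro!: derivative_eq_intros)
      from DERIV_cmult[OF DERIV_chain2[OF DERIV_ln_divide[OF pos] this], of "- (1 / 2)"]
      have "((\<lambda>t. - (1 / 2) * ln ((t - x)\<^sup>2 + y\<^sup>2)) has_real_derivative
          - (1 / 2) * (1 / ((t - x)\<^sup>2 + y\<^sup>2) * (2 * (t - x)))) (at t within {x - 1..x + 1})" .
      moreover have "- (1 / 2) * (1 / D * (2 * (t - x))) = (x - t) / D" for D
        by (simp add: diff_divide_distrib)
      ultimately show ?thesis
        unfolding has_real_derivative_iff_has_vector_derivative[symmetric] by (simp only:)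
    qed
  qed (use pos in \<open>auto intro!: continuous_intros simp: less_imp_neq[symmetric]\<close>)
  then show ?thesis by (simp add: set_lebesgue_integral_def)
qed

text \<open>
  With \<open>s = \<bar>t - x\<bar>\<close>, the integrand \<open>s y / (s\<^sup>2 + y\<^sup>2)\<close> is at most \<open>1 / 2\<close> everywhere and at most \<open>sqrt y\<close>
  for \<open>s > sqrt y\<close>. The first bound is used on an interval of length \<open>2 sqrt y\<close>, the second on one of
  length 2.
\<close>

lemma window_first_moment_bound:
  assumes y: "y > 0"
  shows "(LBINT t:{x - 1..x + 1}. \<bar>t - x\<bar> * \<bar>y / ((t - x)\<^sup>2 + y\<^sup>2)\<bar>) \<le> 3 * sqrt y"
proof -
  define r where "r = sqrt y"
  have r: "r > 0" "y = r\<^sup>2" using y by (auto simp: r_def)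
  let ?b = "\<lambda>t. r * indicator {x - 1..x + 1} t + (1/2) * indicator {x - r..x + r} t :: real"
  have "(LBINT t:{x - 1..x + 1}. \<bar>t - x\<bar> * \<bar>y / ((t - x)\<^sup>2 + y\<^sup>2)\<bar>) \<le> (\<integral>t. ?b t \<partial>lborel)"
    unfolding set_lebesgue_integral_def
  proof (rule integral_mono')
    show "integrable lborel ?b"
      by (intro Bochner_Integration.integrable_add integrable_mult_right integrable_real_indicator)
         (auto simp: emeasure_lborel_Icc_eq)
    show "0 \<le> ?b t" for t using r by (auto simp: indicator_def)
    show "indicator {x - 1..x + 1} t *\<^sub>R (\<bar>t - x\<bar> * \<bar>y / ((t - x)\<^sup>2 + y\<^sup>2)\<bar>) \<le> ?b t" for t
    proof (cases "t \<in> {x - 1..x + 1}")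
      case True
      define s where "s = \<bar>t - x\<bar>"
      have s: "s \<ge> 0" "(t - x)\<^sup>2 = s\<^sup>2" by (auto simp: s_def)
      have pos: "s\<^sup>2 + y\<^sup>2 > 0" using y by (simp add: add_nonneg_pos)
      have eq: "\<bar>t - x\<bar> * \<bar>y / ((t - x)\<^sup>2 + y\<^sup>2)\<bar> = s * y / (s\<^sup>2 + y\<^sup>2)"
        using y s pos by (simp add: abs_of_pos flip: s_def)
      show ?thesis
      proof (cases "s \<le> r")
        case True2: True
        have "0 \<le> (s - y)\<^sup>2" by simp
        then have "s * y / (s\<^sup>2 + y\<^sup>2) \<le> 1 / 2"
          using pos by (simp add: divide_le_eq power2_eq_square algebra_simps)
        moreover have "t \<in> {x - r..x + r}" using True2 by (auto simp: s_def)
        moreover have "1 / 2 \<le> r + 1 / 2" using r(1) by simp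
        ultimately show ?thesis
          using True unfolding eq[symmetric]
          by (simp only: indicator_simps scaleR_one mult_1_right)
      next
        case False
        have "s * y \<le> r * (s\<^sup>2 + y\<^sup>2)"
        proof -
          have "s * y = r * (s * r)" by (simp add: r(2) power2_eq_square)
          also have "\<dots> \<le> r * (s * s + y\<^sup>2)"
            using False r s(1) by (intro mult_left_mono add_increasing2) (auto intro!: mult_left_mono)
          finally show ?thesis by (simp add: power2_eq_square)
        qed
        then have "s * y / (s\<^sup>2 + y\<^sup>2) \<le> r" using pos by (simp add: divide_le_eq)
        then show ?thesis using True eq by (simp add: add_increasing2)
      qed
    qed (use r in \<open>auto simp: indicator_def\<close>)
  qed
  also have "\<dots> = 3 * r" using r by simp
  finally show ?thesis by (simp add: r_def)
qed

text \<open>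
  A common bound, uniform in the distance to the real line, for the contribution of \<open>\<bar>t - x\<bar> > 1\<close> to
  \<open>F\<close> and to the Cauchy transform.
\<close>

definition far_part :: "real \<Rightarrow> real" where
  "far_part x = (\<integral>t. indicator (- {x - 1..x + 1}) t / \<bar>t - x\<bar> \<partial>gamma2)"

lemma far_part_tendsto_0: "(far_part \<longlongrightarrow> 0) at_top"
proof -
  have "((\<lambda>x. \<integral>t. indicator (- {x - 1..x + 1}) t / \<bar>t - x\<bar> \<partial>gamma2) \<longlongrightarrow> (\<integral>t. 0 \<partial>gamma2)) at_top"
  proof (rule integral_dominated_convergence_at_top[where w = "\<lambda>_. 1"])
    show "AE t in gamma2. ((\<lambda>x. indicator (- {x - 1..x + 1}) t / \<bar>t - x\<bar>) \<longlongrightarrow> (0::real)) at_top"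
    proof (rule AE_I2)
      fix t :: real
      have "((\<lambda>x. 1 / \<bar>t - x\<bar>) \<longlongrightarrow> 0) at_top" by real_asymp
      then show "((\<lambda>x. indicator (- {x - 1..x + 1}) t / \<bar>t - x\<bar>) \<longlongrightarrow> (0::real)) at_top"
        by (rule tendsto_0_le[where K = 1]) (auto simp: indicator_def)
    qed
    show "\<forall>\<^sub>F x in at_top. AE t in gamma2. norm (indicator (- {x - 1..x + 1}) t / \<bar>t - x\<bar> :: real) \<le> 1"
      by (intro always_eventually allI AE_I2) (auto simp: indicator_def divide_le_eq)
  qed auto
  then show ?thesis by (simp add: far_part_def[abs_def])
qed

lemma far_integral_bound:
  assumes h: "h \<in> borel_measurable borel"
    and le: "\<And>t. t \<notin> {x - 1..x + 1} \<Longrightarrow> \<bar>h t\<bar> \<le> 1 / \<bar>t - x\<bar>"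
  shows "\<bar>\<integral>t. indicator (- {x - 1..x + 1}) t * h t \<partial>gamma2\<bar> \<le> far_part x"
proof -
  have "\<bar>\<integral>t. indicator (- {x - 1..x + 1}) t * h t \<partial>gamma2\<bar>
      \<le> (\<integral>t. \<bar>indicator (- {x - 1..x + 1}) t * h t\<bar> \<partial>gamma2)"
    using integral_norm_bound[of gamma2 "\<lambda>t. indicator (- {x - 1..x + 1}) t * h t"] by simp
  also have "\<dots> \<le> far_part x"
    unfolding far_part_def
  proof (rule integral_mono')
    show "integrable gamma2 (\<lambda>t. indicator (- {x - 1..x + 1}) t / \<bar>t - x\<bar>)"
      by (rule gamma2.integrable_const_bound[where B = 1])
         (auto simp: indicator_def divide_le_eq)
    show "\<bar>indicator (- {x - 1..x + 1}) t * h t\<bar> \<le> indicator (- {x - 1..x + 1}) t / \<bar>t - x\<bar>" for t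
      using le[of t] by (auto simp: indicator_def)
  qed auto
  finally show ?thesis .
qed

lemma gamma2_integral_approx:
  assumes x: "x \<ge> 1" and h: "continuous_on UNIV (h :: real \<Rightarrow> real)"
    and int: "integrable gamma2 h"
    and le: "\<And>t. t \<notin> {x - 1..x + 1} \<Longrightarrow> \<bar>h t\<bar> \<le> 1 / \<bar>t - x\<bar>"
  shows "\<bar>(\<integral>t. h t \<partial>gamma2) - gamma2_density x * (LBINT t:{x - 1..x + 1}. h t)\<bar>
      \<le> far_part x + 6 * gamma2_density x * (LBINT t:{x - 1..x + 1}. \<bar>t - x\<bar> * \<bar>h t\<bar>)"
proof -
  let ?I = "{x - 1..x + 1}"
  have hm: "h \<in> borel_measurable borel" using h by (rule borel_measurable_continuous_onI)
  have "(\<integral>t. h t \<partial>gamma2) = (\<integral>t. indicator ?I t * h t + indicator (- ?I) t * h t \<partial>gamma2)"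
    by (intro Bochner_Integration.integral_cong) (auto simp: indicator_def)
  also have "\<dots> = (\<integral>t. indicator ?I t * h t \<partial>gamma2) + (\<integral>t. indicator (- ?I) t * h t \<partial>gamma2)"
  proof (rule Bochner_Integration.integral_add)
    show "integrable gamma2 (\<lambda>t. indicator ?I t * h t)"
      using integrable_mult_indicator[of ?I gamma2 h] int by simp
    show "integrable gamma2 (\<lambda>t. indicator (- ?I) t * h t)"
      using integrable_mult_indicator[of "- ?I" gamma2 h] int by simp
  qed
  finally show ?thesis
    using window_integral_approx[OF x h] far_integral_bound[OF hm le] by linarith
qed

text \<open>
  Multiplied by \<open>y\<close>, the kernel of \<open>F\<close> is the Poisson kernel, whose mass on the window is
  \<open>2 arctan (1 / y)\<close>.
\<close>

lemma fg_F_approx: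
  assumes x: "x \<ge> 1" and y: "y > 0"
  shows "\<bar>y * fg_F (Complex x y) - gamma2_density x * (2 * arctan (1 / y))\<bar>
    \<le> y * far_part x + 18 * gamma2_density x * sqrt y"
proof -
  define h where "h t = 1 / ((t - x)\<^sup>2 + y\<^sup>2)" for t
  have pos: "(t - x)\<^sup>2 + y\<^sup>2 > 0" for t using y by (simp add: add_nonneg_pos)
  have hF: "h t = 1 / (cmod (Complex x y - of_real t))\<^sup>2" for t
    by (simp add: h_def cmod_power2 power2_commute)
  have slit: "Complex x y \<in> slit_plane" using y by (simp add: slit_plane_def)
  have "\<bar>(\<integral>t. h t \<partial>gamma2) - gamma2_density x * (LBINT t:{x - 1..x + 1}. h t)\<bar>
      \<le> far_part x + 6 * gamma2_density x * (LBINT t:{x - 1..x + 1}. \<bar>t - x\<bar> * \<bar>h t\<bar>)"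
  proof (rule gamma2_integral_approx[OF x])
    show "continuous_on UNIV h"
      unfolding h_def using pos by (auto intro!: continuous_intros simp: less_imp_neq[symmetric])
    show "integrable gamma2 h"
      unfolding hF using integrable_cauchy_kernel(2)[OF slit] .
    fix t assume "t \<notin> {x - 1..x + 1}"
    then have t: "\<bar>t - x\<bar> > 1" by auto
    have "\<bar>t - x\<bar> * 1 \<le> \<bar>t - x\<bar> * \<bar>t - x\<bar>" using t by (intro mult_left_mono) auto
    then have "\<bar>t - x\<bar> \<le> (t - x)\<^sup>2 + y\<^sup>2" by (simp add: power2_eq_square add_increasing2)
    then show "\<bar>h t\<bar> \<le> 1 / \<bar>t - x\<bar>"
      using t pos[of t] by (simp add: h_def frac_le)
  qed
  moreover define L M where "L = (LBINT t:{x - 1..x + 1}. h t)"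
    and "M = (LBINT t:{x - 1..x + 1}. \<bar>t - x\<bar> * \<bar>h t\<bar>)"
  moreover have "(\<integral>t. h t \<partial>gamma2) = fg_F (Complex x y)" unfolding hF fg_F_gamma2 ..
  ultimately have main: "\<bar>fg_F (Complex x y) - gamma2_density x * L\<bar> \<le> far_part x + 6 * gamma2_density x * M"
    by simp
  have yh: "y / ((t - x)\<^sup>2 + y\<^sup>2) = y * h t" for t by (simp add: h_def)
  have yL: "y * L = 2 * arctan (1 / y)"
    using window_poisson_integral[OF y, of x] unfolding yh L_def by simp
  have "\<bar>t - x\<bar> * \<bar>y * h t\<bar> = y * (\<bar>t - x\<bar> * \<bar>h t\<bar>)" for t
    using y by (simp add: abs_mult)
  then have yM: "y * M \<le> 3 * sqrt y"
    using window_first_moment_bound[OF y, of x] unfolding yh M_def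
    by (simp only: set_integral_mult_right)
  have "y * fg_F (Complex x y) - gamma2_density x * (2 * arctan (1 / y)) = y * (fg_F (Complex x y) - gamma2_density x * L)"
    unfolding yL[symmetric] by algebra
  also have "\<bar>\<dots>\<bar> = y * \<bar>fg_F (Complex x y) - gamma2_density x * L\<bar>"
    using y by (simp add: abs_mult)
  also have "\<dots> \<le> y * (far_part x + 6 * gamma2_density x * M)"
    using main y by (intro mult_left_mono) auto
  also have "\<dots> = y * far_part x + 6 * gamma2_density x * (y * M)" by algebra
  also have "\<dots> \<le> y * far_part x + 6 * gamma2_density x * (3 * sqrt y)"
    using yM x by (intro add_left_mono mult_left_mono) (auto simp: gamma2_density_def)
  finally show ?thesis by simp
qed

lemma Re_cauchy_transform_gamma2_bound:
  assumes x: "x \<ge> 1" and y: "y > 0"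
  shows "\<bar>Re (cauchy_transform gamma2 (Complex x y))\<bar> \<le> far_part x + 12 * gamma2_density x"
proof -
  define h where "h t = (x - t) / ((t - x)\<^sup>2 + y\<^sup>2)" for t
  have pos: "(t - x)\<^sup>2 + y\<^sup>2 > 0" for t using y by (simp add: add_nonneg_pos)
  have slit: "Complex x y \<in> slit_plane" using y by (simp add: slit_plane_def)
  have hR: "h t = Re (1 / (Complex x y - of_real t))" for t
    by (simp add: h_def Re_divide power2_commute)
  have sq: "\<bar>t - x\<bar> * \<bar>h t\<bar> \<le> 1" for t
  proof -
    have "\<bar>t - x\<bar> * \<bar>h t\<bar> = (t - x)\<^sup>2 / ((t - x)\<^sup>2 + y\<^sup>2)"
      using pos[of t] by (simp add: h_def abs_minus_commute power2_eq_square flip: abs_mult)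
    then show ?thesis using pos[of t] by simp
  qed
  have cont: "continuous_on UNIV h"
    unfolding h_def using pos by (auto intro!: continuous_intros simp: less_imp_neq[symmetric])
  have "\<bar>(\<integral>t. h t \<partial>gamma2) - gamma2_density x * (LBINT t:{x - 1..x + 1}. h t)\<bar>
      \<le> far_part x + 6 * gamma2_density x * (LBINT t:{x - 1..x + 1}. \<bar>t - x\<bar> * \<bar>h t\<bar>)"
  proof (rule gamma2_integral_approx[OF x cont])
    show "integrable gamma2 h"
      unfolding hR using integrable_cauchy_kernel(1)[OF slit] by (rule integrable_Re)
    fix t assume "t \<notin> {x - 1..x + 1}"
    then have "\<bar>t - x\<bar> > 0" by auto
    then show "\<bar>h t\<bar> \<le> 1 / \<bar>t - x\<bar>"
      using sq[of t] by (simp add: le_divide_eq mult.commute)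
  qed
  moreover have "(\<integral>t. h t \<partial>gamma2) = Re (cauchy_transform gamma2 (Complex x y))"
    unfolding hR cauchy_transform_def using integrable_cauchy_kernel(1)[OF slit] by (rule integral_Re)
  moreover have "(LBINT t:{x - 1..x + 1}. h t) = 0"
    unfolding h_def by (rule window_odd_integral[OF y])
  moreover have "(LBINT t:{x - 1..x + 1}. \<bar>t - x\<bar> * \<bar>h t\<bar>) \<le> (LBINT t:{x - 1..x + 1}. 1)"
  proof (rule set_integral_mono)
    show "set_integrable lborel {x - 1..x + 1} (\<lambda>t. \<bar>t - x\<bar> * \<bar>h t\<bar>)"
      by (rule borel_integrable_atLeastAtMost')
         (intro continuous_intros continuous_on_subset[OF cont] subset_UNIV)
    show "set_integrable lborel {x - 1..x + 1} (\<lambda>t. 1 :: real)"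
      by (rule borel_integrable_atLeastAtMost') simp
  qed (rule sq)
  then have "6 * gamma2_density x * (LBINT t:{x - 1..x + 1}. \<bar>t - x\<bar> * \<bar>h t\<bar>) \<le> 6 * gamma2_density x * 2"
    using x by (intro mult_left_mono) (auto simp: gamma2_density_def set_integral_const)
  ultimately show ?thesis by simp
qed

lemma gamma2_density_tendsto_0: "(gamma2_density \<longlongrightarrow> 0) at_top"
  unfolding gamma2_density_def by real_asymp

lemma fg_P_asymp:
  assumes "\<alpha> > 0"
  shows "((\<lambda>x. fg_P \<alpha> x - x) \<longlongrightarrow> \<alpha>) at_top"
proof -
  have "((\<lambda>x. fg_P \<alpha> x - x - \<alpha>) \<longlongrightarrow> 0) at_top"
  proof (rule Lim_null_comparison)
    show "((\<lambda>x. \<alpha> * (far_part x + 12 * gamma2_density x)) \<longlongrightarrow> 0) at_top"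
      using tendsto_mult[OF tendsto_const tendsto_add[OF far_part_tendsto_0
          tendsto_mult[OF tendsto_const gamma2_density_tendsto_0]], of \<alpha> 12] by simp
    show "\<forall>\<^sub>F x in at_top. norm (fg_P \<alpha> x - x - \<alpha>) \<le> \<alpha> * (far_part x + 12 * gamma2_density x)"
      using eventually_ge_at_top[of 1]
    proof eventually_elim
      case (elim x)
      have "fg_v \<alpha> x > 0" using fg_v_pos[OF assms] fg_c_pos[OF assms] elim by simp
      from mult_left_mono[OF Re_cauchy_transform_gamma2_bound[OF elim this], of \<alpha>]
      show ?case
        using assms by (simp add: fg_P_def fg_H_gamma2 abs_mult)
    qed
  qed
  from tendsto_add[OF this tendsto_const[of \<alpha>]] show ?thesis by simp
qed

text \<open>
  With \<open>F = 1 / \<alpha>\<close> on the curve, \<open>fg_F_approx\<close> says that \<open>v / \<alpha>\<close> is close to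
  \<open>2 g arctan (1 / v)\<close>, where \<open>g x = x e\<^sup>-\<^sup>x\<close>. The error term \<open>v far_part x\<close> can be absorbed into the left
  side as soon as \<open>far_part x < 1 / (2 \<alpha>)\<close>. This first gives \<open>v \<le> B g\<close>, so \<open>v\<close> tends to 0. Then
  \<open>2 arctan (1 / v)\<close> tends to \<open>\<pi>\<close> and the errors relative to \<open>g\<close> vanish.
\<close>

lemma fg_v_asymp:
  assumes "\<alpha> > 0"
  shows "((\<lambda>x. fg_v \<alpha> x / gamma2_density x) \<longlongrightarrow> pi * \<alpha>) at_top"
    and "(fg_v \<alpha> \<longlongrightarrow> 0) at_top"
proof -
  define B where "B = 2 * \<alpha> * (pi + 18 * sqrt (sqrt \<alpha>))"
  have B: "B \<ge> 0" using assms by (simp add: B_def)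
  have approx: "\<bar>fg_v \<alpha> x / \<alpha> - gamma2_density x * (2 * arctan (1 / fg_v \<alpha> x))\<bar>
      \<le> fg_v \<alpha> x * far_part x + 18 * gamma2_density x * sqrt (fg_v \<alpha> x)"
    and vpos: "fg_v \<alpha> x > 0" if "x \<ge> 1" for x
  proof -
    have x: "x > - fg_c \<alpha>" using fg_c_pos[OF assms] that by simp
    show "fg_v \<alpha> x > 0" by (rule fg_v_pos[OF assms x])
    from fg_F_approx[OF that this] show "\<bar>fg_v \<alpha> x / \<alpha> - gamma2_density x * (2 * arctan (1 / fg_v \<alpha> x))\<bar>
      \<le> fg_v \<alpha> x * far_part x + 18 * gamma2_density x * sqrt (fg_v \<alpha> x)"
      by (simp add: fg_F_fg_v[OF assms x])
  qed
  have gpos: "gamma2_density x > 0" if "x \<ge> 1" for x using that by (simp add: gamma2_density_def)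
  have far_small: "\<forall>\<^sub>F x in at_top. far_part x < 1 / (2 * \<alpha>)"
    using assms by (intro order_tendstoD(2)[OF far_part_tendsto_0]) simp
  have bound: "\<forall>\<^sub>F x in at_top. fg_v \<alpha> x \<le> B * gamma2_density x"
    using eventually_ge_at_top[of 1] far_small
  proof eventually_elim
    case (elim x)
    let ?v = "fg_v \<alpha> x" and ?g = "gamma2_density x"
    have "?v / \<alpha> \<le> ?g * (2 * arctan (1 / ?v)) + ?v * far_part x + 18 * ?g * sqrt ?v"
      using approx[OF elim(1)] by linarith
    moreover have "?g * (2 * arctan (1 / ?v)) \<le> ?g * pi"
      using gpos[OF elim(1)] arctan_ubound[of "1 / ?v"] by (intro mult_left_mono) auto
    moreover have "?v * far_part x \<le> ?v * (1 / (2 * \<alpha>))"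
      using elim vpos[of x] by (intro mult_left_mono) auto
    moreover have "18 * ?g * sqrt ?v \<le> 18 * ?g * sqrt (sqrt \<alpha>)"
      using gpos[OF elim(1)] fg_v_bounds(2)[OF assms] by (intro mult_left_mono) auto
    ultimately have "?v / \<alpha> - ?v * (1 / (2 * \<alpha>)) \<le> ?g * (pi + 18 * sqrt (sqrt \<alpha>))"
      by (simp only: distrib_left)
    then have "(2 * \<alpha>) * (?v / \<alpha> - ?v * (1 / (2 * \<alpha>))) \<le> (2 * \<alpha>) * (?g * (pi + 18 * sqrt (sqrt \<alpha>)))"
      using assms by (intro mult_left_mono) auto
    also have "(2 * \<alpha>) * (?v / \<alpha> - ?v * (1 / (2 * \<alpha>))) = ?v"
      using assms by (simp add: right_diff_distrib)
    finally show ?case by (simp add: B_def mult_ac)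
  qed
  show v0: "(fg_v \<alpha> \<longlongrightarrow> 0) at_top"
  proof (rule Lim_null_comparison)
    show "\<forall>\<^sub>F x in at_top. norm (fg_v \<alpha> x) \<le> B * gamma2_density x"
      using bound by eventually_elim (use fg_v_bounds(1)[OF assms] in simp)
    show "((\<lambda>x. B * gamma2_density x) \<longlongrightarrow> 0) at_top"
      using tendsto_mult[OF tendsto_const gamma2_density_tendsto_0] by fastforce
  qed
  have err: "((\<lambda>x. fg_v \<alpha> x / gamma2_density x / \<alpha> - 2 * arctan (1 / fg_v \<alpha> x)) \<longlongrightarrow> 0) at_top"
  proof (rule Lim_null_comparison)
    show "((\<lambda>x. B * far_part x + 18 * sqrt (fg_v \<alpha> x)) \<longlongrightarrow> 0) at_top"
      using tendsto_add[OF tendsto_mult[OF tendsto_const far_part_tendsto_0]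
          tendsto_mult[OF tendsto_const tendsto_real_sqrt[OF v0]], of B 18] by simp
    show "\<forall>\<^sub>F x in at_top. norm (fg_v \<alpha> x / gamma2_density x / \<alpha> - 2 * arctan (1 / fg_v \<alpha> x))
        \<le> B * far_part x + 18 * sqrt (fg_v \<alpha> x)"
      using bound eventually_ge_at_top[of 1]
    proof eventually_elim
      case (elim x)
      let ?v = "fg_v \<alpha> x" and ?g = "gamma2_density x"
      note g = gpos[OF elim(2)]
      have far: "far_part x \<ge> 0" unfolding far_part_def by (intro integral_nonneg_AE) auto
      have "?g * \<bar>?v / ?g / \<alpha> - 2 * arctan (1 / ?v)\<bar> = \<bar>?g * (?v / ?g / \<alpha> - 2 * arctan (1 / ?v))\<bar>"
        using g by (simp add: abs_mult)
      also have "?g * (?v / ?g / \<alpha> - 2 * arctan (1 / ?v)) = ?v / \<alpha> - ?g * (2 * arctan (1 / ?v))"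
        using g by (simp add: right_diff_distrib)
      also have "\<bar>\<dots>\<bar> \<le> ?v * far_part x + 18 * ?g * sqrt ?v" by (rule approx[OF elim(2)])
      also have "\<dots> \<le> (B * ?g) * far_part x + 18 * ?g * sqrt ?v"
        using mult_right_mono[OF elim(1) far] by simp
      also have "\<dots> = ?g * (B * far_part x + 18 * sqrt ?v)" by algebra
      finally show ?case using g by simp
    qed
  qed
  have "filterlim (\<lambda>x. inverse (fg_v \<alpha> x)) at_top at_top"
    by (intro filterlim_inverse_at_top[OF v0] eventually_mono[OF eventually_ge_at_top[of 1]] vpos)
  then have "((\<lambda>x. 2 * arctan (1 / fg_v \<alpha> x)) \<longlongrightarrow> 2 * (pi / 2)) at_top"
    by (intro tendsto_mult tendsto_const filterlim_compose[OF tendsto_arctan_at_top])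
       (simp add: inverse_eq_divide)
  from tendsto_mult[OF tendsto_add[OF err this] tendsto_const[of \<alpha>]]
  show "((\<lambda>x. fg_v \<alpha> x / gamma2_density x) \<longlongrightarrow> pi * \<alpha>) at_top"
    using assms by simp
qed

lemma free_gamma_density_fg_P_asymp:
  assumes "\<alpha> > 0"
  shows "((\<lambda>x. free_gamma_density \<alpha> (fg_P \<alpha> x) / (inverse (fg_P \<alpha> x) * exp (- fg_P \<alpha> x)))
    \<longlongrightarrow> \<alpha> * exp \<alpha>) at_top"
proof -
  have inv0: "((\<lambda>x. 1 / x :: real) \<longlongrightarrow> 0) at_top" by real_asymp
  have ratio: "((\<lambda>x. 1 + (fg_P \<alpha> x - x) * (1 / x)) \<longlongrightarrow> 1 + \<alpha> * 0) at_top"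
    by (intro tendsto_intros fg_P_asymp[OF assms] inv0)
  have vx: "((\<lambda>x. 1 / (1 + (fg_v \<alpha> x * (1 / x))\<^sup>2)) \<longlongrightarrow> 1 / (1 + (0 * 0)\<^sup>2)) at_top"
    by (intro tendsto_intros fg_v_asymp(2)[OF assms] inv0) simp
  have "((\<lambda>x. 1 / pi * (fg_v \<alpha> x / gamma2_density x) * (1 + (fg_P \<alpha> x - x) * (1 / x)) * exp (fg_P \<alpha> x - x)
      * (1 / (1 + (fg_v \<alpha> x * (1 / x))\<^sup>2)))
    \<longlongrightarrow> 1 / pi * (pi * \<alpha>) * (1 + \<alpha> * 0) * exp \<alpha> * (1 / (1 + (0 * 0)\<^sup>2))) at_top"
    by (intro tendsto_mult tendsto_const fg_v_asymp(1)[OF assms] ratio vx tendsto_exp fg_P_asymp[OF assms])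
  then have "((\<lambda>x. 1 / pi * (fg_v \<alpha> x / gamma2_density x) * (1 + (fg_P \<alpha> x - x) * (1 / x)) * exp (fg_P \<alpha> x - x)
      * (1 / (1 + (fg_v \<alpha> x * (1 / x))\<^sup>2))) \<longlongrightarrow> \<alpha> * exp \<alpha>) at_top"
    by simp
  moreover have "\<forall>\<^sub>F x in at_top. 1 / pi * (fg_v \<alpha> x / gamma2_density x) * (1 + (fg_P \<alpha> x - x) * (1 / x))
      * exp (fg_P \<alpha> x - x) * (1 / (1 + (fg_v \<alpha> x * (1 / x))\<^sup>2))
    = free_gamma_density \<alpha> (fg_P \<alpha> x) / (inverse (fg_P \<alpha> x) * exp (- fg_P \<alpha> x))"
    using eventually_gt_at_top[of 0]
  proof eventually_elim
    case (elim x)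
    define p v where "p = fg_P \<alpha> x" and "v = fg_v \<alpha> x"
    have 1: "1 + (p - x) * (1 / x) = p / x" using elim by (simp add: field_simps)
    have 2: "1 / (1 + (v * (1 / x))\<^sup>2) = x\<^sup>2 / (x\<^sup>2 + v\<^sup>2)"
      using elim by (simp add: power_divide add_divide_eq_iff divide_simps)
    have 3: "v / gamma2_density x = v * exp x / x" by (simp add: gamma2_density_def exp_minus field_simps)
    have "1 / pi * (v * exp x / x) * (p / x) * exp (p - x) * (x\<^sup>2 / D)
        = 1 / pi * (v / D) / (inverse p * exp (- p))" for D
      using elim by (simp add: exp_diff exp_minus power2_eq_square field_simps)
    moreover have "free_gamma_density \<alpha> p = 1 / pi * (v / (x\<^sup>2 + v\<^sup>2))"
      unfolding p_def v_def free_gamma_density_fg_P[OF assms] fg_Q_def ..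
    ultimately show ?case
      unfolding p_def[symmetric] v_def[symmetric] 1 2 3 by simp
  qed
  ultimately show ?thesis by (rule Lim_transform_eventually)
qed

text \<open>
  Substitute \<open>\<xi> = P x\<close>; the inverse of \<open>P\<close> tends to infinity because \<open>P\<close> is close to a translation.
\<close>

lemma free_gamma_density_asymp:
  assumes "\<alpha> > 0"
  shows "((\<lambda>\<xi>. free_gamma_density \<alpha> \<xi> / (inverse \<xi> * exp (- \<xi>))) \<longlongrightarrow> \<alpha> * exp \<alpha>) at_top"
proof -
  define X where "X = inv (fg_P \<alpha>)"
  have PX: "fg_P \<alpha> (X \<xi>) = \<xi>" for \<xi>
    unfolding X_def using surj_fg_P[OF assms, of \<xi>] by (metis f_inv_into_f rangeI)
  have "filterlim X at_top at_top"
  proof (rule filterlim_at_top_mono)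
    show "filterlim (\<lambda>\<xi>. \<xi> - (\<alpha> + sqrt \<alpha>)) at_top at_top" by real_asymp
    show "\<forall>\<^sub>F \<xi> in at_top. \<xi> - (\<alpha> + sqrt \<alpha>) \<le> X \<xi>"
    proof (rule always_eventually, rule allI)
      fix \<xi>
      show "\<xi> - (\<alpha> + sqrt \<alpha>) \<le> X \<xi>"
        using fg_P_near_shift[OF assms, of "X \<xi>"] unfolding PX by linarith
    qed
  qed
  from filterlim_compose[OF free_gamma_density_fg_P_asymp[OF assms] this]
  show ?thesis unfolding PX .
qed

section \<open>The characteristic function of the Gamma law\<close>

lemma integral_gamma_law:
  fixes f :: "real \<Rightarrow> 'a::{banach,second_countable_topology}"
  assumes "\<alpha> > 0" and [measurable]: "f \<in> borel_measurable borel"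
  shows "(\<integral>t. f t \<partial>gamma_law \<alpha>)
    = (\<integral>t. (1 / Gamma \<alpha> * t powr (\<alpha> - 1) * exp (- t) * indicator {0..} t) *\<^sub>R f t \<partial>lborel)"
  unfolding gamma_law_def
  by (rule integral_density) (use Gamma_real_pos[OF assms(1)] in \<open>auto simp: indicator_def\<close>)

lemma AE_gamma_law_nonneg: "AE t in gamma_law \<alpha>. t \<ge> 0"
  unfolding gamma_law_def by (subst AE_density) (auto simp: indicator_def)

lemma sets_gamma_law [simp]: "sets (gamma_law \<alpha>) = sets borel"
  by (simp add: gamma_law_def)

lemma gamma_law_laplace_real:
  assumes \<alpha>: "\<alpha> > 0" and prob: "prob_space (gamma_law \<alpha>)" and \<sigma>: "\<sigma> \<ge> 0"
  shows "(\<integral>t. exp (- \<sigma> * t) \<partial>gamma_law \<alpha>) = (1 + \<sigma>) powr (- \<alpha>)"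
proof -
  interpret prob_space "gamma_law \<alpha>" by fact
  define f where "f t = 1 / Gamma \<alpha> * t powr (\<alpha> - 1) * exp (- t) * indicator {0..} t" for t :: real
  define c where "c = 1 + \<sigma>"
  have c: "c > 0" using \<sigma> by (simp add: c_def)
  have "(1::real) = (\<integral>t. 1 \<partial>gamma_law \<alpha>)" using prob_space by simp
  also have "\<dots> = (\<integral>t. f t \<partial>lborel)"
    by (subst integral_gamma_law[OF \<alpha>]) (auto simp: f_def[abs_def])
  also have "\<dots> = c * (\<integral>t. f (c * t) \<partial>lborel)"
    using lborel_integral_real_affine[of c f 0] c by simp
  also have "(\<lambda>t. f (c * t)) = (\<lambda>t. c powr (\<alpha> - 1) * (f t * exp (- \<sigma> * t)))"
  proof
    fix t
    have "exp (- (c * t)) = exp (- t) * exp (- \<sigma> * t)"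
      by (simp add: c_def algebra_simps flip: exp_add)
    then show "f (c * t) = c powr (\<alpha> - 1) * (f t * exp (- \<sigma> * t))"
      using c by (cases "t \<ge> 0") (auto simp: f_def powr_mult indicator_def zero_le_mult_iff)
  qed
  also have "c * (\<integral>t. c powr (\<alpha> - 1) * (f t * exp (- \<sigma> * t)) \<partial>lborel)
      = c powr \<alpha> * (\<integral>t. f t * exp (- \<sigma> * t) \<partial>lborel)"
    using c by (simp add: powr_diff)
  also have "(\<integral>t. f t * exp (- \<sigma> * t) \<partial>lborel) = (\<integral>t. exp (- \<sigma> * t) \<partial>gamma_law \<alpha>)"
    by (subst integral_gamma_law[OF \<alpha>]) (auto simp: f_def)
  finally show ?thesis
    using c by (simp add: powr_minus c_def field_simps)
qed

lemma norm_exp_le_1: "Re w \<ge> 0 \<Longrightarrow> t \<ge> 0 \<Longrightarrow> cmod (exp (- w * of_real t)) \<le> 1"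
  by simp

text \<open>
  Both sides are holomorphic for \<open>Re w > 0\<close> and agree on the positive reals by the substitution
  \<open>t \<mapsto> (1 + \<sigma>) t\<close> of \<open>gamma_law_laplace_real\<close>.
\<close>

lemma gamma_law_laplace:
  assumes \<alpha>: "\<alpha> > 0" and prob: "prob_space (gamma_law \<alpha>)" and w: "Re w > 0"
  shows "(\<integral>t. exp (- w * of_real t) \<partial>gamma_law \<alpha>) = exp (- of_real \<alpha> * Ln (1 + w))"
proof -
  interpret prob_space "gamma_law \<alpha>" by fact
  define S where "S = {w. 0 < Re w}"
  define L where "L w = (\<integral>t. exp (- w * of_real t) \<partial>gamma_law \<alpha>)" for w :: complex
  have S: "open S" "connected S"
    unfolding S_def by (auto intro: open_halfspace_Re_gt convex_connected convex_halfspace_Re_gt)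
  have holL: "L holomorphic_on S"
    unfolding L_def
  proof (rule holomorphic_on_integral[OF _ S(1)])
    show "(\<lambda>t. exp (- w * of_real t)) \<in> borel_measurable (gamma_law \<alpha>)" for w :: complex
      by (subst measurable_cong_sets[OF sets_gamma_law refl]) measurable
    show "AE t in gamma_law \<alpha>. (\<lambda>w. exp (- w * of_real t)) holomorphic_on S"
      by (intro AE_I2 holomorphic_intros)
    fix z assume z: "z \<in> S"
    have "AE t in gamma_law \<alpha>. \<forall>w\<in>ball z (Re z). cmod (exp (- w * of_real t)) \<le> 1"
      using AE_gamma_law_nonneg
    proof eventually_elim
      case (elim t)
      show ?case
      proof
        fix w assume "w \<in> ball z (Re z)"
        then have "\<bar>Re (z - w)\<bar> < Re z"
          using abs_Re_le_cmod[of "z - w"] by (simp add: dist_norm)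
        then show "cmod (exp (- w * of_real t)) \<le> 1"
          using elim by (intro norm_exp_le_1) auto
      qed
    qed
    then show "\<exists>e>0. \<exists>g. integrable (gamma_law \<alpha>) g \<and>
        (AE t in gamma_law \<alpha>. \<forall>w\<in>ball z e. cmod (exp (- w * of_real t)) \<le> g t)"
      using z by (intro exI[of _ "Re z"] conjI exI[of _ "\<lambda>_. 1"]) (auto simp: S_def)
  qed
  have "L w - exp (- of_real \<alpha> * Ln (1 + w)) = 0"
  proof (rule analytic_continuation[of "\<lambda>w. L w - exp (- of_real \<alpha> * Ln (1 + w))" S])
    show "(\<lambda>w. L w - exp (- of_real \<alpha> * Ln (1 + w))) holomorphic_on S"
      by (intro holomorphic_intros holL) (auto simp: S_def complex_nonpos_Reals_iff)
    show "of_real ` {0<..} \<subseteq> S" "1 \<in> S" "w \<in> S" using w by (auto simp: S_def)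
    have "(1::real) islimpt {0<..}"
      by (rule interior_limit_point) (simp add: interior_open)
    then show "(1::complex) islimpt of_real ` {0<..}"
      using islimpt_isCont_image[of 1 "{0<..}" complex_of_real] 
      by (simp add: eventually_at_filter)
    fix z :: complex assume "z \<in> of_real ` {0<..}"
    then obtain x where x: "x > 0" "z = of_real x" by auto
    have "L z = of_real (\<integral>t. exp (- x * t) \<partial>gamma_law \<alpha>)"
    proof -
      have "exp (- z * of_real t) = complex_of_real (exp (- x * t))" for t
        by (simp add: x(2) flip: exp_of_real)
      then show ?thesis by (simp only: L_def integral_complex_of_real)
    qed
    also have "\<dots> = of_real ((1 + x) powr (- \<alpha>))"
      using gamma_law_laplace_real[OF \<alpha> prob, of x] x by simp
    also have "\<dots> = exp (- of_real \<alpha> * Ln (1 + z))"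
      using x Ln_of_real[of "1 + x"] by (simp add: powr_def exp_of_real[symmetric])
    finally show "L z - exp (- of_real \<alpha> * Ln (1 + z)) = 0" by simp
  qed (use S in auto)
  then show ?thesis by (simp add: L_def)
qed

text \<open>
  The Laplace transform is continuous up to the imaginary axis by dominated convergence, and the
  characteristic function is its boundary value.
\<close>

lemma char_gamma_law:
  assumes \<alpha>: "\<alpha> > 0" and prob: "prob_space (gamma_law \<alpha>)"
  shows "char (gamma_law \<alpha>) u = exp (- of_real \<alpha> * Ln (1 - \<i> * of_real u))"
proof (rule LIMSEQ_unique)
  interpret prob_space "gamma_law \<alpha>" by fact
  define w where "w n = of_real (inverse (real (Suc n))) - \<i> * of_real u" for n
  have w: "w \<longlonglongrightarrow> - \<i> * of_real u"
    unfolding w_def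
    using tendsto_diff[OF tendsto_of_real[OF LIMSEQ_inverse_real_of_nat] tendsto_const[of "\<i> * of_real u"]]
    by simp
  have Re_w: "Re (w n) > 0" for n by (simp add: w_def)
  show "(\<lambda>n. exp (- of_real \<alpha> * Ln (1 + w n))) \<longlonglongrightarrow> exp (- of_real \<alpha> * Ln (1 - \<i> * of_real u))"
    using tendsto_add[OF tendsto_const[of 1] w]
    by (intro tendsto_intros tendsto_Ln) (auto simp: complex_nonpos_Reals_iff)
  have "(\<lambda>n. \<integral>t. exp (- w n * of_real t) \<partial>gamma_law \<alpha>) \<longlonglongrightarrow> (\<integral>t. iexp (u * t) \<partial>gamma_law \<alpha>)"
  proof (rule integral_dominated_convergence[where w = "\<lambda>_. 1"])
    show "AE t in gamma_law \<alpha>. (\<lambda>n. exp (- w n * of_real t)) \<longlonglongrightarrow> iexp (u * t)"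
    proof (rule AE_I2)
      fix t
      have "(\<lambda>n. exp (- w n * of_real t)) \<longlonglongrightarrow> exp (- (- \<i> * of_real u) * of_real t)"
        by (intro tendsto_intros w)
      then show "(\<lambda>n. exp (- w n * of_real t)) \<longlonglongrightarrow> iexp (u * t)" by (simp add: mult.assoc)
    qed
    show "AE t in gamma_law \<alpha>. cmod (exp (- w n * of_real t)) \<le> 1" for n
      using AE_gamma_law_nonneg by eventually_elim (intro norm_exp_le_1 less_imp_le[OF Re_w])
    show "(\<lambda>t. exp (- w n * of_real t)) \<in> borel_measurable (gamma_law \<alpha>)" for n
      by (subst measurable_cong_sets[OF sets_gamma_law refl]) measurable
    show "(\<lambda>t. iexp (u * t)) \<in> borel_measurable (gamma_law \<alpha>)"
      by (subst measurable_cong_sets[OF sets_gamma_law refl]) measurable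
  qed simp
  then show "(\<lambda>n. exp (- of_real \<alpha> * Ln (1 + w n))) \<longlonglongrightarrow> char (gamma_law \<alpha>) u"
    unfolding gamma_law_laplace[OF \<alpha> prob Re_w] char_def .
qed

text \<open>
  The exponential law. It transfers exponents of infinitely divisible laws to free cumulant transforms
  by averaging over dilations.
\<close>

definition exp1 :: "real measure" where
  "exp1 = density lborel (\<lambda>t. ennreal (erlang_density 0 1 t))"

interpretation exp1: prob_space exp1
  unfolding exp1_def by (rule prob_space_erlang_density) simp

lemma sets_exp1 [measurable_cong, simp]: "sets exp1 = sets borel"
  by (simp add: exp1_def)

lemma space_exp1 [simp]: "space exp1 = UNIV"
  by (simp add: exp1_def)

lemma AE_exp1_pos: "AE t in exp1. t > 0"
proof -
  have "AE t in lborel. (t::real) \<noteq> 0" by (rule AE_lborel_singleton)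
  then show ?thesis
    unfolding exp1_def by (subst AE_density) (auto simp: erlang_density_def elim!: eventually_mono)
qed

lemma exp1_eq_gamma_law: "exp1 = gamma_law 1"
  unfolding exp1_def gamma_law_def
proof (rule density_cong)
  have "AE t in lborel. (t::real) \<noteq> 0" by (rule AE_lborel_singleton)
  then show "AE t in lborel. ennreal (erlang_density 0 1 t)
      = ennreal (1 / Gamma 1 * t powr (1 - 1) * exp (- t) * indicator {0..} t)"
    by eventually_elim (auto simp: erlang_density_def indicator_def)
qed auto

lemma integral_exp1:
  fixes f :: "real \<Rightarrow> 'a::{banach,second_countable_topology}"
  assumes [measurable]: "f \<in> borel_measurable borel"
  shows "(\<integral>t. f t \<partial>exp1) = (LBINT t:{0..}. exp (- t) *\<^sub>R f t)"
proof -
  have "(\<integral>t. f t \<partial>exp1) = (\<integral>t. erlang_density 0 1 t *\<^sub>R f t \<partial>lborel)"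
    unfolding exp1_def by (rule integral_density) auto
  also have "\<dots> = (LBINT t:{0..}. exp (- t) *\<^sub>R f t)"
    unfolding set_lebesgue_integral_def
    by (intro Bochner_Integration.integral_cong) (auto simp: erlang_density_def indicator_def)
  finally show ?thesis .
qed

lemma exp1_char: "(\<integral>x. exp (\<i> * of_real (v * x)) \<partial>exp1) = 1 / (1 - \<i> * of_real v)"
proof -
  have "1 - \<i> * of_real v \<noteq> 0" by (simp add: complex_eq_iff)
  then have "exp (- Ln (1 - \<i> * of_real v)) = 1 / (1 - \<i> * of_real v)"
    by (simp add: exp_minus inverse_eq_divide)
  then show ?thesis
    using char_gamma_law[of 1 v] exp1.prob_space_axioms
    by (simp add: char_def exp1_eq_gamma_law)
qed

lemma exp1_moment: "has_bochner_integral exp1 (\<lambda>x. x ^ i) (fact i)"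
proof (rule has_bochner_integral_nn_integral)
  show "AE x in exp1. 0 \<le> x ^ i" using AE_exp1_pos by eventually_elim simp
  have "(\<integral>\<^sup>+x. ennreal (x ^ i) \<partial>exp1) = (\<integral>\<^sup>+x. ennreal (erlang_density 0 1 x) * ennreal (x ^ i) \<partial>lborel)"
    unfolding exp1_def by (subst nn_integral_density) auto
  also have "\<dots> = (\<integral>\<^sup>+x. ennreal (erlang_density 0 1 x * x ^ i) \<partial>lborel)"
    by (intro nn_integral_cong) (auto simp: ennreal_mult' erlang_density_def)
  also have "\<dots> = ennreal (fact i)"
    using nn_integral_erlang_ith_moment[of 1 0 i] by simp
  finally show "(\<integral>\<^sup>+x. ennreal (x ^ i) \<partial>exp1) = ennreal (fact i)" .
qed auto

section \<open>From Levy--Khintchine exponents to free cumulant transforms\<close>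

text \<open>
  The difference of the two logarithms is continuous and has values in the discrete set of integer
  multiples of \<open>2 \<pi> \<i>\<close>.
\<close>

lemma continuous_log_unique:
  fixes f g :: "real \<Rightarrow> complex"
  assumes cont: "continuous_on UNIV f" "continuous_on UNIV g"
    and eq: "\<And>x. exp (f x) = exp (g x)" and 0: "f 0 = g 0"
  shows "f x = g x"
proof -
  have "(\<lambda>x. f x - g x) constant_on UNIV"
  proof (rule continuous_discrete_range_constant)
    show "continuous_on UNIV (\<lambda>x. f x - g x)" by (intro continuous_intros cont)
    fix x
    have "2 * pi \<le> cmod ((f y - g y) - (f x - g x))" if "f y - g y \<noteq> f x - g x" for y
    proof -
      have "exp ((f y - g y) - (f x - g x)) = 1" by (simp add: exp_diff eq)
      then obtain n :: int where n: "Re ((f y - g y) - (f x - g x)) = 0"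
        "Im ((f y - g y) - (f x - g x)) = of_int (2 * n) * pi"
        unfolding exp_eq_1 by auto
      then have "n \<noteq> 0" using that by (auto simp: complex_eq_iff)
      then have "1 \<le> \<bar>real_of_int n\<bar>" by linarith
      then have "2 * pi * 1 \<le> 2 * pi * \<bar>real_of_int n\<bar>" by (intro mult_left_mono) auto
      also have "\<dots> = \<bar>Im ((f y - g y) - (f x - g x))\<bar>" unfolding n by (simp add: abs_mult)
      also have "\<dots> \<le> cmod ((f y - g y) - (f x - g x))" by (rule abs_Im_le_cmod)
      finally show ?thesis by simp
    qed
    then show "\<exists>e>0. \<forall>y. y \<in> UNIV \<and> f y - g y \<noteq> f x - g x \<longrightarrow>
        e \<le> cmod ((f y - g y) - (f x - g x))"
      by (intro exI[of _ "2 * pi"]) auto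
  qed auto
  then obtain c where "\<And>x. f x - g x = c" by (auto simp: constant_on_def)
  from this[of x] this[of 0] show ?thesis using 0 by simp
qed

definition lk_kernel :: "real \<Rightarrow> real \<Rightarrow> complex" where
  "lk_kernel u t = exp (\<i> * of_real (u * t)) - 1 - \<i> * of_real (u * t) * indicator {-1..1} t"

lemma lk_kernel_bound: "cmod (lk_kernel u t) \<le> (2 + u\<^sup>2) * min 1 (t\<^sup>2)"
proof (cases "t \<in> {-1..1}")
  case True
  have "cmod (lk_kernel u t) \<le> \<bar>u * t\<bar> ^ 2 / 2"
    using iexp_approx1[of "u * t" 1] True
    by (simp add: lk_kernel_def numeral_2_eq_2 algebra_simps)
  also have "\<dots> \<le> (2 + u\<^sup>2) * t\<^sup>2"
    by (simp add: power_mult_distrib algebra_simps)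
  also have "t\<^sup>2 = min 1 (t\<^sup>2)"
    using True abs_square_le_1[of t] by (auto simp: min_def)
  finally show ?thesis .
next
  case False
  have "cmod (lk_kernel u t) \<le> 2"
    using False norm_triangle_ineq4[of "exp (\<i> * of_real (u * t))" 1] by (simp add: lk_kernel_def)
  moreover have "min 1 (t\<^sup>2) = 1"
    using False abs_square_le_1[of t] by (auto simp: min_def)
  ultimately show ?thesis by (simp add: add_increasing2)
qed

lemma lk_kernel_measurable [measurable]:
  "lk_kernel u \<in> borel_measurable borel"
  unfolding lk_kernel_def by measurable

text \<open>
  A Levy measure can be infinite near 0. Moving the weight \<open>min 1 t\<^sup>2\<close> from the integrand into the
  measure makes it finite, so that dominated convergence and Fubini's theorem apply directly. At
  \<open>t = 0\<close> the quotients below have the value 0 by the convention for division by zero, which agrees with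
  the vanishing of the integrands there.
\<close>

definition levy_weighted :: "real measure \<Rightarrow> real measure" where
  "levy_weighted \<rho> = density \<rho> (\<lambda>t. ennreal (min 1 (t\<^sup>2)))"

lemma
  assumes "levy_measure \<rho>"
  shows sets_levy_weighted: "sets (levy_weighted \<rho>) = sets borel"
    and finite_levy_weighted: "finite_measure (levy_weighted \<rho>)"
    and integral_levy: "\<And>f. f \<in> borel_measurable borel \<Longrightarrow> f 0 = 0 \<Longrightarrow>
      (\<integral>t. f t \<partial>\<rho>) = (\<integral>t. f t / complex_of_real (min 1 (t\<^sup>2)) \<partial>levy_weighted \<rho>)"
proof -
  have sets [measurable_cong]: "sets \<rho> = sets borel" and fin: "(\<integral>\<^sup>+ t. ennreal (min 1 (t\<^sup>2)) \<partial>\<rho>) < \<infinity>"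
    using assms by (auto simp: levy_measure_def)
  show "sets (levy_weighted \<rho>) = sets borel" by (simp add: levy_weighted_def sets)
  have "emeasure (levy_weighted \<rho>) (space (levy_weighted \<rho>)) = (\<integral>\<^sup>+ t. ennreal (min 1 (t\<^sup>2)) \<partial>\<rho>)"
    unfolding levy_weighted_def
    by (subst emeasure_density) (auto intro!: nn_integral_cong simp: indicator_def)
  then show "finite_measure (levy_weighted \<rho>)" using fin by (intro finite_measureI) auto
  fix f :: "real \<Rightarrow> complex" assume [measurable]: "f \<in> borel_measurable borel" and f0: "f 0 = 0"
  have "(\<integral>t. f t / complex_of_real (min 1 (t\<^sup>2)) \<partial>levy_weighted \<rho>)
      = (\<integral>t. min 1 (t\<^sup>2) *\<^sub>R (f t / complex_of_real (min 1 (t\<^sup>2))) \<partial>\<rho>)"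
    unfolding levy_weighted_def by (rule integral_density) auto
  also have "\<dots> = (\<integral>t. f t \<partial>\<rho>)"
  proof (rule Bochner_Integration.integral_cong)
    fix t show "min 1 (t\<^sup>2) *\<^sub>R (f t / complex_of_real (min 1 (t\<^sup>2))) = f t"
      using f0 by (cases "t = 0") (auto simp: scaleR_conv_of_real min_def)
  qed simp
  finally show "(\<integral>t. f t \<partial>\<rho>) = (\<integral>t. f t / complex_of_real (min 1 (t\<^sup>2)) \<partial>levy_weighted \<rho>)" ..
qed

definition lk_exponent :: "real \<Rightarrow> real measure \<Rightarrow> real \<Rightarrow> real \<Rightarrow> complex" where
  "lk_exponent a \<rho> \<eta> u = \<i> * of_real (\<eta> * u) - of_real (a * u\<^sup>2 / 2) + (\<integral>t. lk_kernel u t \<partial>\<rho>)"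

lemma lk_kernel_div_bound: "cmod (lk_kernel u t / of_real (min 1 (t\<^sup>2))) \<le> 2 + u\<^sup>2"
proof (cases "t = 0")
  case False
  then have "min 1 (t\<^sup>2) > 0" by simp
  then show ?thesis
    using lk_kernel_bound[of u t] by (simp add: norm_divide divide_le_eq)
qed simp

lemma lk_kernel_0: "lk_kernel u 0 = 0" "lk_kernel 0 t = 0"
  by (auto simp: lk_kernel_def)

lemma continuous_lk_exponent:
  assumes "levy_measure \<rho>"
  shows "continuous_on UNIV (lk_exponent a \<rho> \<eta>)"
proof -
  interpret finite_measure "levy_weighted \<rho>" by (rule finite_levy_weighted[OF assms])
  have "isCont (\<lambda>u. \<integral>t. lk_kernel u t / of_real (min 1 (t\<^sup>2)) \<partial>levy_weighted \<rho>) u" for u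
  proof (rule isCont_integral_dominated[where U = "ball u 1" and g = "\<lambda>_. 2 + (\<bar>u\<bar> + 1)\<^sup>2"])
    show "(\<lambda>t. lk_kernel w t / of_real (min 1 (t\<^sup>2))) \<in> borel_measurable (levy_weighted \<rho>)" for w
      by (subst measurable_cong_sets[OF sets_levy_weighted[OF assms] refl]) measurable
    show "AE t in levy_weighted \<rho>. cmod (lk_kernel w t / of_real (min 1 (t\<^sup>2))) \<le> 2 + (\<bar>u\<bar> + 1)\<^sup>2"
      if "w \<in> ball u 1" for w
    proof (rule AE_I2)
      fix t
      have "\<bar>w\<bar> \<le> \<bar>u\<bar> + 1" using that by (auto simp: dist_real_def)
      then have "w\<^sup>2 \<le> (\<bar>u\<bar> + 1)\<^sup>2" by (metis abs_ge_zero power2_abs power_mono)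
      then show "cmod (lk_kernel w t / of_real (min 1 (t\<^sup>2))) \<le> 2 + (\<bar>u\<bar> + 1)\<^sup>2"
        using lk_kernel_div_bound[of w t] by linarith
    qed
    show "AE t in levy_weighted \<rho>. isCont (\<lambda>w. lk_kernel w t / of_real (min 1 (t\<^sup>2))) u"
    proof (rule AE_I2)
      fix t
      show "isCont (\<lambda>w. lk_kernel w t / of_real (min 1 (t\<^sup>2))) u"
      proof (cases "t = 0")
        case False
        then show ?thesis unfolding lk_kernel_def by (intro continuous_intros) (auto simp: min_def)
      qed (simp add: lk_kernel_0)
    qed
  qed auto
  then have "isCont (\<lambda>u. \<integral>t. lk_kernel u t \<partial>\<rho>) u" for u
    by (subst integral_levy[OF assms]) (auto simp: lk_kernel_0)
  then show ?thesis
    unfolding lk_exponent_def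
    by (intro continuous_intros) (auto intro: continuous_at_imp_continuous_on)
qed

text \<open>
  For \<open>x\<close> exponentially distributed, \<open>e\<^sup>i\<^sup>\<zeta>\<^sup>x\<^sup>t\<close> has mean \<open>1 / (1 - \<i> \<zeta> t)\<close>, \<open>x\<close> has mean 1 and
  \<open>x\<^sup>2 / 2\<close> has mean 1. So averaging turns each term of the classical exponent into the corresponding
  term of the free formula; the Levy integral is handled by Fubini's theorem.
\<close>

lemma free_levy_khintchine_imaginary:
  assumes "levy_measure \<rho>"
  shows "free_levy_khintchine a \<rho> \<eta> (\<i> * of_real \<zeta>) = (\<integral>x. lk_exponent a \<rho> \<eta> (\<zeta> * x) \<partial>exp1)"
proof -
  let ?m = "\<lambda>t. complex_of_real (min 1 (t\<^sup>2))"
  interpret K: finite_measure "levy_weighted \<rho>" by (rule finite_levy_weighted[OF assms])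
  interpret P: pair_sigma_finite exp1 "levy_weighted \<rho>" ..
  note [measurable_cong] = sets_levy_weighted[OF assms]
  have m1: "integrable exp1 (\<lambda>x. x)" "(\<integral>x. x \<partial>exp1) = 1"
    using exp1_moment[of 1] by (auto simp: has_bochner_integral_iff)
  have m2: "integrable exp1 (\<lambda>x. x\<^sup>2)" "(\<integral>x. x\<^sup>2 \<partial>exp1) = 2"
    using exp1_moment[of 2] by (auto simp: has_bochner_integral_iff)
  define J where "J t = 1 / (1 - of_real t * (\<i> * of_real \<zeta>)) - 1 - of_real t * (\<i> * of_real \<zeta>) * indicator {-1..1} t"
    for t :: real
  have inner: "(\<integral>x. lk_kernel (\<zeta> * x) t \<partial>exp1) = J t" for t
  proof -
    have ie: "integrable exp1 (\<lambda>x. exp (\<i> * of_real (\<zeta> * t * x)))"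
      by (rule exp1.integrable_const_bound[where B = 1]) auto
    have ix: "integrable exp1 (\<lambda>x. \<i> * of_real (\<zeta> * t) * indicator {-1..1} t * complex_of_real x)"
      using m1(1) by (intro integrable_mult_right) auto
    have "(\<integral>x. lk_kernel (\<zeta> * x) t \<partial>exp1)
      = (\<integral>x. exp (\<i> * of_real (\<zeta> * t * x)) - 1 - \<i> * of_real (\<zeta> * t) * indicator {-1..1} t * complex_of_real x \<partial>exp1)"
      by (intro Bochner_Integration.integral_cong) (auto simp: lk_kernel_def mult_ac)
    also have "\<dots> = (\<integral>x. exp (\<i> * of_real (\<zeta> * t * x)) \<partial>exp1) - (\<integral>x. 1 \<partial>exp1)
        - (\<integral>x. \<i> * of_real (\<zeta> * t) * indicator {-1..1} t * complex_of_real x \<partial>exp1)"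
      using ie ix by simp
    also have "(\<integral>x. 1 \<partial>exp1) = (1::complex)" using exp1.prob_space by simp
    also have "(\<integral>x. \<i> * of_real (\<zeta> * t) * indicator {-1..1} t * complex_of_real x \<partial>exp1)
        = \<i> * of_real (\<zeta> * t) * indicator {-1..1} t"
      by (simp only: integral_mult_right_zero integral_complex_of_real m1) simp
    finally show ?thesis
      unfolding exp1_char J_def by (simp add: mult_ac)
  qed
  have bound: "cmod (lk_kernel (\<zeta> * x) t / ?m t) \<le> 2 + \<zeta>\<^sup>2 * x\<^sup>2" for x t
    using lk_kernel_div_bound[of "\<zeta> * x" t] by (simp add: power_mult_distrib)
  have intK: "integrable (levy_weighted \<rho>) (\<lambda>t. lk_kernel u t / ?m t)" for u
    by (rule K.integrable_const_bound[where B = "2 + u\<^sup>2"]) (use lk_kernel_div_bound in auto)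
  have intP: "integrable (exp1 \<Otimes>\<^sub>M levy_weighted \<rho>) (\<lambda>(x, t). lk_kernel (\<zeta> * x) t / ?m t)"
  proof (rule P.Fubini_integrable)
    show [measurable]: "(\<lambda>(x, t). lk_kernel (\<zeta> * x) t / ?m t) \<in> borel_measurable (exp1 \<Otimes>\<^sub>M levy_weighted \<rho>)"
      unfolding lk_kernel_def by measurable
    show "integrable exp1 (\<lambda>x. \<integral>t. norm (case (x, t) of (x, t) \<Rightarrow> lk_kernel (\<zeta> * x) t / ?m t) \<partial>levy_weighted \<rho>)"
    proof (rule Bochner_Integration.integrable_bound)
      show "integrable exp1 (\<lambda>x. (2 + \<zeta>\<^sup>2 * x\<^sup>2) * measure (levy_weighted \<rho>) (space (levy_weighted \<rho>)))"
        using m2(1) by simp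
      show "AE x in exp1. norm (\<integral>t. norm (case (x, t) of (x, t) \<Rightarrow> lk_kernel (\<zeta> * x) t / ?m t) \<partial>levy_weighted \<rho>)
          \<le> norm ((2 + \<zeta>\<^sup>2 * x\<^sup>2) * measure (levy_weighted \<rho>) (space (levy_weighted \<rho>)))"
      proof (rule AE_I2)
        fix x
        have "(\<integral>t. norm (lk_kernel (\<zeta> * x) t / ?m t) \<partial>levy_weighted \<rho>) \<le> (\<integral>t. 2 + \<zeta>\<^sup>2 * x\<^sup>2 \<partial>levy_weighted \<rho>)"
          using intK bound by (intro integral_mono) auto
        also have "\<dots> = (2 + \<zeta>\<^sup>2 * x\<^sup>2) * measure (levy_weighted \<rho>) (space (levy_weighted \<rho>))" by simp
        finally show "norm (\<integral>t. norm (case (x, t) of (x, t) \<Rightarrow> lk_kernel (\<zeta> * x) t / ?m t) \<partial>levy_weighted \<rho>)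
          \<le> norm ((2 + \<zeta>\<^sup>2 * x\<^sup>2) * measure (levy_weighted \<rho>) (space (levy_weighted \<rho>)))"
          by (simp add: abs_mult integral_nonneg_AE)
      qed
    qed measurable
    show "AE x in exp1. integrable (levy_weighted \<rho>) (\<lambda>t. case (x, t) of (x, t) \<Rightarrow> lk_kernel (\<zeta> * x) t / ?m t)"
      using intK by simp
  qed
  have Jm: "J \<in> borel_measurable borel" unfolding J_def by measurable
  have "(\<integral>t. J t \<partial>\<rho>) = (\<integral>t. J t / ?m t \<partial>levy_weighted \<rho>)"
    by (rule integral_levy[OF assms Jm]) (simp add: J_def)
  also have "\<dots> = (\<integral>t. (\<integral>x. lk_kernel (\<zeta> * x) t / ?m t \<partial>exp1) \<partial>levy_weighted \<rho>)"
    by (simp add: inner)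
  also have "\<dots> = (\<integral>x. (\<integral>t. lk_kernel (\<zeta> * x) t / ?m t \<partial>levy_weighted \<rho>) \<partial>exp1)"
    using P.Fubini_integral[OF intP] by simp
  also have "\<dots> = (\<integral>x. (\<integral>t. lk_kernel (\<zeta> * x) t \<partial>\<rho>) \<partial>exp1)"
    by (subst integral_levy[OF assms]) (auto simp: lk_kernel_0)
  finally have JK: "(\<integral>t. J t \<partial>\<rho>) = (\<integral>x. (\<integral>t. lk_kernel (\<zeta> * x) t \<partial>\<rho>) \<partial>exp1)" .
  have intX: "integrable exp1 (\<lambda>x. (\<integral>t. lk_kernel (\<zeta> * x) t \<partial>\<rho>))"
    using P.integrable_fst'[OF intP] by (subst integral_levy[OF assms]) (auto simp: lk_kernel_0)
  have i1: "integrable exp1 (\<lambda>x. \<i> * complex_of_real (\<eta> * (\<zeta> * x)))"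
    "(\<integral>x. \<i> * complex_of_real (\<eta> * (\<zeta> * x)) \<partial>exp1) = \<i> * of_real (\<eta> * \<zeta>)"
    using m1 by (auto simp only: integral_mult_right_zero integral_complex_of_real) auto
  have i2: "integrable exp1 (\<lambda>x. complex_of_real (a * (\<zeta> * x)\<^sup>2 / 2))"
    "(\<integral>x. complex_of_real (a * (\<zeta> * x)\<^sup>2 / 2) \<partial>exp1) = of_real (a * \<zeta>\<^sup>2)"
  proof -
    have eq: "a * (\<zeta> * x)\<^sup>2 / 2 = (a * \<zeta>\<^sup>2 / 2) * x\<^sup>2" for x by (simp add: power_mult_distrib)
    show "integrable exp1 (\<lambda>x. complex_of_real (a * (\<zeta> * x)\<^sup>2 / 2))"
      unfolding eq using m2(1) by (intro integrable_of_real integrable_mult_right) auto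
    show "(\<integral>x. complex_of_real (a * (\<zeta> * x)\<^sup>2 / 2) \<partial>exp1) = of_real (a * \<zeta>\<^sup>2)"
      unfolding eq integral_complex_of_real integral_mult_right_zero m2 by simp
  qed
  have "(\<integral>x. lk_exponent a \<rho> \<eta> (\<zeta> * x) \<partial>exp1)
      = \<i> * of_real (\<eta> * \<zeta>) - of_real (a * \<zeta>\<^sup>2) + (\<integral>t. J t \<partial>\<rho>)"
    unfolding lk_exponent_def JK i1(2)[symmetric] i2(2)[symmetric]
    using i1(1) i2(1) intX by simp
  then show ?thesis
    by (simp add: free_levy_khintchine_def J_def[abs_def] power_mult_distrib)
qed

lemma lk_exponent_gamma_law:
  assumes \<alpha>: "\<alpha> > 0" and prob: "prob_space (gamma_law \<alpha>)"
    and lk: "levy_khintchine_triplet (gamma_law \<alpha>) a \<rho> \<eta>"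
  shows "lk_exponent a \<rho> \<eta> u = - of_real \<alpha> * Ln (1 - \<i> * of_real u)"
proof (rule continuous_log_unique)
  have \<rho>: "levy_measure \<rho>" using lk by (simp add: levy_khintchine_triplet_def)
  show "continuous_on UNIV (lk_exponent a \<rho> \<eta>)" by (rule continuous_lk_exponent[OF \<rho>])
  show "continuous_on UNIV (\<lambda>u. - of_real \<alpha> * Ln (1 - \<i> * of_real u))"
    by (intro continuous_intros) (auto simp: complex_nonpos_Reals_iff)
  show "lk_exponent a \<rho> \<eta> 0 = - of_real \<alpha> * Ln (1 - \<i> * of_real 0)"
    by (simp add: lk_exponent_def lk_kernel_0)
  show "exp (lk_exponent a \<rho> \<eta> u) = exp (- of_real \<alpha> * Ln (1 - \<i> * of_real u))" for u
    using lk unfolding levy_khintchine_triplet_def char_gamma_law[OF \<alpha> prob, symmetric]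
    by (simp add: lk_exponent_def lk_kernel_def)
qed

lemma norm_Ln_1_minus_imag:
  "cmod (Ln (1 - \<i> * of_real u)) \<le> u\<^sup>2 + pi"
proof -
  define w where "w = 1 - \<i> * of_real u"
  have w0: "w \<noteq> 0" by (simp add: w_def complex_eq_iff)
  have cm: "cmod w = sqrt (1 + u\<^sup>2)" by (simp add: w_def cmod_def)
  have "Re (Ln w) = ln (1 + u\<^sup>2) / 2" using w0 by (simp add: cm ln_sqrt)
  moreover have "0 \<le> ln (1 + u\<^sup>2)" "ln (1 + u\<^sup>2) \<le> u\<^sup>2" by (auto intro: ln_add_one_self_le_self)
  ultimately have "\<bar>Re (Ln w)\<bar> \<le> u\<^sup>2" by linarith
  moreover have "\<bar>Im (Ln w)\<bar> \<le> pi" using Im_Ln_le_pi[OF w0] mpi_less_Im_Ln[OF w0] by simp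
  ultimately show ?thesis
    using cmod_le[of "Ln w"] unfolding w_def[symmetric] by linarith
qed

lemma integrable_exp1_iff:
  fixes f :: "real \<Rightarrow> complex"
  assumes [measurable]: "f \<in> borel_measurable borel"
  shows "integrable exp1 f \<longleftrightarrow> set_integrable lborel {0..} (\<lambda>t. exp (- t) *\<^sub>R f t)"
  unfolding exp1_def set_integrable_def
  by (subst integrable_density)
     (auto simp: erlang_density_def indicator_def intro!: Bochner_Integration.integrable_cong)

text \<open>
  Integration by parts: \<open>F x = - e\<^sup>-\<^sup>x Ln (1 - z x)\<close> vanishes at 0 and at infinity, and its derivative is
  \<open>e\<^sup>-\<^sup>x (Ln (1 - z x) + z / (1 - z x))\<close>.
\<close>

lemma exp1_integral_Ln:
  fixes \<zeta> :: real
  defines "z \<equiv> \<i> * of_real \<zeta>"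
  shows "(\<integral>x. Ln (1 - \<i> * of_real (\<zeta> * x)) \<partial>exp1) = - (\<integral>x. z / (1 - z * of_real x) \<partial>exp1)"
proof -
  have zx: "\<i> * of_real (\<zeta> * x) = z * of_real x" for x by (simp add: z_def)
  have Re1: "Re (1 - z * of_real x) = 1" for x :: real by (simp add: z_def)
  have nz: "1 - z * of_real x \<noteq> 0" for x :: real
    using Re1[of x] by (metis zero_complex.sel(1) zero_neq_one)
  have nonpos: "1 - z * of_real x \<notin> \<real>\<^sub>\<le>\<^sub>0" for x :: real
    using Re1[of x] by (auto simp: complex_nonpos_Reals_iff)
  define f1 f2 where "f1 x = Ln (1 - z * of_real x)" and "f2 x = z / (1 - z * of_real x)" for x :: real
  have cont: "isCont f1 x" "isCont f2 x" for x
    unfolding f1_def f2_def using nz nonpos by (auto intro!: continuous_intros)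
  have meas [measurable]: "f1 \<in> borel_measurable borel" "f2 \<in> borel_measurable borel"
    using cont by (auto intro!: borel_measurable_continuous_onI continuous_at_imp_continuous_on)
  have int1: "integrable exp1 f1"
  proof (rule Bochner_Integration.integrable_bound)
    show "integrable exp1 (\<lambda>x. \<zeta>\<^sup>2 * x\<^sup>2 + pi)"
      using exp1_moment[of 2] by (simp add: has_bochner_integral_iff)
    show "AE x in exp1. cmod (f1 x) \<le> norm (\<zeta>\<^sup>2 * x\<^sup>2 + pi)"
      using norm_Ln_1_minus_imag[of "\<zeta> * x" for x] unfolding f1_def zx
      by (intro AE_I2) (simp add: power_mult_distrib)
  qed simp
  have int2: "integrable exp1 f2"
  proof (rule exp1.integrable_const_bound[where B = "cmod z"])
    show "AE x in exp1. cmod (f2 x) \<le> cmod z"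
    proof (rule AE_I2)
      fix x
      have "1 \<le> cmod (1 - z * of_real x)" using complex_Re_le_cmod[of "1 - z * of_real x"] unfolding Re1 .
      then show "cmod (f2 x) \<le> cmod z"
        by (simp add: f2_def norm_divide divide_le_eq mult_le_cancel_left1)
    qed
  qed simp
  define F where "F x = - (exp (- x) *\<^sub>R f1 x)" for x
  have f1_le: "cmod (f1 x) \<le> \<zeta>\<^sup>2 * x\<^sup>2 + pi" for x
    using norm_Ln_1_minus_imag[of "\<zeta> * x"] unfolding f1_def zx by (simp add: power_mult_distrib)
  have "(LBINT x=0..\<infinity>. exp (- x) *\<^sub>R (f1 x + f2 x)) = 0 - 0"
  proof (rule interval_integral_FTC_integrable)
    show "(F has_vector_derivative exp (- x) *\<^sub>R (f1 x + f2 x)) (at x)" for x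
    proof -
      have "((\<lambda>w. Ln (1 - z * w)) has_field_derivative - z / (1 - z * of_real x)) (at (of_real x))"
        using nonpos[of x] by (auto intro!: derivative_eq_intros simp: divide_inverse mult.commute)
      then have 1: "(f1 has_vector_derivative - f2 x) (at x)"
        using has_vector_derivative_real_field[of "\<lambda>w. Ln (1 - z * w)" _ x UNIV]
        by (simp add: f1_def[abs_def] f2_def)
      have "((\<lambda>x. exp (- x)) has_real_derivative - exp (- x)) (at x)"
        by (auto intro!: derivative_eq_intros)
      from has_vector_derivative_minus[OF has_vector_derivative_scaleR[OF this 1]]
      show ?thesis unfolding F_def[abs_def] by (simp add: scaleR_add_right)
    qed
    show "isCont (\<lambda>x. exp (- x) *\<^sub>R (f1 x + f2 x)) x" for x
      using cont by (intro continuous_intros) auto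
    have "set_integrable lborel {0..} (\<lambda>x. exp (- x) *\<^sub>R (f1 x + f2 x))"
      by (subst integrable_exp1_iff[symmetric]) (use int1 int2 in auto)
    then show "set_integrable lborel (einterval 0 \<infinity>) (\<lambda>x. exp (- x) *\<^sub>R (f1 x + f2 x))"
      by (rule set_integrable_subset) (auto simp: einterval_def)
    have "F 0 = 0" by (simp add: F_def f1_def)
    moreover have "isCont F 0"
      unfolding F_def using cont by (intro continuous_intros) auto
    ultimately have "(F \<longlongrightarrow> 0) (at_right 0)"
      by (metis continuous_within filterlim_at_split)
    then show "((F \<circ> real_of_ereal) \<longlongrightarrow> 0) (at_right 0)"
      using ereal_tendsto_simps(2)[of F _ 0] by (simp add: zero_ereal_def)
    have "(F \<longlongrightarrow> 0) at_top"
    proof (rule Lim_null_comparison)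
      show "\<forall>\<^sub>F x in at_top. norm (F x) \<le> exp (- x) * (\<zeta>\<^sup>2 * x\<^sup>2 + pi)"
        using f1_le by (intro always_eventually) (auto simp: F_def intro!: mult_left_mono)
      show "((\<lambda>x. exp (- x) * (\<zeta>\<^sup>2 * x\<^sup>2 + pi)) \<longlongrightarrow> 0) at_top"
      proof -
        have "((\<lambda>x. \<zeta>\<^sup>2 * (x\<^sup>2 * exp (- x)) + pi * exp (- x)) \<longlongrightarrow> \<zeta>\<^sup>2 * 0 + pi * 0) at_top"
          by (intro tendsto_intros; real_asymp)
        then show ?thesis by (simp add: algebra_simps)
      qed
    qed
    then show "((F \<circ> real_of_ereal) \<longlongrightarrow> 0) (at_left \<infinity>)"
      by (simp add: ereal_tendsto_simps)
  qed simp
  moreover have "(LBINT x=0..\<infinity>. exp (- x) *\<^sub>R (f1 x + f2 x)) = (LBINT x:{0..}. exp (- x) *\<^sub>R (f1 x + f2 x))"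
  proof -
    have "(LBINT x=0..\<infinity>. exp (- x) *\<^sub>R (f1 x + f2 x)) = (LBINT x:{0<..}. exp (- x) *\<^sub>R (f1 x + f2 x))"
      by (simp add: interval_lebesgue_integral_def einterval_def greaterThan_def zero_ereal_def)
    also have "\<dots> = (LBINT x:{0..}. exp (- x) *\<^sub>R (f1 x + f2 x))"
    proof (rule set_integral_cong_set)
      have "AE x in lborel. (x::real) \<noteq> 0" by (rule AE_lborel_singleton)
      then show "AE x in lborel. (x \<in> {0..}) = ((x::real) \<in> {0<..})"
        by eventually_elim auto
    qed (auto simp: set_borel_measurable_def)
    finally show ?thesis .
  qed
  moreover have "(LBINT x:{0..}. exp (- x) *\<^sub>R (f1 x + f2 x)) = (\<integral>x. f1 x + f2 x \<partial>exp1)"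
    by (rule integral_exp1[symmetric]) measurable
  ultimately have "(\<integral>x. f1 x \<partial>exp1) + (\<integral>x. f2 x \<partial>exp1) = 0"
    using int1 int2 by simp
  then show ?thesis
    unfolding zx f1_def[symmetric] f2_def[symmetric] by (simp add: add_eq_0_iff2)
qed

text \<open>
  If \<open>C\<close> is the free cumulant transform of a law, then \<open>w (1 + C (1 / w))\<close> is the value at \<open>1 / w\<close> of the
  inverse of its Cauchy transform.
\<close>

lemma free_gamma_inverse_on_imaginary_axis:
  assumes \<alpha>: "\<alpha> > 0" and prob: "prob_space (gamma_law \<alpha>)"
    and lk: "levy_khintchine_triplet (gamma_law \<alpha>) a \<rho> \<eta>" and y: "y > 0"
  defines "w \<equiv> \<i> * of_real y"
  shows "w * (1 + free_levy_khintchine a \<rho> \<eta> (inverse w)) = fg_H \<alpha> w"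
proof -
  define \<zeta> where "\<zeta> = - inverse y"
  have w0: "w \<noteq> 0" using y by (simp add: w_def)
  have inv: "inverse w = \<i> * of_real \<zeta>" by (simp add: w_def \<zeta>_def)
  have wx: "w - of_real x \<noteq> 0" for x using y by (simp add: w_def complex_eq_iff)
  have \<rho>: "levy_measure \<rho>" using lk by (simp add: levy_khintchine_triplet_def)
  have "free_levy_khintchine a \<rho> \<eta> (inverse w)
      = (\<integral>x. - of_real \<alpha> * Ln (1 - \<i> * of_real (\<zeta> * x)) \<partial>exp1)"
    unfolding inv free_levy_khintchine_imaginary[OF \<rho>] lk_exponent_gamma_law[OF \<alpha> prob lk] ..
  also have "\<dots> = of_real \<alpha> * (\<integral>x. inverse w / (1 - inverse w * of_real x) \<partial>exp1)"
    unfolding integral_mult_right_zero exp1_integral_Ln inv by simp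
  also have "(\<lambda>x. inverse w / (1 - inverse w * of_real x)) = (\<lambda>x. 1 / (w - of_real x))"
    using w0 wx by (auto simp: fun_eq_iff field_simps)
  finally have C: "w * free_levy_khintchine a \<rho> \<eta> (inverse w)
      = of_real \<alpha> * (w * (\<integral>x. 1 / (w - of_real x) \<partial>exp1))" by simp
  have le: "cmod (1 / (w - of_real x)) \<le> 1 / y" for x
    using kernel_bounds(1)[of y w x] abs_Im_le_cmod[of "w - of_real x"] y by (simp add: w_def)
  have int: "integrable exp1 (\<lambda>x. 1 / (w - of_real x))"
    by (rule exp1.integrable_const_bound[where B = "1 / y"]) (use le in auto)
  \<comment> \<open>Splitting off 1 produces the factor \<open>t\<close> that turns the exponential law into \<open>t e\<^sup>-\<^sup>t\<close>.\<close>
  have eq: "w * (1 / (w - of_real x)) = 1 + of_real x / (w - of_real x)" for x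
    using wx[of x] by (simp add: field_simps)
  have int': "integrable exp1 (\<lambda>x. of_real x / (w - of_real x))"
  proof -
    have "integrable exp1 (\<lambda>x. w * (1 / (w - of_real x)) - 1)"
      by (intro Bochner_Integration.integrable_diff integrable_mult_right int) simp
    then show ?thesis unfolding eq by simp
  qed
  have "w * (\<integral>x. 1 / (w - of_real x) \<partial>exp1) = (\<integral>x. 1 + of_real x / (w - of_real x) \<partial>exp1)"
    unfolding integral_mult_right_zero[symmetric] eq ..
  also have "\<dots> = 1 + (\<integral>x. of_real x / (w - of_real x) \<partial>exp1)"
    using int' exp1.prob_space by simp
  also have "(\<integral>x. of_real x / (w - of_real x) \<partial>exp1)
      = (LBINT t:{0..}. of_real (t * exp (- t)) / (w - of_real t))"
    by (subst integral_exp1) (auto simp: scaleR_conv_of_real mult.commute)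
  finally show ?thesis
    unfolding distrib_left C by (simp add: fg_H_def distrib_left)
qed

section \<open>Stieltjes inversion for bounded Cauchy transforms\<close>

lemma cauchy_transform_upper_half_plane:
  assumes "real_distribution \<nu>"
  shows cauchy_transform_holomorphic_upper: "cauchy_transform \<nu> holomorphic_on {z. Im z > 0}"
    and Im_cauchy_transform: "\<And>z. Im z > 0 \<Longrightarrow>
      Im (cauchy_transform \<nu> z) = - (\<integral>t. Im z / (cmod (z - of_real t))\<^sup>2 \<partial>\<nu>)"
    and Im_cauchy_transform_neg: "\<And>z. Im z > 0 \<Longrightarrow> Im (cauchy_transform \<nu> z) < 0"
proof -
  interpret real_distribution \<nu> by fact
  show "cauchy_transform \<nu> holomorphic_on {z. Im z > 0}"
  proof (rule cauchy_transform_holomorphic[where A = UNIV])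
    fix z :: complex assume "z \<in> {z. Im z > 0}"
    then have z: "Im z > 0" by simp
    have "Im z / 2 \<le> cmod (w - of_real t)" if "w \<in> ball z (Im z / 2)" for w t
    proof -
      have "\<bar>Im (z - w)\<bar> < Im z / 2"
        using that abs_Im_le_cmod[of "z - w"] by (simp add: dist_norm)
      then have "\<bar>Im z - Im w\<bar> < Im z / 2" by simp
      then have "Im z / 2 \<le> Im w" by linarith
      then show ?thesis using abs_Im_le_cmod[of "w - of_real t"] by simp
    qed
    then show "\<exists>d>0. \<forall>w\<in>ball z d. \<forall>t\<in>UNIV. d \<le> cmod (w - of_real t)"
      using z by (intro exI[of _ "Im z / 2"]) auto
  qed (auto intro: finite_measure_axioms open_halfspace_Im_gt)
  fix z :: complex assume z: "Im z > 0"
  have le: "Im z \<le> cmod (z - of_real t)" for t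
    using abs_Im_le_cmod[of "z - of_real t"] by simp
  have int: "integrable \<nu> (\<lambda>t. 1 / (z - of_real t))"
    by (rule integrable_const_bound[where B = "1 / Im z"]) (use kernel_bounds(1)[OF z le] in auto)
  have im: "Im (1 / (z - of_real t)) = - (Im z / (cmod (z - of_real t))\<^sup>2)" for t
    by (simp add: Im_divide cmod_power2)
  show eq: "Im (cauchy_transform \<nu> z) = - (\<integral>t. Im z / (cmod (z - of_real t))\<^sup>2 \<partial>\<nu>)"
    unfolding cauchy_transform_def integral_Im[OF int, symmetric] im by simp
  have "(\<integral>t. 0 \<partial>\<nu>) < (\<integral>t. Im z / (cmod (z - of_real t))\<^sup>2 \<partial>\<nu>)"
  proof (rule integral_less_AE_space)
    have "integrable \<nu> (\<lambda>t. - Im (1 / (z - of_real t)))" using int by simp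
    then show "integrable \<nu> (\<lambda>t. Im z / (cmod (z - of_real t))\<^sup>2)" unfolding im by simp
    show "AE t in \<nu>. 0 < Im z / (cmod (z - of_real t))\<^sup>2"
    proof (rule AE_I2)
      fix t
      have "cmod (z - of_real t) > 0" using le[of t] z by linarith
      then show "0 < Im z / (cmod (z - of_real t))\<^sup>2" using z by simp
    qed
  qed (use emeasure_space_1 in auto)
  then show "Im (cauchy_transform \<nu> z) < 0" unfolding eq by simp
qed

lemma arctan_scaled_tendsto:
  "(\<lambda>n. arctan (c * real (Suc n))) \<longlonglongrightarrow> sgn c * (pi / 2)"
proof -
  have pos: "(\<lambda>n. arctan (c * real (Suc n))) \<longlonglongrightarrow> pi / 2" if "c > 0" for c
  proof (rule filterlim_compose[OF tendsto_arctan_at_top])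
    show "filterlim (\<lambda>n. c * real (Suc n)) at_top sequentially"
      by (rule filterlim_tendsto_pos_mult_at_top[OF tendsto_const that])
         (rule filterlim_compose[OF filterlim_real_sequentially filterlim_Suc])
  qed
  consider "c > 0" | "c = 0" | "c < 0" by linarith
  then show ?thesis
  proof cases
    case 3
    then show ?thesis using tendsto_minus[OF pos[of "- c"]] by (simp add: arctan_minus)
  qed (use pos in auto)
qed

lemma measure_eqI_Ioc:
  fixes M N :: "real measure"
  assumes sets: "sets M = sets borel" "sets N = sets borel"
    and fin: "\<And>a b. emeasure M {a<..b} \<noteq> \<infinity>"
    and eq: "\<And>a b. a < b \<Longrightarrow> emeasure M {a<..b} = emeasure N {a<..b}"
  shows "M = N"
proof (rule measure_eqI_generator_eq[where A = "\<lambda>n. {- real n<..real n}"])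
  let ?E = "range (\<lambda>(a, b). {a<..b :: real})"
  show "Int_stable ?E"
  proof (rule Int_stableI)
    fix X Y assume "X \<in> ?E" "Y \<in> ?E"
    then obtain a b c d where "X = {a<..b}" "Y = {c<..d}" by auto
    then have "X \<inter> Y = (case (max a c, min b d) of (a, b) \<Rightarrow> {a<..b})" by auto
    then show "X \<inter> Y \<in> ?E" by blast
  qed
  show "sets M = sigma_sets UNIV ?E" "sets N = sigma_sets UNIV ?E"
    unfolding sets borel_sigma_sets_Ioc by auto
  show "(\<Union>n. {- real n<..real n}) = UNIV"
  proof safe
    fix x :: real
    obtain n where "real n > \<bar>x\<bar>" using reals_Archimedean2 by blast
    then show "x \<in> (\<Union>n. {- real n<..real n})" by (auto intro!: exI[of _ n])
  qed simp
  show "range (\<lambda>n. {- real n<..real n}) \<subseteq> ?E" by auto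
  show "emeasure M X = emeasure N X" if XE: "X \<in> ?E" for X
  proof -
    obtain a b where X: "X = {a<..b}" using XE by auto
    show ?thesis unfolding X by (cases "a < b") (auto intro: eq)
  qed
qed (use fin in auto)

text \<open>
  At height \<open>\<epsilon>\<close>, \<open>- Im G / \<pi>\<close> is the Poisson integral \<open>p\<close> of \<open>\<nu>\<close>. Its integral over \<open>[a,b]\<close> is computed by
  Fubini's theorem and tends to the \<open>\<nu>\<close>-integral of \<open>h a b\<close>, which is 1 inside the interval,
  \<open>1 / 2\<close> at its ends and 0 outside. Since \<open>p\<close> is bounded by \<open>C / \<pi>\<close>, it also tends to the integral of
  \<open>f\<close>. The same bound excludes atoms, so the values of \<open>h\<close> at the ends do not matter.
\<close>

lemma stieltjes_inversion:
  assumes "real_distribution \<nu>"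
    and bound: "\<And>z. Im z > 0 \<Longrightarrow> cmod (cauchy_transform \<nu> z) \<le> C"
    and lim: "\<And>\<xi>. (\<lambda>n. - Im (cauchy_transform \<nu> (Complex \<xi> (1 / real (Suc n)))) / pi) \<longlonglongrightarrow> f \<xi>"
  shows "\<nu> = density lborel (\<lambda>\<xi>. ennreal (f \<xi>))"
proof -
  interpret real_distribution \<nu> by fact
  define \<epsilon> where "\<epsilon> n = 1 / real (Suc n)" for n
  have \<epsilon>: "\<epsilon> n > 0" for n by (simp add: \<epsilon>_def)
  define p where "p n \<xi> = - Im (cauchy_transform \<nu> (Complex \<xi> (\<epsilon> n))) / pi" for n \<xi>
  have p_lim: "(\<lambda>n. p n \<xi>) \<longlonglongrightarrow> f \<xi>" for \<xi> using lim by (simp add: p_def \<epsilon>_def)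
  have p_eq: "p n \<xi> = (\<integral>t. \<epsilon> n / ((\<xi> - t)\<^sup>2 + (\<epsilon> n)\<^sup>2) \<partial>\<nu>) / pi" for n \<xi>
    using Im_cauchy_transform[OF assms(1), of "Complex \<xi> (\<epsilon> n)"] \<epsilon>[of n]
    by (simp add: p_def cmod_power2)
  have p_nonneg: "0 \<le> p n \<xi>" for n \<xi>
    unfolding p_eq using \<epsilon>[of n] by (intro divide_nonneg_pos integral_nonneg_AE) (auto intro!: AE_I2)
  have p_le: "p n \<xi> \<le> C / pi" for n \<xi>
  proof -
    have "- Im (cauchy_transform \<nu> (Complex \<xi> (\<epsilon> n))) \<le> C"
      using bound[of "Complex \<xi> (\<epsilon> n)"] \<epsilon>[of n] abs_Im_le_cmod[of "cauchy_transform \<nu> (Complex \<xi> (\<epsilon> n))"]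
      by simp
    then show ?thesis unfolding p_def by (intro divide_right_mono) auto
  qed
  have kernel_meas [measurable]: "(\<lambda>(\<xi>, t). \<epsilon> n / ((\<xi> - t)\<^sup>2 + (\<epsilon> n)\<^sup>2)) \<in> borel_measurable (lborel \<Otimes>\<^sub>M \<nu>)" for n
    by measurable
  have p_meas [measurable]: "p n \<in> borel_measurable lborel" for n
    unfolding p_eq[abs_def] by measurable
  have f_meas [measurable]: "f \<in> borel_measurable lborel"
    by (rule borel_measurable_LIMSEQ_real[OF p_lim p_meas])
  have f_nonneg: "0 \<le> f \<xi>" for \<xi>
    using p_lim by (rule LIMSEQ_le_const) (use p_nonneg in auto)
  have f_le: "f \<xi> \<le> C / pi" for \<xi>
    using p_lim by (rule LIMSEQ_le_const2) (use p_le in auto)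
  have C: "0 \<le> C / pi" using f_nonneg f_le order_trans by blast
  have C0: "0 \<le> C" using C pi_gt_zero by (auto simp: zero_le_divide_iff)
  define h where "h a b t = (sgn (b - t) - sgn (a - t)) / 2" for a b t :: real
  have int_ind: "integrable lborel (\<lambda>\<xi>. indicator {a..b} \<xi> * c)" for a b c :: real
    by (intro integrable_mult_left integrable_real_indicator) (auto simp: emeasure_lborel_Icc_eq)
  have f_int: "integrable lborel (\<lambda>\<xi>. indicator {a..b} \<xi> * f \<xi>)" for a b
  proof (rule Bochner_Integration.integrable_bound[OF int_ind[of a b "C / pi"]])
    show "AE \<xi> in lborel. norm (indicator {a..b} \<xi> * f \<xi>) \<le> norm (indicator {a..b} \<xi> * (C / pi))"
      using f_nonneg f_le C0 by (intro AE_I2) (auto simp: indicator_def)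
  qed measurable
  have main: "(\<integral>\<xi>. indicator {a..b} \<xi> * f \<xi> \<partial>lborel) = (\<integral>t. h a b t \<partial>\<nu>)" if ab: "a < b" for a b
  proof (rule LIMSEQ_unique)
    show "(\<lambda>n. \<integral>\<xi>. indicator {a..b} \<xi> * p n \<xi> \<partial>lborel) \<longlonglongrightarrow> (\<integral>\<xi>. indicator {a..b} \<xi> * f \<xi> \<partial>lborel)"
    proof (rule integral_dominated_convergence[OF _ _ int_ind[of a b "C / pi"]])
      show "AE \<xi> in lborel. (\<lambda>n. indicator {a..b} \<xi> * p n \<xi>) \<longlonglongrightarrow> indicator {a..b} \<xi> * f \<xi>"
        by (intro AE_I2 tendsto_intros p_lim)
      show "AE \<xi> in lborel. norm (indicator {a..b} \<xi> * p n \<xi>) \<le> indicator {a..b} \<xi> * (C / pi)" for n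
        using p_nonneg p_le by (intro AE_I2) (auto simp: indicator_def)
    qed measurable
    have swap: "(\<integral>\<xi>. indicator {a..b} \<xi> * p n \<xi> \<partial>lborel)
      = (\<integral>t. (arctan ((b - t) / \<epsilon> n) - arctan ((a - t) / \<epsilon> n)) / pi \<partial>\<nu>)" for n
    proof -
      interpret P: pair_sigma_finite lborel \<nu> ..
      let ?k = "\<lambda>\<xi> t. indicator {a..b} \<xi> * (\<epsilon> n / ((\<xi> - t)\<^sup>2 + (\<epsilon> n)\<^sup>2))"
      have k_bound: "\<bar>\<epsilon> n / ((\<xi> - t)\<^sup>2 + (\<epsilon> n)\<^sup>2)\<bar> \<le> 1 / \<epsilon> n" for \<xi> t
      proof -
        have "\<epsilon> n / ((\<xi> - t)\<^sup>2 + (\<epsilon> n)\<^sup>2) \<le> \<epsilon> n / (\<epsilon> n)\<^sup>2"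
          using \<epsilon>[of n] by (intro divide_left_mono) (auto intro!: mult_pos_pos add_nonneg_pos)
        also have "\<dots> = 1 / \<epsilon> n" by (simp add: power2_eq_square)
        finally show ?thesis using \<epsilon>[of n] by simp
      qed
      have int_k: "integrable \<nu> (\<lambda>t. ?k \<xi> t)" for \<xi>
        by (rule integrable_const_bound[where B = "1 / \<epsilon> n"])
           (use k_bound \<epsilon>[of n] in \<open>auto simp: indicator_def\<close>)
      have "integrable (lborel \<Otimes>\<^sub>M \<nu>) (\<lambda>(\<xi>, t). ?k \<xi> t)"
      proof (rule P.Fubini_integrable)
        show "integrable lborel (\<lambda>\<xi>. \<integral>t. norm (case (\<xi>, t) of (\<xi>, t) \<Rightarrow> ?k \<xi> t) \<partial>\<nu>)"
        proof (rule Bochner_Integration.integrable_bound[OF int_ind[of a b "1 / \<epsilon> n"]])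
          show "AE \<xi> in lborel. norm (\<integral>t. norm (case (\<xi>, t) of (\<xi>, t) \<Rightarrow> ?k \<xi> t) \<partial>\<nu>)
              \<le> norm (indicator {a..b} \<xi> * (1 / \<epsilon> n))"
          proof (rule AE_I2)
            fix \<xi>
            have "(\<integral>t. norm (?k \<xi> t) \<partial>\<nu>) \<le> (\<integral>t. indicator {a..b} \<xi> * (1 / \<epsilon> n) \<partial>\<nu>)"
            proof (rule integral_mono)
              show "integrable \<nu> (\<lambda>t. norm (?k \<xi> t))" by (rule integrable_norm[OF int_k])
              show "norm (?k \<xi> t) \<le> indicator {a..b} \<xi> * (1 / \<epsilon> n)" for t
                using k_bound[of \<xi> t] by (auto simp: indicator_def)
            qed simp
            also have "\<dots> = indicator {a..b} \<xi> * (1 / \<epsilon> n)" using prob_space by simp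
            finally show "norm (\<integral>t. norm (case (\<xi>, t) of (\<xi>, t) \<Rightarrow> ?k \<xi> t) \<partial>\<nu>)
              \<le> norm (indicator {a..b} \<xi> * (1 / \<epsilon> n))"
              using \<epsilon>[of n] by (simp add: abs_of_nonneg integral_nonneg_AE)
          qed
        qed measurable
        show "AE \<xi> in lborel. integrable \<nu> (\<lambda>t. case (\<xi>, t) of (\<xi>, t) \<Rightarrow> ?k \<xi> t)"
          using int_k by simp
      qed measurable
      from P.Fubini_integral[OF this]
      have "(\<integral>\<xi>. (\<integral>t. ?k \<xi> t \<partial>\<nu>) \<partial>lborel) = (\<integral>t. (\<integral>\<xi>. ?k \<xi> t \<partial>lborel) \<partial>\<nu>)"
        by simp
      also have "(\<lambda>t. \<integral>\<xi>. ?k \<xi> t \<partial>lborel) = (\<lambda>t. arctan ((b - t) / \<epsilon> n) - arctan ((a - t) / \<epsilon> n))"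
        using poisson_kernel_integral[OF \<epsilon>[of n], of a b] ab
        by (simp add: set_lebesgue_integral_def)
      also have "(\<lambda>\<xi>. \<integral>t. ?k \<xi> t \<partial>\<nu>) = (\<lambda>\<xi>. pi * (indicator {a..b} \<xi> * p n \<xi>))"
      proof
        fix \<xi>
        have "(\<integral>t. \<epsilon> n / ((\<xi> - t)\<^sup>2 + (\<epsilon> n)\<^sup>2) \<partial>\<nu>) = pi * p n \<xi>" by (simp add: p_eq)
        then show "(\<integral>t. ?k \<xi> t \<partial>\<nu>) = pi * (indicator {a..b} \<xi> * p n \<xi>)"
          by (simp only: integral_mult_right_zero mult.left_commute)
      qed
      finally show ?thesis by (simp add: field_simps)
    qed
    have "(\<lambda>n. \<integral>t. (arctan ((b - t) / \<epsilon> n) - arctan ((a - t) / \<epsilon> n)) / pi \<partial>\<nu>) \<longlonglongrightarrow> (\<integral>t. h a b t \<partial>\<nu>)"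
    proof (rule integral_dominated_convergence[where w = "\<lambda>_. 1"])
      show "AE t in \<nu>. (\<lambda>n. (arctan ((b - t) / \<epsilon> n) - arctan ((a - t) / \<epsilon> n)) / pi) \<longlonglongrightarrow> h a b t"
      proof (rule AE_I2)
        fix t
        have "(\<lambda>n. (arctan ((b - t) * real (Suc n)) - arctan ((a - t) * real (Suc n))) / pi)
            \<longlonglongrightarrow> (sgn (b - t) * (pi / 2) - sgn (a - t) * (pi / 2)) / pi"
          by (intro tendsto_intros arctan_scaled_tendsto) simp
        also have "(sgn (b - t) * (pi / 2) - sgn (a - t) * (pi / 2)) / pi = h a b t"
          by (simp add: h_def diff_divide_distrib)
        finally show "(\<lambda>n. (arctan ((b - t) / \<epsilon> n) - arctan ((a - t) / \<epsilon> n)) / pi) \<longlonglongrightarrow> h a b t"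
          by (simp add: \<epsilon>_def)
      qed
      show "AE t in \<nu>. norm ((arctan ((b - t) / \<epsilon> n) - arctan ((a - t) / \<epsilon> n)) / pi) \<le> 1" for n
      proof (rule AE_I2)
        fix t
        show "norm ((arctan ((b - t) / \<epsilon> n) - arctan ((a - t) / \<epsilon> n)) / pi) \<le> 1"
          using arctan_bounded[of "(b - t) / \<epsilon> n"] arctan_bounded[of "(a - t) / \<epsilon> n"]
          by (simp add: abs_le_iff)
      qed
    qed (auto simp: h_def[abs_def])
    then show "(\<lambda>n. \<integral>\<xi>. indicator {a..b} \<xi> * p n \<xi> \<partial>lborel) \<longlonglongrightarrow> (\<integral>t. h a b t \<partial>\<nu>)"
      unfolding swap .
  qed
  have h_int: "integrable \<nu> (h a b)" for a b
    by (rule integrable_const_bound[where B = 1]) (auto simp: h_def[abs_def] sgn_if)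
  have no_atom: "measure \<nu> {a} = 0" for a
  proof (rule ccontr)
    assume "measure \<nu> {a} \<noteq> 0"
    then have m: "measure \<nu> {a} > 0" by (simp add: measure_nonneg less_le)
    \<comment> \<open>An interval \<open>[a, a + d]\<close> so short that its mass, at most \<open>d C / \<pi>\<close>, is less than half of the atom.\<close>
    define d where "d = measure \<nu> {a} / (4 * (C / pi + 1))"
    have d: "d > 0" using m C by (simp add: d_def)
    have "measure \<nu> {a} / 2 = (\<integral>t. indicator {a} t / 2 \<partial>\<nu>)" by simp
    also have "\<dots> \<le> (\<integral>t. h a (a + d) t \<partial>\<nu>)"
    proof (rule integral_mono[OF _ h_int])
      show "integrable \<nu> (\<lambda>t. indicator {a} t / 2 :: real)"
        by (rule integrable_const_bound[where B = 1]) (auto simp: indicator_def intro!: AE_I2)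
    qed (use d in \<open>auto simp: h_def sgn_if indicator_def\<close>)
    also have "\<dots> = (\<integral>\<xi>. indicator {a..a + d} \<xi> * f \<xi> \<partial>lborel)"
      using main[of a "a + d"] d by simp
    also have "\<dots> \<le> (\<integral>\<xi>. indicator {a..a + d} \<xi> * (C / pi) \<partial>lborel)"
      using f_le by (intro integral_mono f_int int_ind) (auto simp: indicator_def)
    also have "\<dots> = d * (C / pi)" using d by simp
    also have "\<dots> \<le> d * (C / pi + 1)" using d by (intro mult_left_mono) auto
    also have "\<dots> = measure \<nu> {a} / 4" proof -
      have "C / pi + 1 \<noteq> 0" using C by linarith
      moreover have "x / (4 * y) * y = x / 4" if "y \<noteq> 0" for x y :: real using that by simp
      ultimately show ?thesis unfolding d_def by blast
    qed
    finally show False using m by simp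
  qed
  show ?thesis
  proof (rule measure_eqI_Ioc)
    fix a b :: real assume ab: "a < b"
    have neq: "AE t in \<nu>. t \<noteq> c" for c
      by (rule AE_I[where N = "{c}"]) (auto simp: emeasure_eq_measure no_atom)
    have "(\<integral>t. indicator {a<..b} t \<partial>\<nu>) = (\<integral>t. h a b t \<partial>\<nu>)"
    proof (rule integral_cong_AE)
      show "AE t in \<nu>. indicator {a<..b} t = h a b t"
        using neq[of a] neq[of b]
        by eventually_elim (use ab in \<open>auto simp: h_def sgn_if indicator_def\<close>)
    qed (auto simp: h_def[abs_def])
    then have "measure \<nu> {a<..b} = (\<integral>t. h a b t \<partial>\<nu>)" by simp
    also have "\<dots> = (\<integral>\<xi>. indicator {a..b} \<xi> * f \<xi> \<partial>lborel)" by (rule main[OF ab, symmetric])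
    also have "ennreal \<dots> = (\<integral>\<^sup>+\<xi>. ennreal (indicator {a..b} \<xi> * f \<xi>) \<partial>lborel)"
      using f_nonneg by (intro nn_integral_eq_integral[symmetric] f_int) auto
    also have "\<dots> = (\<integral>\<^sup>+\<xi>. ennreal (f \<xi>) * indicator {a<..b} \<xi> \<partial>lborel)"
    proof (rule nn_integral_cong_AE)
      have "AE \<xi> in lborel. \<xi> \<noteq> a" by (rule AE_lborel_singleton)
      then show "AE \<xi> in lborel. ennreal (indicator {a..b} \<xi> * f \<xi>) = ennreal (f \<xi>) * indicator {a<..b} \<xi>"
        by eventually_elim (auto simp: indicator_def)
    qed
    also have "\<dots> = emeasure (density lborel (\<lambda>\<xi>. ennreal (f \<xi>))) {a<..b}"
      by (rule emeasure_density[symmetric]) auto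
    finally show "emeasure \<nu> {a<..b} = emeasure (density lborel (\<lambda>\<xi>. ennreal (f \<xi>))) {a<..b}"
      by (simp add: emeasure_eq_measure)
  qed auto
qed

section \<open>The law of the free Gamma distribution\<close>

lemma free_gamma_right_inverse:
  assumes \<alpha>: "\<alpha> > 0" and law: "is_free_gamma_law \<alpha> \<nu>"
  obtains M where "M > 0" "\<And>y. y > M \<Longrightarrow> Im (fg_H \<alpha> (\<i> * of_real y)) > 0"
    "\<And>y. y > M \<Longrightarrow> cauchy_transform \<nu> (fg_H \<alpha> (\<i> * of_real y)) = inverse (\<i> * of_real y)"
proof -
  obtain a \<rho> \<eta> where prob: "prob_space (gamma_law \<alpha>)"
    and lk: "levy_khintchine_triplet (gamma_law \<alpha>) a \<rho> \<eta>"
    and fc: "has_free_cumulant_transform \<nu> (free_levy_khintchine a \<rho> \<eta>)"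
    using law unfolding is_free_gamma_law_def bercovici_pata_def real_distribution_def
    by (elim exE conjE) (rule that; assumption)
  obtain \<theta> M0 \<theta>' M where M: "M0 > 0" "\<theta>' > 0" "M > 0"
    and sub: "inverse ` truncated_cone \<theta>' M \<subseteq> cauchy_transform \<nu> ` truncated_cone \<theta> M0"
    and C: "\<forall>z \<in> inverse ` truncated_cone \<theta>' M. free_levy_khintchine a \<rho> \<eta> z
      = z * inv_into (truncated_cone \<theta> M0) (cauchy_transform \<nu>) z - 1"
    using fc unfolding has_free_cumulant_transform_def
    by (elim exE conjE) (rule that; assumption)
  have "Im (fg_H \<alpha> (\<i> * of_real y)) > 0 \<and>
      cauchy_transform \<nu> (fg_H \<alpha> (\<i> * of_real y)) = inverse (\<i> * of_real y)" if y: "y > M" for y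
  proof -
    define w where "w = \<i> * of_real y"
    have w0: "w \<noteq> 0" using y M by (simp add: w_def)
    have "w \<in> truncated_cone \<theta>' M" using y M by (simp add: truncated_cone_def w_def)
    then have iw: "inverse w \<in> inverse ` truncated_cone \<theta>' M" by (rule imageI)
    then have iw': "inverse w \<in> cauchy_transform \<nu> ` truncated_cone \<theta> M0" using sub by blast
    define g where "g = inv_into (truncated_cone \<theta> M0) (cauchy_transform \<nu>) (inverse w)"
    have g: "g \<in> truncated_cone \<theta> M0" "cauchy_transform \<nu> g = inverse w"
      unfolding g_def by (rule inv_into_into[OF iw'], rule f_inv_into_f[OF iw'])
    have "g = w * (1 + free_levy_khintchine a \<rho> \<eta> (inverse w))"
      unfolding bspec[OF C iw] g_def[symmetric] using w0 by simp
    also have "\<dots> = fg_H \<alpha> w"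
      unfolding w_def using y M by (intro free_gamma_inverse_on_imaginary_axis[OF \<alpha> prob lk]) simp
    finally have eq: "fg_H \<alpha> w = g" by (rule sym)
    show ?thesis using g M(1) unfolding w_def[symmetric] eq by (simp add: truncated_cone_def)
  qed
  with M(3) show ?thesis by (intro that) auto
qed

text \<open>
  \<open>1 / G\<close> maps the upper half plane into itself, where \<open>H\<close> is holomorphic, so the left side is
  holomorphic on the whole half plane. By \<open>free_gamma_right_inverse\<close> the equation holds on the image
  under \<open>H\<close> of a piece of the imaginary axis. This image has a limit point in the half plane because \<open>H\<close> is
  continuous and injective on that piece.
\<close>

lemma free_gamma_subordination:
  assumes \<alpha>: "\<alpha> > 0" and \<nu>: "real_distribution \<nu>" and law: "is_free_gamma_law \<alpha> \<nu>" and z: "Im z > 0"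
  shows "fg_H \<alpha> (inverse (cauchy_transform \<nu> z)) = z"
proof -
  define G where "G = cauchy_transform \<nu>"
  define S where "S = {z::complex. Im z > 0}"
  have S: "open S" "connected S"
    unfolding S_def by (auto intro: open_halfspace_Im_gt convex_connected convex_halfspace_Im_gt)
  obtain M where M: "M > 0" "\<And>y. y > M \<Longrightarrow> Im (fg_H \<alpha> (\<i> * of_real y)) > 0"
    "\<And>y. y > M \<Longrightarrow> G (fg_H \<alpha> (\<i> * of_real y)) = inverse (\<i> * of_real y)"
    using free_gamma_right_inverse[OF \<alpha> law] unfolding G_def by blast
  have G0: "G z \<noteq> 0" "inverse (G z) \<in> slit_plane" if "z \<in> S" for z
  proof -
    have neg: "Im (G z) < 0" using Im_cauchy_transform_neg[OF \<nu>] that by (simp add: G_def S_def)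
    then show "G z \<noteq> 0" by auto
    then have "(cmod (G z))\<^sup>2 > 0" by simp
    then show "inverse (G z) \<in> slit_plane"
      using neg by (simp add: slit_plane_def cmod_power2)
  qed
  define h where "h y = fg_H \<alpha> (\<i> * of_real y)" for y :: real
  have "fg_H \<alpha> (inverse (G z)) - z = 0"
  proof (rule analytic_continuation[of "\<lambda>z. fg_H \<alpha> (inverse (G z)) - z" S "h ` {M<..}" "h (M + 1)"])
    have "(\<lambda>z. inverse (G z)) holomorphic_on S"
      using G0(1) cauchy_transform_holomorphic_upper[OF \<nu>]
      by (intro holomorphic_intros) (auto simp: G_def S_def)
    then have "(fg_H \<alpha> \<circ> (\<lambda>z. inverse (G z))) holomorphic_on S"
      using G0(2) by (intro holomorphic_on_compose_gen[OF _ fg_H_holomorphic]) auto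
    then show "(\<lambda>z. fg_H \<alpha> (inverse (G z)) - z) holomorphic_on S"
      unfolding o_def by (intro holomorphic_intros)
    show "h ` {M<..} \<subseteq> S" using M(2) by (auto simp: S_def h_def)
    show "h (M + 1) \<in> S" using M(2)[of "M + 1"] by (simp add: S_def h_def)
    show "h (M + 1) islimpt h ` {M<..}"
    proof (rule islimpt_isCont_image)
      show "M + 1 islimpt {M<..}" by (rule interior_limit_point) (simp add: interior_open)
      have "\<i> * of_real (M + 1) \<in> slit_plane" using M(1) by (simp add: slit_plane_def)
      then show "isCont h (M + 1)"
        unfolding h_def by (intro isCont_o2[OF _ isCont_fg_H] continuous_intros)
      have "h y \<noteq> h (M + 1)" if "y > M" "y \<noteq> M + 1" for y
      proof
        assume "h y = h (M + 1)"
        then have "inverse (\<i> * of_real y) = inverse (\<i> * of_real (M + 1))"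
          using M(3)[of y] M(3)[of "M + 1"] that by (simp add: h_def)
        then have "\<i> * of_real y = \<i> * of_real (M + 1)" by (simp only: inverse_eq_iff_eq)
        then have "Im (\<i> * of_real y) = Im (\<i> * of_real (M + 1))" by (rule arg_cong)
        then show False using that(2) by simp
      qed
      moreover have "\<forall>\<^sub>F y in at (M + 1). y > M"
        by (rule eventually_at_in_open'[of "{M<..}", simplified]) simp
      ultimately show "\<forall>\<^sub>F y in at (M + 1). h y \<noteq> h (M + 1)"
        by (auto simp: eventually_at_filter elim!: eventually_mono)
    qed
    show "fg_H \<alpha> (inverse (G z)) - z = 0" if "z \<in> h ` {M<..}" for z
      using that M(3) by (auto simp: h_def)
  qed (use S z in \<open>auto simp: S_def\<close>)
  then show ?thesis by (simp add: G_def)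
qed

text \<open>
  \<open>H\<close> maps \<open>w = 1 / G z\<close> to \<open>z\<close>, which has positive imaginary part, and \<open>Im (H w) = Im w (1 - \<alpha> F w)\<close>.
\<close>

lemma inverse_cauchy_in_fg_region:
  assumes \<alpha>: "\<alpha> > 0" and \<nu>: "real_distribution \<nu>" and law: "is_free_gamma_law \<alpha> \<nu>" and z: "Im z > 0"
  shows "inverse (cauchy_transform \<nu> z) \<in> fg_region \<alpha>"
proof -
  define w where "w = inverse (cauchy_transform \<nu> z)"
  have neg: "Im (cauchy_transform \<nu> z) < 0" by (rule Im_cauchy_transform_neg[OF \<nu> z])
  then have "cauchy_transform \<nu> z \<noteq> 0" by auto
  then have "(cmod (cauchy_transform \<nu> z))\<^sup>2 > 0" by simp
  then have pos: "Im w > 0"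
    using neg by (simp add: w_def cmod_power2 divide_neg_pos)
  then have slit: "w \<in> slit_plane" by (simp add: slit_plane_def)
  have "Im (fg_H \<alpha> w) > 0"
    using free_gamma_subordination[OF \<alpha> \<nu> law z] z by (simp add: w_def)
  then have "1 - \<alpha> * fg_F w > 0"
    using pos by (simp add: Im_fg_H[OF slit] zero_less_mult_iff)
  then have "fg_F w \<le> 1 / \<alpha>" using \<alpha> by (simp add: field_simps)
  then show ?thesis using slit pos by (simp add: fg_region_def flip: w_def)
qed

lemma free_gamma_cauchy_bounded:
  assumes \<alpha>: "\<alpha> > 0" and \<nu>: "real_distribution \<nu>" and law: "is_free_gamma_law \<alpha> \<nu>"
  shows "\<exists>C. \<forall>z. Im z > 0 \<longrightarrow> cmod (cauchy_transform \<nu> z) \<le> C"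
proof -
  have "0 \<notin> fg_region \<alpha>" by (simp add: fg_region_def slit_plane_def)
  then have "\<exists>\<delta>>0. ball 0 \<delta> \<subseteq> - fg_region \<alpha>"
    using closed_fg_region[of \<alpha>] open_contains_ball[of "- fg_region \<alpha>"] by (auto simp: open_closed)
  then obtain \<delta> where \<delta>: "\<delta> > 0" "ball 0 \<delta> \<subseteq> - fg_region \<alpha>" by blast
  have "cmod (cauchy_transform \<nu> z) \<le> 1 / \<delta>" if z: "Im z > 0" for z
  proof -
    have "cauchy_transform \<nu> z \<noteq> 0" using Im_cauchy_transform_neg[OF \<nu> z] by auto
    moreover have "inverse (cauchy_transform \<nu> z) \<notin> ball 0 \<delta>"
      using inverse_cauchy_in_fg_region[OF \<alpha> \<nu> law z] \<delta>(2) by blast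
    then have "\<delta> \<le> inverse (cmod (cauchy_transform \<nu> z))" by (simp add: norm_inverse not_less)
    ultimately show ?thesis using \<delta>(1) by (simp add: field_simps)
  qed
  then show ?thesis by blast
qed

text \<open>
  As \<open>z\<close> tends to \<open>\<xi> = P x\<close>, the points \<open>1 / G z\<close> stay in a compact part \<open>K\<close> of the region. There \<open>H\<close> is
  injective, so its inverse is continuous on the image of \<open>K\<close>, and the points converge to the preimage
  \<open>x + \<i> v x\<close> of \<open>\<xi>\<close>.
\<close>

lemma free_gamma_boundary_limit:
  assumes \<alpha>: "\<alpha> > 0" and \<nu>: "real_distribution \<nu>" and law: "is_free_gamma_law \<alpha> \<nu>"
  shows "(\<lambda>n. - Im (cauchy_transform \<nu> (Complex \<xi> (1 / real (Suc n)))) / pi)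
    \<longlonglongrightarrow> free_gamma_density \<alpha> \<xi>"
proof -
  define z where "z n = Complex \<xi> (1 / real (Suc n))" for n
  define w where "w n = inverse (cauchy_transform \<nu> (z n))" for n
  have z_pos: "Im (z n) > 0" for n by (simp add: z_def)
  have Hw: "fg_H \<alpha> (w n) = z n" for n
    unfolding w_def by (rule free_gamma_subordination[OF \<alpha> \<nu> law z_pos])
  have w_region: "w n \<in> fg_region \<alpha>" for n
    unfolding w_def by (rule inverse_cauchy_in_fg_region[OF \<alpha> \<nu> law z_pos])
  obtain x where x: "fg_P \<alpha> x = \<xi>" using surj_fg_P[OF \<alpha>] by blast
  define l where "l = Complex x (fg_v \<alpha> x)"
  have l: "l \<in> fg_region \<alpha>" unfolding l_def by (rule graph_in_fg_curve(2)[OF \<alpha>])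
  have Hl: "fg_H \<alpha> l = of_real \<xi>" unfolding l_def fg_H_on_graph[OF \<alpha>] x ..
  have z_lim: "z \<longlonglongrightarrow> of_real \<xi>"
    using tendsto_Complex[OF tendsto_const[of \<xi>] LIMSEQ_inverse_real_of_nat]
    by (simp add: z_def[abs_def] complex_of_real_def inverse_eq_divide)
  define K where "K = fg_region \<alpha> \<inter> cball 0 (\<bar>\<xi>\<bar> + 1 + \<alpha> + sqrt \<alpha>)"
  have "compact K" unfolding K_def by (intro closed_Int_compact closed_fg_region compact_cball)
  have in_K: "u \<in> K" if "u \<in> fg_region \<alpha>" "cmod (fg_H \<alpha> u) \<le> \<bar>\<xi>\<bar> + 1" for u
  proof -
    have "cmod u = cmod ((fg_H \<alpha> u - of_real \<alpha>) - (fg_H \<alpha> u - u - of_real \<alpha>))" by simp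
    also have "\<dots> \<le> cmod (fg_H \<alpha> u - of_real \<alpha>) + cmod (fg_H \<alpha> u - u - of_real \<alpha>)"
      by (rule norm_triangle_ineq4)
    finally have "cmod u \<le> cmod (fg_H \<alpha> u) + cmod (of_real \<alpha> :: complex) + cmod (fg_H \<alpha> u - u - of_real \<alpha>)"
      using norm_triangle_ineq4[of "fg_H \<alpha> u" "of_real \<alpha>"] by linarith
    then show ?thesis
      using that fg_H_near_shift[OF \<alpha> that(1)] \<alpha> by (simp add: K_def)
  qed
  have wK: "w n \<in> K" for n
  proof (rule in_K[OF w_region])
    have "cmod (z n) \<le> \<bar>Re (z n)\<bar> + \<bar>Im (z n)\<bar>" by (rule cmod_le)
    also have "\<dots> \<le> \<bar>\<xi>\<bar> + 1" by (simp add: z_def)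
    finally show "cmod (fg_H \<alpha> (w n)) \<le> \<bar>\<xi>\<bar> + 1" by (simp add: Hw)
  qed
  have lK: "l \<in> K" by (rule in_K[OF l]) (simp add: Hl)
  have inj: "inj_on (fg_H \<alpha>) K"
    by (rule inj_on_subset[OF inj_on_fg_H[OF \<alpha>]]) (simp add: K_def)
  have cont: "continuous_on K (fg_H \<alpha>)"
    by (intro continuous_at_imp_continuous_on ballI isCont_fg_H) (auto simp: K_def fg_region_def)
  have "continuous_on (fg_H \<alpha> ` K) (the_inv_into K (fg_H \<alpha>))"
    by (rule continuous_on_inv[OF cont \<open>compact K\<close>]) (simp add: the_inv_into_f_f[OF inj])
  then have "(\<lambda>n. the_inv_into K (fg_H \<alpha>) (z n)) \<longlonglongrightarrow> the_inv_into K (fg_H \<alpha>) (of_real \<xi>)"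
  proof (rule continuous_on_tendsto_compose[OF _ z_lim])
    show "of_real \<xi> \<in> fg_H \<alpha> ` K" using imageI[OF lK, of "fg_H \<alpha>"] unfolding Hl .
    have "z n \<in> fg_H \<alpha> ` K" for n using imageI[OF wK, of "fg_H \<alpha>"] unfolding Hw .
    then show "\<forall>\<^sub>F n in sequentially. z n \<in> fg_H \<alpha> ` K" by (intro always_eventually allI)
  qed
  moreover have "the_inv_into K (fg_H \<alpha>) (z n) = w n" for n
    using the_inv_into_f_f[OF inj wK] unfolding Hw .
  moreover have "the_inv_into K (fg_H \<alpha>) (of_real \<xi>) = l"
    using the_inv_into_f_f[OF inj lK] unfolding Hl .
  ultimately have "w \<longlonglongrightarrow> l" by simp
  moreover have "l \<noteq> 0" using l by (auto simp: fg_region_def slit_plane_def)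
  ultimately have "(\<lambda>n. - Im (inverse (w n)) / pi) \<longlonglongrightarrow> - Im (inverse l) / pi"
    by (intro tendsto_divide tendsto_minus tendsto_Im tendsto_inverse tendsto_const) auto
  moreover have "- Im (inverse l) / pi = free_gamma_density \<alpha> \<xi>"
    unfolding x[symmetric] free_gamma_density_fg_P[OF \<alpha>]
    by (simp add: l_def fg_Q_def)
  ultimately show ?thesis by (simp add: w_def z_def)
qed

theorem proposition4p1:
  fixes \<alpha> :: real
  assumes "\<alpha> > 0"
  shows "(\<forall>\<nu>. is_free_gamma_law \<alpha> \<nu> \<longrightarrow>
            \<nu> = density lborel (\<lambda>\<xi>. ennreal (free_gamma_density \<alpha> \<xi>))) \<and>
         ((\<lambda>\<xi>. free_gamma_density \<alpha> \<xi> / (inverse \<xi> * exp (- \<xi>)))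
            \<longlongrightarrow> \<alpha> * exp \<alpha>) at_top"
proof (intro conjI allI impI)
  fix \<nu> assume law: "is_free_gamma_law \<alpha> \<nu>"
  then have \<nu>: "real_distribution \<nu>" by (simp add: is_free_gamma_law_def bercovici_pata_def)
  obtain C where "\<And>z. Im z > 0 \<Longrightarrow> cmod (cauchy_transform \<nu> z) \<le> C"
    using free_gamma_cauchy_bounded[OF assms \<nu> law] by blast
  then show "\<nu> = density lborel (\<lambda>\<xi>. ennreal (free_gamma_density \<alpha> \<xi>))"
    by (rule stieltjes_inversion[OF \<nu> _ free_gamma_boundary_limit[OF assms \<nu> law]])
qed (rule free_gamma_density_asymp[OF assms])

end
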